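(* Let $\Omega\subset\mathbb{C}^{n}$ be a bounded domain, and let $\rho:\Omega\to[-1,0)$ be a smooth strictly plurisubharmonic exhaustion function. Put $g=-\log(-\rho)$ and $\omega=dd^{c}g$. Assume that $$\int_{\Omega}(-\rho)^{\varepsilon}(dd^{c}\rho)^{n}<+\infty\quad\text{for every }\varepsilon>0.$$ Then $(\Omega,\omega)$ is complete and $$\lambda_{0}(\Delta_{\omega},\Omega)=n^{2}.$$ In particular, the conclusion holds if $\rho$ has finite Monge--Amp\`ere mass, namely $\int_{\Omega}(dd^{c}\rho)^{n}<+\infty$.
   Context: Conventions: $d^{c}u=\frac{\sqrt{-1}}{2}(\bar\partial-\partial)u$, so $dd^{c}u=\sqrt{-1}\,\partial\bar\partial u$. Subscripts denote derivatives: $u_i=\partial u/\partial z^i$, $u_{\bar j}=\partial u/\partial\bar z^j$, $u_{i\bar j}=\partial^2u/\partial z^i\partial\bar z^j$. A smooth strictly plurisubharmonic function is one whose complex Hessian $(\rho_{i\bar j})$ is positive definite at every point. A function $\rho:\Omega\to[-1,0)$ is an exhaustion function if $\{z\in\Omega:\rho(z)<c\}\Subset\Omega$ (relatively compact in $\Omega$) for every $c<0$. The form $\omega=dd^{c}g=\sqrt{-1}\sum_{i,j} g_{i\bar j}\,dz^i\wedge d\bar z^j$ is identified with the K\"ahler metric with tensor $(g_{i\bar j})$; completeness means completeness of the associated Riemannian metric. Write $(g^{\bar j i})=(g_{i\bar j})^{-1}$. The Laplace--Beltrami operator is $\Delta_{\omega}=-4\sum_{i,j=1}^{n}g^{\bar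 j i}\frac{\partial^{2}}{\partial z^{i}\partial\bar z^{j}}$, and the bottom of its spectrum is defined by $$\lambda_{0}(\Delta_{\omega},\Omega)=\inf\left\{\frac{4\int_{\Omega}\sum_{i,j=1}^{n}g^{\bar j i}f_{i}f_{\bar j}\,\omega^{n}}{\int_{\Omega}|f|^{2}\,\omega^{n}}\;:\;0\neq f\in C_{0}^{\infty}(\Omega)\right\},$$ with $C_0^\infty(\Omega)$ the (real-valued) smooth compactly supported functions and $\omega^n$ the $n$-fold wedge power, used as the reference volume measure. *)

theory Defs
  imports "HOL-Analysis.Analysis"
begin

section \<open>Smooth functions and Wirtinger derivatives\<close>

text \<open>
  Intended for open sets \<open>S\<close>: all iterated directional derivatives exist and are continuous.
\<close>

primrec Ck_on :: "nat \<Rightarrow> ('a::real_normed_vector) set \<Rightarrow> ('a \<Rightarrow> 'b::real_normed_vector) \<Rightarrow> bool"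
where
  "Ck_on 0 S f \<longleftrightarrow> continuous_on S f"
| "Ck_on (Suc k) S f \<longleftrightarrow>
     (\<forall>x\<in>S. f differentiable (at x)) \<and> (\<forall>v. Ck_on k S (\<lambda>x. frechet_derivative f (at x) v))"

definition smooth_on :: "('a::real_normed_vector) set \<Rightarrow> ('a \<Rightarrow> 'b::real_normed_vector) \<Rightarrow> bool"
  where "smooth_on S f \<longleftrightarrow> (\<forall>k. Ck_on k S f)"

text \<open>
  With \<open>z\<^sup>j = x\<^sup>j + \<i> y\<^sup>j\<close>, the vectors \<open>axis j 1\<close> and \<open>axis j \<i>\<close> are the real coordinate directions
  \<open>\<partial>/\<partial>x\<^sup>j\<close> and \<open>\<partial>/\<partial>y\<^sup>j\<close> of \<open>\<complex>\<^sup>n\<close>.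
\<close>

definition d_z :: "'n \<Rightarrow> (complex^'n::finite \<Rightarrow> complex) \<Rightarrow> complex^'n \<Rightarrow> complex"
  where "d_z j u z =
    (frechet_derivative u (at z) (axis j 1) - \<i> * frechet_derivative u (at z) (axis j \<i>)) / 2"

definition d_zbar :: "'n \<Rightarrow> (complex^'n::finite \<Rightarrow> complex) \<Rightarrow> complex^'n \<Rightarrow> complex"
  where "d_zbar j u z =
    (frechet_derivative u (at z) (axis j 1) + \<i> * frechet_derivative u (at z) (axis j \<i>)) / 2"

text \<open>Row \<open>i\<close>, column \<open>j\<close> holds the derivative with respect to \<open>z\<^sup>i\<close> and the conjugate of \<open>z\<^sup>j\<close>.\<close>

definition complex_hessian :: "(complex^'n::finite \<Rightarrow> real) \<Rightarrow> complex^'n \<Rightarrow> complex^'n^'n"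
  where "complex_hessian u z = (\<chi> i j. d_z i (d_zbar j (\<lambda>w. complex_of_real (u w))) z)"


section \<open>Strictly plurisubharmonic exhaustion functions\<close>

text \<open>Requiring the sesquilinear form to be real-valued on the diagonal makes \<open>H\<close> Hermitian.\<close>

definition pos_def_matrix :: "complex^'n^'n::finite \<Rightarrow> bool"
  where "pos_def_matrix H \<longleftrightarrow>
    (\<forall>v. v \<noteq> 0 \<longrightarrow>
      Im (\<Sum>i\<in>UNIV. \<Sum>j\<in>UNIV. H$i$j * v$i * cnj (v$j)) = 0 \<and>
      Re (\<Sum>i\<in>UNIV. \<Sum>j\<in>UNIV. H$i$j * v$i * cnj (v$j)) > 0)"

definition smooth_strictly_psh_on :: "(complex^'n::finite) set \<Rightarrow> (complex^'n \<Rightarrow> real) \<Rightarrow> bool"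
  where "smooth_strictly_psh_on \<Omega> u \<longleftrightarrow>
    smooth_on \<Omega> u \<and> (\<forall>z\<in>\<Omega>. pos_def_matrix (complex_hessian u z))"

definition exhaustion_function_on :: "(complex^'n::finite) set \<Rightarrow> (complex^'n \<Rightarrow> real) \<Rightarrow> bool"
  where "exhaustion_function_on \<Omega> \<rho> \<longleftrightarrow>
    \<rho> ` \<Omega> \<subseteq> {-1..<0} \<and>
    (\<forall>c<0. compact (closure {z\<in>\<Omega>. \<rho> z < c}) \<and> closure {z\<in>\<Omega>. \<rho> z < c} \<subseteq> \<Omega>)"


section \<open>Real two-forms, wedge powers and Monge-Ampere measures\<close>

type_synonym 'n two_form = "complex^'n \<Rightarrow> complex^'n \<Rightarrow> real"

text \<open>
  The constant-coefficient form \<open>\<i> \<Sum> H\<^sub>i\<^sub>j dz\<^sup>i \<and> cnj dz\<^sup>j\<close>, as an alternating bilinear form on the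
  real vector space \<open>\<complex>\<^sup>n\<close>, where
  \<open>(dz\<^sup>i \<and> cnj dz\<^sup>j)(v, w) = v\<^sub>i * cnj w\<^sub>j - w\<^sub>i * cnj v\<^sub>j\<close>.
  Its values are real for Hermitian \<open>H\<close>, so \<open>Re\<close> is only a coercion.
\<close>

definition fundamental_form :: "complex^'n^'n::finite \<Rightarrow> 'n two_form"
  where "fundamental_form H v w =
    Re (\<i> * (\<Sum>i\<in>UNIV. \<Sum>j\<in>UNIV. H$i$j * (v$i * cnj (w$j) - w$i * cnj (v$j))))"

definition ddc :: "(complex^'n::finite \<Rightarrow> real) \<Rightarrow> complex^'n \<Rightarrow> 'n two_form"
  where "ddc u z = fundamental_form (complex_hessian u z)"

text \<open>\<open>real_frame (k, False) = \<partial>/\<partial>x\<^sup>k\<close> and \<open>real_frame (k, True) = \<partial>/\<partial>y\<^sup>k\<close>.\<close>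

definition real_frame :: "'n \<times> bool \<Rightarrow> complex^'n::finite"
  where "real_frame p = axis (fst p) (if snd p then \<i> else 1)"

text \<open>
  The value of the \<open>n\<close>-fold wedge power of \<open>\<alpha>\<close> on \<open>(\<partial>/\<partial>x\<^sup>1, \<partial>/\<partial>y\<^sup>1, \<dots>, \<partial>/\<partial>x\<^sup>n, \<partial>/\<partial>y\<^sup>n)\<close>, by the
  alternation formula for the wedge product of \<open>n\<close> two-forms; equivalently, the coefficient of
  \<open>\<alpha>\<^sup>n\<close> with respect to \<open>dx\<^sup>1 \<and> dy\<^sup>1 \<and> \<dots> \<and> dx\<^sup>n \<and> dy\<^sup>n\<close>. Positions are labelled by \<open>'n \<times> bool\<close>;
  no ordering of the index type is needed, because reordering the pairs \<open>(x\<^sup>k, y\<^sup>k)\<close> is an even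
  permutation.
\<close>

definition top_wedge_power :: "('n::finite) two_form \<Rightarrow> real"
  where "top_wedge_power \<alpha> =
    (\<Sum>\<sigma> | \<sigma> permutes (UNIV :: ('n \<times> bool) set).
       of_int (sign \<sigma>) *
       (\<Prod>k\<in>UNIV. \<alpha> (real_frame (\<sigma> (k, False))) (real_frame (\<sigma> (k, True)))))
    / 2 ^ CARD('n)"

text \<open>
  The measure \<open>\<alpha>\<^sup>n\<close> on \<open>\<Omega>\<close> (extended by zero), \<open>\<complex>\<^sup>n\<close> carrying the orientation
  \<open>dx\<^sup>1 \<and> dy\<^sup>1 \<and> \<dots> \<and> dx\<^sup>n \<and> dy\<^sup>n\<close>; meant for fields of nonnegative forms, as
  \<open>ennreal\<close> truncates negative densities.
\<close>

definition wedge_power_measure ::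
    "(complex^'n::finite) set \<Rightarrow> (complex^'n \<Rightarrow> 'n two_form) \<Rightarrow> (complex^'n) measure"
  where "wedge_power_measure \<Omega> \<alpha> =
    density lborel (\<lambda>z. ennreal (top_wedge_power (\<alpha> z)) * indicator \<Omega> z)"


section \<open>The Riemannian distance of a Hermitian metric\<close>

definition hermitian_norm :: "complex^'n^'n::finite \<Rightarrow> complex^'n \<Rightarrow> real"
  where "hermitian_norm H v = sqrt (Re (\<Sum>i\<in>UNIV. \<Sum>j\<in>UNIV. H$i$j * v$i * cnj (v$j)))"

text \<open>
  The library's piecewise \<open>C\<^sup>1\<close> paths may have an unbounded derivative near the finitely many
  exceptional parameters, so lengths are taken in \<open>ennreal\<close>: a path of infinite length gets length
  \<open>\<infinity>\<close> and not the default value \<open>0\<close> of a divergent real integral.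
\<close>

definition path_length :: "(complex^'n::finite \<Rightarrow> complex^'n^'n) \<Rightarrow> (real \<Rightarrow> complex^'n) \<Rightarrow> ennreal"
  where "path_length H \<gamma> =
    (\<integral>\<^sup>+ t\<in>{0..1}. ennreal (hermitian_norm (H (\<gamma> t)) (vector_derivative \<gamma> (at t))) \<partial>lborel)"

definition riemannian_dist ::
    "(complex^'n::finite) set \<Rightarrow> (complex^'n \<Rightarrow> complex^'n^'n) \<Rightarrow> complex^'n \<Rightarrow> complex^'n \<Rightarrow> real"
  where "riemannian_dist \<Omega> H p q =
    enn2real (INF \<gamma>\<in>{\<gamma>. valid_path \<gamma> \<and> path_image \<gamma> \<subseteq> \<Omega> \<and> pathstart \<gamma> = p \<and> pathfinish \<gamma> = q}.
      path_length H \<gamma>)"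

definition complete_hermitian_metric ::
    "(complex^'n::finite) set \<Rightarrow> (complex^'n \<Rightarrow> complex^'n^'n) \<Rightarrow> bool"
  where "complete_hermitian_metric \<Omega> H \<longleftrightarrow>
    Metric_space \<Omega> (riemannian_dist \<Omega> H) \<and> Metric_space.mcomplete \<Omega> (riemannian_dist \<Omega> H)"


section \<open>The bottom of the spectrum\<close>

definition test_functions :: "(complex^'n::finite) set \<Rightarrow> (complex^'n \<Rightarrow> real) set"
  where "test_functions \<Omega> =
    {f. smooth_on UNIV f \<and> compact (closure {z. f z \<noteq> 0}) \<and> closure {z. f z \<noteq> 0} \<subseteq> \<Omega>}"

text \<open>
  \<open>\<Sum> g\<^sup>j\<^sup>i f\<^sub>i f\<^sub>j\<close>, with \<open>f\<^sub>i\<close> the \<open>z\<^sup>i\<close>-derivative, \<open>f\<^sub>j\<close> the derivative in the conjugate of \<open>z\<^sup>j\<close>,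
  and \<open>g\<^sup>j\<^sup>i\<close> the entry in row \<open>j\<close>, column \<open>i\<close> of \<open>H\<^sup>-\<^sup>1\<close>. It is real for Hermitian \<open>H\<close> and real \<open>f\<close>.
\<close>

definition gradient_sq :: "complex^'n^'n::finite \<Rightarrow> (complex^'n \<Rightarrow> real) \<Rightarrow> complex^'n \<Rightarrow> real"
  where "gradient_sq H f z =
    Re (\<Sum>i\<in>UNIV. \<Sum>j\<in>UNIV. matrix_inv H $ j $ i *
          d_z i (\<lambda>w. complex_of_real (f w)) z * d_zbar j (\<lambda>w. complex_of_real (f w)) z)"

definition bottom_spectrum ::
    "(complex^'n::finite) set \<Rightarrow> (complex^'n \<Rightarrow> complex^'n^'n) \<Rightarrow> real"
  where "bottom_spectrum \<Omega> H =
    (let \<mu> = wedge_power_measure \<Omega> (\<lambda>z. fundamental_form (H z)) in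
     Inf {4 * (\<integral>z\<in>\<Omega>. gradient_sq (H z) f z \<partial>\<mu>) / (\<integral>z\<in>\<Omega>. \<bar>f z\<bar>\<^sup>2 \<partial>\<mu>) | f.
           f \<in> test_functions \<Omega> \<and> f \<noteq> (\<lambda>z. 0)})"

end

theory Submission
  imports Defs "HOL-Complex_Analysis.Contour_Integration"
begin

text \<open>
  Write \<open>b = \<partial>g\<close>, \<open>H = (g\<^sub>i\<^sub>j)\<close> and \<open>t = |\<partial>g|\<^sup>2\<close> in the metric \<open>H\<close>. Since \<open>H\<close> is the Hessian of \<open>\<rho>\<close> divided by
  \<open>- \<rho>\<close> plus the rank one matrix \<open>b b\<^sup>*\<close>, one has \<open>t \<le> 1\<close>; hence \<open>g\<close> is a proper Lipschitz function,
  which gives completeness. Up to the factor \<open>2\<^sup>n n!\<close> the volume density is \<open>det H\<close>, and by the Piola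
  identity the vector field \<open>adj(H) b\<close> has divergence \<open>n det H\<close>, so that
  \<open>\<integral> (n f + \<langle>\<partial>g, \<partial>f\<rangle>) det H = 0\<close> for every test function \<open>f\<close>. Applied to \<open>f\<^sup>2\<close>, this and
  \<open>0 \<le> |\<partial>f + (n/2) f \<partial>g|\<^sup>2\<close> give the lower bound \<open>n\<^sup>2\<close>. For the upper bound take cutoffs of
  \<open>exp (- s g)\<close> with \<open>2 s > n\<close>, whose Rayleigh quotients tend to at most \<open>4 s\<^sup>2\<close> provided
  \<open>\<integral> exp (- 2 s g) det H\<close> is finite. The latter follows from the same integration by parts,
  because \<open>(1 - t) det H\<close> equals \<open>(- \<rho>)\<^sup>-\<^sup>n\<close> times the Monge-Ampere density of \<open>\<rho>\<close>.
\<close>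

section \<open>Smooth functions\<close>

text \<open>The coefficient n/2 in the lower bound is an optimum: with \<partial>f + a f \<partial>g
  the integration by parts gives energy at least (a n - a^2) times the mass, which is largest at a =
  n/2. The threshold 2 s > n arises from the same identity. Formally, inserting exp (- 2 s g) yields
  (2 s - n) \<integral> exp (- 2 s g) det H = 2 s \<integral> (1 - t) exp (- 2 s g) det H; for 2 s =
  n + \<epsilon> the factor (- \<rho>)^(-n) hidden in (1 - t) det H turns the right side into a
  multiple of the moment of order \<epsilon> from the hypothesis. Letting \<epsilon> decrease to 0
  brings 4 s^2 down to n^2. The obstacle is that exp (- 2 s g) has no compact support, and that
  cutting it off creates a term with the derivative of the cutoff, which cannot be estimated before
  the mass is known to be finite. Once finiteness is known, a bound on that derivative uniform in
  the cutoff parameter is enough for dominated convergence in the Rayleigh quotients.\<close>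

lemma Ck_on_cong:
  assumes "open S" "\<And>x. x \<in> S \<Longrightarrow> f x = g x" "Ck_on k S f"
  shows "Ck_on k S g"
  using assms(2,3)
proof (induction k arbitrary: f g)
  case 0
  then show ?case by (simp cong: continuous_on_cong)
next
  case (Suc k)
  have d: "(g has_derivative frechet_derivative f (at x)) (at x)" if "x \<in> S" for x
    using Suc.prems that assms(1)
    by (auto simp: frechet_derivative_works intro: has_derivative_transform_within_open)
  have e: "frechet_derivative g (at x) = frechet_derivative f (at x)" if "x \<in> S" for x
    using frechet_derivative_at[OF d[OF that]] by simp
  have "Ck_on k S (\<lambda>x. frechet_derivative g (at x) v)" for v
    by (rule Suc.IH[of "\<lambda>x. frechet_derivative f (at x) v"]) (use Suc.prems e in auto)
  then show ?case
    using d by (auto simp: differentiable_def)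
qed

lemma Ck_on_subset: "Ck_on k S f \<Longrightarrow> T \<subseteq> S \<Longrightarrow> Ck_on k T f"
  by (induction k arbitrary: f) (auto intro: continuous_on_subset)

lemma Ck_on_SucD: "Ck_on (Suc k) S f \<Longrightarrow> Ck_on k S f"
proof (induction k arbitrary: f)
  case 0
  then show ?case
    by (simp add: continuous_at_imp_continuous_on differentiable_imp_continuous_within)
next
  case (Suc k)
  show ?case
    unfolding Ck_on.simps(2)[of k]
    using Suc.IH Suc.prems by auto
qed

text \<open>Lets the derivative be given by an explicit formula, so that closure under sums,
  products and compositions follows from the corresponding rule of calculus by induction on the
  order.\<close>

lemma Ck_on_SucI:
  assumes "open S" "\<And>x. x \<in> S \<Longrightarrow> (f has_derivative f' x) (at x)"
    and "\<And>v. Ck_on k S (\<lambda>x. f' x v)"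
  shows "Ck_on (Suc k) S f"
proof -
  have "Ck_on k S (\<lambda>x. frechet_derivative f (at x) v)" for v
    by (rule Ck_on_cong[OF assms(1) _ assms(3)[of v]])
      (simp add: frechet_derivative_at[OF assms(2), symmetric])
  then show ?thesis
    using assms(2) by (auto simp: differentiable_def)
qed

lemma Ck_on_Suc_derivative:
  "Ck_on (Suc k) S f \<Longrightarrow> x \<in> S \<Longrightarrow> (f has_derivative frechet_derivative f (at x)) (at x)"
  by (simp add: frechet_derivative_works[symmetric])

lemma Ck_on_const: "Ck_on k S (\<lambda>x. c)"
proof (induction k arbitrary: c)
  case (Suc k)
  then show ?case by simp
qed simp

lemma Ck_on_add:
  assumes "open S" "Ck_on k S f" "Ck_on k S g"
  shows "Ck_on k S (\<lambda>x. f x + g x)"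
  using assms(2,3)
proof (induction k arbitrary: f g)
  case (Suc k)
  show ?case
    by (rule Ck_on_SucI[where f' = "\<lambda>x v. frechet_derivative f (at x) v + frechet_derivative g (at x) v"])
      (use Suc assms(1) in \<open>auto simp del: Ck_on.simps(2) intro!: has_derivative_add Ck_on_Suc_derivative\<close>, simp_all)
qed (simp add: continuous_on_add)

lemma Ck_on_linear:
  assumes "open S" "bounded_linear T" "Ck_on k S f"
  shows "Ck_on k S (\<lambda>x. T (f x))"
  using assms(3)
proof (induction k arbitrary: f)
  case 0
  then show ?case
    using bounded_linear.continuous_on[OF assms(2)] by simp
next
  case (Suc k)
  show ?case
    by (rule Ck_on_SucI[where f' = "\<lambda>x v. T (frechet_derivative f (at x) v)"])
      (use Suc assms(1) in \<open>auto simp: frechet_derivative_works intro: bounded_linear.has_derivative[OF assms(2)]\<close>)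
qed

lemma Ck_on_bilinear:
  assumes "open S" "bounded_bilinear B" "Ck_on k S f" "Ck_on k S g"
  shows "Ck_on k S (\<lambda>x. B (f x) (g x))"
  using assms(3,4)
proof (induction k arbitrary: f g)
  case 0
  then show ?case
    using bounded_bilinear.continuous_on[OF assms(2)] by simp
next
  case (Suc k)
  have f: "Ck_on k S f" and g: "Ck_on k S g"
    using Suc.prems by (auto intro: Ck_on_SucD simp del: Ck_on.simps)
  show ?case
  proof (rule Ck_on_SucI[where f' = "\<lambda>x v. B (f x) (frechet_derivative g (at x) v)
        + B (frechet_derivative f (at x) v) (g x)"])
    show "((\<lambda>x. B (f x) (g x)) has_derivative
        (\<lambda>v. B (f x) (frechet_derivative g (at x) v) + B (frechet_derivative f (at x) v) (g x))) (at x)"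
      if "x \<in> S" for x
      by (rule bounded_bilinear.FDERIV[OF assms(2)]) (rule Ck_on_Suc_derivative[OF _ that], fact)+
    show "Ck_on k S (\<lambda>x. B (f x) (frechet_derivative g (at x) v) + B (frechet_derivative f (at x) v) (g x))"
      for v
      using Suc f g by (intro Ck_on_add assms(1) Suc.IH) auto
  qed fact
qed

text \<open>The outer function comes with the whole sequence \<phi> of its successive derivatives.
  The induction runs over all indices \<open>m\<close> at once, since the chain rule passes from
  \<open>m\<close> to \<open>Suc m\<close>.\<close>

lemma Ck_on_compose_real:
  fixes u :: "'a::real_normed_vector \<Rightarrow> real" and \<phi> :: "nat \<Rightarrow> real \<Rightarrow> real"
  assumes "open S" "\<And>n t. t \<in> T \<Longrightarrow> (\<phi> n has_real_derivative \<phi> (Suc n) t) (at t)"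
    and "u ` S \<subseteq> T" "Ck_on k S u"
  shows "Ck_on k S (\<lambda>x. \<phi> m (u x))"
  using assms(4)
proof (induction k arbitrary: m)
  case 0
  have "continuous_on T (\<phi> m)"
    using assms(2) by (meson DERIV_isCont continuous_at_imp_continuous_on)
  then show ?case
    using 0 assms(3) by (auto intro: continuous_on_compose2)
next
  case (Suc k)
  have u: "Ck_on k S u"
    using Suc.prems by (auto intro: Ck_on_SucD simp del: Ck_on.simps)
  show ?case
  proof (rule Ck_on_SucI[where f' = "\<lambda>x v. \<phi> (Suc m) (u x) * frechet_derivative u (at x) v"])
    show "((\<lambda>x. \<phi> m (u x)) has_derivative (\<lambda>v. \<phi> (Suc m) (u x) * frechet_derivative u (at x) v)) (at x)"
      if "x \<in> S" for x
      using has_derivative_compose[OF Ck_on_Suc_derivative[OF Suc.prems that]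
          assms(2)[of "u x" m, unfolded has_field_derivative_def]] that assms(3) by auto
    show "Ck_on k S (\<lambda>x. \<phi> (Suc m) (u x) * frechet_derivative u (at x) v)" for v
      using Suc u by (intro Ck_on_bilinear[OF _ bounded_bilinear_mult] assms(1)) auto
  qed fact
qed

lemma Ck_on_Un:
  assumes "open S" "open T" "Ck_on k S f" "Ck_on k T f"
  shows "Ck_on k (S \<union> T) f"
  using assms(3,4) by (induction k arbitrary: f) (auto intro: continuous_on_open_Un assms)

lemma smooth_on_imp_continuous_on: "smooth_on S f \<Longrightarrow> continuous_on S f"
  using Ck_on.simps(1) smooth_on_def by blast

lemma smooth_on_has_derivative:
  "smooth_on S f \<Longrightarrow> x \<in> S \<Longrightarrow> (f has_derivative frechet_derivative f (at x)) (at x)"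
  by (metis Ck_on_Suc_derivative smooth_on_def)

lemma smooth_on_derivative: "smooth_on S f \<Longrightarrow> smooth_on S (\<lambda>x. frechet_derivative f (at x) v)"
  by (metis Ck_on.simps(2) smooth_on_def)

lemma smooth_on_cong:
  "open S \<Longrightarrow> (\<And>x. x \<in> S \<Longrightarrow> f x = g x) \<Longrightarrow> smooth_on S f \<Longrightarrow> smooth_on S g"
  using Ck_on_cong smooth_on_def by metis

lemma smooth_on_subset: "smooth_on S f \<Longrightarrow> T \<subseteq> S \<Longrightarrow> smooth_on T f"
  using Ck_on_subset smooth_on_def by metis

lemma smooth_on_const: "smooth_on S (\<lambda>x. c)"
  by (simp add: smooth_on_def Ck_on_const)

lemma smooth_on_add:
  "open S \<Longrightarrow> smooth_on S f \<Longrightarrow> smooth_on S g \<Longrightarrow> smooth_on S (\<lambda>x. f x + g x)"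
  by (simp add: smooth_on_def Ck_on_add)

lemma smooth_on_linear:
  "open S \<Longrightarrow> bounded_linear T \<Longrightarrow> smooth_on S f \<Longrightarrow> smooth_on S (\<lambda>x. T (f x))"
  by (simp add: smooth_on_def Ck_on_linear)

lemma smooth_on_of_real:
  "open S \<Longrightarrow> smooth_on S f \<Longrightarrow> smooth_on S (\<lambda>x. complex_of_real (f x))"
  by (rule smooth_on_linear[OF _ bounded_linear_of_real])

lemma smooth_on_mult:
  fixes f g :: "'a::real_normed_vector \<Rightarrow> 'b::real_normed_algebra"
  shows "open S \<Longrightarrow> smooth_on S f \<Longrightarrow> smooth_on S g \<Longrightarrow> smooth_on S (\<lambda>x. f x * g x)"
  by (simp add: smooth_on_def Ck_on_bilinear[OF _ bounded_bilinear_mult])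

lemma smooth_on_minus:
  fixes f :: "'a::real_normed_vector \<Rightarrow> 'b::real_normed_vector"
  shows "open S \<Longrightarrow> smooth_on S f \<Longrightarrow> smooth_on S (\<lambda>x. - f x)"
  using smooth_on_linear[of S uminus f] bounded_linear_minus[OF bounded_linear_ident] by simp

lemma smooth_on_diff:
  "open S \<Longrightarrow> smooth_on S f \<Longrightarrow> smooth_on S g \<Longrightarrow> smooth_on S (\<lambda>x. f x - g x)"
  using smooth_on_add[of S f "\<lambda>x. - g x"] smooth_on_minus[of S g] by simp

lemma smooth_on_sum:
  "open S \<Longrightarrow> (\<And>i. i \<in> I \<Longrightarrow> smooth_on S (f i)) \<Longrightarrow> smooth_on S (\<lambda>x. \<Sum>i\<in>I. f i x)"
  by (induction I rule: infinite_finite_induct) (auto intro: smooth_on_add smooth_on_const)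

lemma smooth_on_prod:
  fixes f :: "'i \<Rightarrow> 'a::real_normed_vector \<Rightarrow> 'b::{real_normed_algebra,comm_ring_1}"
  shows "open S \<Longrightarrow> (\<And>i. i \<in> I \<Longrightarrow> smooth_on S (f i)) \<Longrightarrow> smooth_on S (\<lambda>x. \<Prod>i\<in>I. f i x)"
  by (induction I rule: infinite_finite_induct) (auto intro: smooth_on_mult smooth_on_const)

lemma smooth_on_Un: "open S \<Longrightarrow> open T \<Longrightarrow> smooth_on S f \<Longrightarrow> smooth_on T f \<Longrightarrow> smooth_on (S \<union> T) f"
  by (simp add: smooth_on_def Ck_on_Un)

lemma smooth_on_compose_real:
  fixes u :: "'a::real_normed_vector \<Rightarrow> real" and \<phi> :: "nat \<Rightarrow> real \<Rightarrow> real"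
  assumes "open S" "\<And>n t. t \<in> T \<Longrightarrow> (\<phi> n has_real_derivative \<phi> (Suc n) t) (at t)"
    and "u ` S \<subseteq> T" "smooth_on S u"
  shows "smooth_on S (\<lambda>x. \<phi> m (u x))"
  using assms Ck_on_compose_real unfolding smooth_on_def by metis

lemmas smooth_intros = smooth_on_const smooth_on_add smooth_on_mult smooth_on_minus smooth_on_diff
  smooth_on_sum smooth_on_prod smooth_on_of_real smooth_on_derivative

lemma has_vector_derivative_line:
  assumes "(f has_derivative f') (at (x + s *\<^sub>R v))"
  shows "((\<lambda>s. f (x + s *\<^sub>R v)) has_vector_derivative f' v) (at s)"
proof -
  have "((\<lambda>s. f (x + s *\<^sub>R v)) has_derivative (\<lambda>a. f' (a *\<^sub>R v))) (at s)"
    by (rule has_derivative_compose[where g = f and f = "\<lambda>s. x + s *\<^sub>R v"])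
      (auto intro!: derivative_eq_intros assms)
  then show ?thesis
    using has_derivative_linear[OF assms] by (simp add: has_vector_derivative_def linear_scale)
qed

section \<open>Symmetry of second derivatives\<close>

text \<open>The second difference of \<open>f\<close> over the parallelogram spanned by \<open>h v\<close> and \<open>h w\<close> is
  \<open>h\<^sup>2\<close> times a mixed derivative at some point of the parallelogram, in either order.\<close>

lemma second_difference_mean_value:
  fixes f :: "'a::real_normed_vector \<Rightarrow> real"
  assumes h: "0 < h" and S: "\<And>s t. s \<in> {0..h} \<Longrightarrow> t \<in> {0..h} \<Longrightarrow> x + s *\<^sub>R v + t *\<^sub>R w \<in> S"
    and f: "\<And>y. y \<in> S \<Longrightarrow> (f has_derivative f' y) (at y)"
    and f': "\<And>y. y \<in> S \<Longrightarrow> ((\<lambda>y. f' y v) has_derivative f'' y) (at y)"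
  obtains s t where "s \<in> {0..h}" "t \<in> {0..h}"
    "f (x + h *\<^sub>R v + h *\<^sub>R w) - f (x + h *\<^sub>R v) - f (x + h *\<^sub>R w) + f x
      = h\<^sup>2 * f'' (x + s *\<^sub>R v + t *\<^sub>R w) w"
proof -
  have d: "((\<lambda>s. f (x + s *\<^sub>R v + t *\<^sub>R w)) has_real_derivative f' (x + s *\<^sub>R v + t *\<^sub>R w) v) (at s)"
    if "s \<in> {0..h}" "t \<in> {0..h}" for s t
    using has_vector_derivative_line[of f _ "x + t *\<^sub>R w" s v] f[OF S[OF that]]
    by (simp add: has_real_derivative_iff_has_vector_derivative algebra_simps)
  define k where "k s = f (x + s *\<^sub>R v + h *\<^sub>R w) - f (x + s *\<^sub>R v)" for s
  have "(k has_real_derivative f' (x + s *\<^sub>R v + h *\<^sub>R w) v - f' (x + s *\<^sub>R v) v) (at s)"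
    if "0 \<le> s" "s \<le> h" for s
    unfolding k_def using d[of s h] d[of s 0] that h by (auto intro!: DERIV_diff)
  from MVT2[OF h this] obtain s where s: "0 < s" "s < h"
    "k h - k 0 = h * (f' (x + s *\<^sub>R v + h *\<^sub>R w) v - f' (x + s *\<^sub>R v) v)"
    by auto
  have e: "((\<lambda>t. f' (x + s *\<^sub>R v + t *\<^sub>R w) v) has_real_derivative f'' (x + s *\<^sub>R v + t *\<^sub>R w) w) (at t)"
    if "0 \<le> t" "t \<le> h" for t
    using has_vector_derivative_line[OF f'[OF S]] s that
    by (simp add: has_real_derivative_iff_has_vector_derivative)
  from MVT2[OF h e] obtain t where t: "0 < t" "t < h"
    "f' (x + s *\<^sub>R v + h *\<^sub>R w) v - f' (x + s *\<^sub>R v) v = h * f'' (x + s *\<^sub>R v + t *\<^sub>R w) w"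
    by auto
  show ?thesis
    by (rule that[of s t]) (use s t in \<open>auto simp: k_def power2_eq_square algebra_simps\<close>)
qed

text \<open>The second difference is symmetric in \<open>v\<close> and \<open>w\<close>, so the two
  mixed derivatives agree at two nearby points; continuity brings both points back to
  \<open>x\<close>.\<close>

lemma frechet_derivative_commute_real:
  fixes f :: "'a::real_normed_vector \<Rightarrow> real"
  assumes S: "open S" and x: "x \<in> S" and f: "Ck_on 2 S f"
  shows "frechet_derivative (\<lambda>y. frechet_derivative f (at y) v) (at x) w
    = frechet_derivative (\<lambda>y. frechet_derivative f (at y) w) (at x) v"
proof -
  define D where "D v y = frechet_derivative f (at y) v" for v y
  define E where "E v w y = frechet_derivative (D v) (at y) w" for v w y
  have f1: "\<And>y. y \<in> S \<Longrightarrow> (f has_derivative (\<lambda>v. D v y)) (at y)"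
    using f by (auto simp: D_def numeral_2_eq_2 frechet_derivative_works)
  have f2: "\<And>y v. y \<in> S \<Longrightarrow> (D v has_derivative (\<lambda>w. E v w y)) (at y)"
    using f by (auto simp: D_def[abs_def] E_def numeral_2_eq_2 frechet_derivative_works)
  have f3: "continuous_on S (E v w)" for v w
    using f by (auto simp: D_def[abs_def] E_def numeral_2_eq_2)
  have "\<bar>E v w x - E w v x\<bar> \<le> e" if "e > 0" for e
  proof -
    obtain d where d: "d > 0" "\<And>y. y \<in> S \<Longrightarrow> dist y x < d \<Longrightarrow> \<bar>E v w y - E v w x\<bar> < e/2"
      using f3[of v w] x \<open>e > 0\<close> unfolding continuous_on_iff dist_real_def by (metis half_gt_zero)
    obtain d' where d': "d' > 0" "\<And>y. y \<in> S \<Longrightarrow> dist y x < d' \<Longrightarrow> \<bar>E w v y - E w v x\<bar> < e/2"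
      using f3[of w v] x \<open>e > 0\<close> unfolding continuous_on_iff dist_real_def by (metis half_gt_zero)
    obtain c where c: "c > 0" "ball x c \<subseteq> S"
      using S x openE by blast
    define m where "m = min c (min d d')"
    have m: "m > 0" using c d d' by (simp add: m_def)
    \<comment> \<open>Small enough that the parallelogram spanned by \<open>h v\<close> and
      \<open>h w\<close> stays within distance \<open>m\<close> of \<open>x\<close>; the summand 1
      keeps the denominator positive when both vectors vanish.\<close>
    define h where "h = m / (norm v + norm w + 1)"
    have nz: "norm v + norm w + 1 > 0" by (simp add: add_nonneg_pos)
    have h: "h > 0" unfolding h_def using m nz by simp
    have near: "dist (x + s *\<^sub>R v + t *\<^sub>R w) x < m" if "s \<in> {0..h}" "t \<in> {0..h}" for s t
    proof -
      have "dist (x + s *\<^sub>R v + t *\<^sub>R w) x = norm (s *\<^sub>R v + t *\<^sub>R w)"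
        by (simp add: dist_norm)
      also have "\<dots> \<le> \<bar>s\<bar> * norm v + \<bar>t\<bar> * norm w"
        by (metis norm_scaleR norm_triangle_ineq)
      also have "\<dots> \<le> h * norm v + h * norm w"
        using that by (intro add_mono mult_right_mono) auto
      also have "\<dots> < h * (norm v + norm w + 1)"
        using h by (simp add: algebra_simps)
      also have "\<dots> = m" using nz by (simp add: h_def)
      finally show ?thesis .
    qed
    have inS: "x + s *\<^sub>R v + t *\<^sub>R w \<in> S" if "s \<in> {0..h}" "t \<in> {0..h}" for s t
      using near[OF that] c by (auto simp: m_def dist_commute)
    have inS': "x + s *\<^sub>R w + t *\<^sub>R v \<in> S" if "s \<in> {0..h}" "t \<in> {0..h}" for s t
      using inS[OF that(2,1)] by (simp add: algebra_simps)
    obtain s t where st: "s \<in> {0..h}" "t \<in> {0..h}"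
      "f (x + h *\<^sub>R v + h *\<^sub>R w) - f (x + h *\<^sub>R v) - f (x + h *\<^sub>R w) + f x
        = h\<^sup>2 * E v w (x + s *\<^sub>R v + t *\<^sub>R w)"
      by (rule second_difference_mean_value[OF h inS f1 f2])
    obtain s' t' where st': "s' \<in> {0..h}" "t' \<in> {0..h}"
      "f (x + h *\<^sub>R w + h *\<^sub>R v) - f (x + h *\<^sub>R w) - f (x + h *\<^sub>R v) + f x
        = h\<^sup>2 * E w v (x + s' *\<^sub>R w + t' *\<^sub>R v)"
      by (rule second_difference_mean_value[OF h inS' f1 f2])
    have "h\<^sup>2 * E v w (x + s *\<^sub>R v + t *\<^sub>R w) = h\<^sup>2 * E w v (x + s' *\<^sub>R w + t' *\<^sub>R v)"
      unfolding st(3)[symmetric] st'(3)[symmetric] by (simp add: algebra_simps)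
    then have eq: "E v w (x + s *\<^sub>R v + t *\<^sub>R w) = E w v (x + s' *\<^sub>R w + t' *\<^sub>R v)"
      using h by simp
    have "\<bar>E v w (x + s *\<^sub>R v + t *\<^sub>R w) - E v w x\<bar> < e/2"
      using near[OF st(1,2)] inS[OF st(1,2)] d by (simp add: m_def)
    moreover have "\<bar>E w v (x + s' *\<^sub>R w + t' *\<^sub>R v) - E w v x\<bar> < e/2"
      using near[OF st'(2,1)] inS'[OF st'(1,2)] d' by (simp add: m_def algebra_simps)
    ultimately show ?thesis
      unfolding eq by linarith
  qed
  then have "\<bar>E v w x - E w v x\<bar> \<le> 0"
    using dense_ge by blast
  then show ?thesis
    by (simp add: E_def D_def[abs_def])
qed

lemma frechet_derivative_linear_image:
  assumes "bounded_linear T" "f differentiable at x"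
  shows "frechet_derivative (\<lambda>y. T (f y)) (at x) v = T (frechet_derivative f (at x) v)"
  using frechet_derivative_at[OF bounded_linear.has_derivative[OF assms(1)]] assms(2)
  by (metis frechet_derivative_works)

text \<open>Testing against an arbitrary vector \<open>b\<close> reduces to real values; the
  complex-valued case is the one used for Wirtinger derivatives.\<close>

lemma frechet_derivative_commute:
  fixes f :: "'a::real_normed_vector \<Rightarrow> 'b::real_inner"
  assumes S: "open S" and x: "x \<in> S" and f: "Ck_on 2 S f"
  shows "frechet_derivative (\<lambda>y. frechet_derivative f (at y) v) (at x) w
    = frechet_derivative (\<lambda>y. frechet_derivative f (at y) w) (at x) v"
proof -
  have B: "bounded_linear (\<lambda>y::'b. y \<bullet> b)" for b
    by (rule bounded_linear_inner_left)
  have d: "f differentiable at y" "(\<lambda>y. frechet_derivative f (at y) v) differentiable at y"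
    if "y \<in> S" for y v
    using f that by (auto simp: numeral_2_eq_2)
  have e: "frechet_derivative (\<lambda>y. frechet_derivative (\<lambda>y. f y \<bullet> b) (at y) v) (at x) w
    = frechet_derivative (\<lambda>y. frechet_derivative f (at y) v) (at x) w \<bullet> b" for b v w
  proof -
    have "frechet_derivative (\<lambda>y. frechet_derivative (\<lambda>y. f y \<bullet> b) (at y) v) (at x)
      = frechet_derivative (\<lambda>y. frechet_derivative f (at y) v \<bullet> b) (at x)"
    proof (rule sym, rule frechet_derivative_transform_within_open[OF _ S x])
      show "(\<lambda>y. frechet_derivative f (at y) v \<bullet> b) differentiable at x"
        using d(2)[OF x, of v] bounded_linear.has_derivative[OF B] unfolding differentiable_def by blast
    qed (simp add: frechet_derivative_linear_image[OF B d(1)])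
    then show ?thesis
      by (simp add: frechet_derivative_linear_image[OF B d(2)[OF x]])
  qed
  have "frechet_derivative (\<lambda>y. frechet_derivative f (at y) v) (at x) w \<bullet> b
    = frechet_derivative (\<lambda>y. frechet_derivative f (at y) w) (at x) v \<bullet> b" for b
    using frechet_derivative_commute_real[OF S x Ck_on_linear[OF S B f]] by (simp add: e)
  then show ?thesis
    by (metis inner_commute vector_eq_ldot)
qed

section \<open>Top powers of Hermitian two-forms\<close>

definition hermitian :: "complex^'n^'n::finite \<Rightarrow> bool"
  where "hermitian H \<longleftrightarrow> (\<forall>i j. H $ i $ j = cnj (H $ j $ i))"

lemma hermitianD: "hermitian H \<Longrightarrow> cnj (H $ i $ j) = H $ j $ i"
  by (metis hermitian_def)

text \<open>Each pair of slots \<open>(k, False)\<close>, \<open>(k, True)\<close> contributes a factor 2, by composing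
  permutations with the transposition of the two slots.\<close>

lemma alternating_sum_antisymmetrize:
  fixes X :: "'n::finite \<times> bool \<Rightarrow> 'n \<times> bool \<Rightarrow> complex"
  shows "(\<Sum>\<sigma> | \<sigma> permutes UNIV. of_int (sign \<sigma>) *
      (\<Prod>k\<in>UNIV. X (\<sigma> (k, False)) (\<sigma> (k, True)) - X (\<sigma> (k, True)) (\<sigma> (k, False))))
    = 2 ^ CARD('n) * (\<Sum>\<sigma> | \<sigma> permutes UNIV. of_int (sign \<sigma>) *
      (\<Prod>k\<in>UNIV. X (\<sigma> (k, False)) (\<sigma> (k, True))))"
proof -
  define P where "P = {\<sigma> :: 'n \<times> bool \<Rightarrow> 'n \<times> bool. \<sigma> permutes UNIV}"
  define Y where "Y \<sigma> k = X (\<sigma> (k, False)) (\<sigma> (k, True))" for \<sigma> :: "'n \<times> bool \<Rightarrow> 'n \<times> bool" and k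
  define Z where "Z \<sigma> k = X (\<sigma> (k, True)) (\<sigma> (k, False))" for \<sigma> :: "'n \<times> bool \<Rightarrow> 'n \<times> bool" and k
  \<comment> \<open>Generalized for induction: slots in \<open>S\<close> carry the antisymmetrized
    factor, the others still the plain one.\<close>
  have "(\<Sum>\<sigma>\<in>P. of_int (sign \<sigma>) * ((\<Prod>k\<in>S. Y \<sigma> k - Z \<sigma> k) * (\<Prod>k\<in>-S. Y \<sigma> k)))
    = 2 ^ card S * (\<Sum>\<sigma>\<in>P. of_int (sign \<sigma>) * (\<Prod>k\<in>UNIV. Y \<sigma> k))" (is "?L S = _") for S
  proof (induction S rule: finite_induct[OF finite])
    case 1
    then show ?case by simp
  next
    case (2 a S)
    define \<tau> where "\<tau> = Transposition.transpose (a, False) (a, True)"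
    have \<tau>: "\<tau> permutes UNIV" "sign \<tau> = - 1"
      by (auto simp: \<tau>_def sign_swap_id permutes_swap_id)
    define R where "R \<sigma> = (\<Prod>k\<in>S. Y \<sigma> k - Z \<sigma> k) * (\<Prod>k\<in>-insert a S. Y \<sigma> k)" for \<sigma>
    have swap: "Y (\<sigma> \<circ> \<tau>) a = Z \<sigma> a" "k \<noteq> a \<Longrightarrow> Y (\<sigma> \<circ> \<tau>) k = Y \<sigma> k"
       "k \<noteq> a \<Longrightarrow> Z (\<sigma> \<circ> \<tau>) k = Z \<sigma> k" for \<sigma> k
      by (auto simp: Y_def Z_def \<tau>_def Transposition.transpose_def)
    have R: "R (\<sigma> \<circ> \<tau>) = R \<sigma>" for \<sigma>
    proof -
      have "Y (\<sigma> \<circ> \<tau>) k - Z (\<sigma> \<circ> \<tau>) k = Y \<sigma> k - Z \<sigma> k" if "k \<in> S" for k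
        using 2 that swap(2,3) by metis
      then show ?thesis
        unfolding R_def by (intro arg_cong2[of _ _ _ _ "(*)"] prod.cong refl) (auto simp: swap)
    qed
    have neg: "(\<Sum>\<sigma>\<in>P. of_int (sign \<sigma>) * (Z \<sigma> a * R \<sigma>)) = - (\<Sum>\<sigma>\<in>P. of_int (sign \<sigma>) * (Y \<sigma> a * R \<sigma>))"
    proof -
      have "(\<Sum>\<sigma>\<in>P. of_int (sign \<sigma>) * (Y \<sigma> a * R \<sigma>))
        = (\<Sum>\<sigma>\<in>P. of_int (sign (\<sigma> \<circ> \<tau>)) * (Y (\<sigma> \<circ> \<tau>) a * R (\<sigma> \<circ> \<tau>)))"
        unfolding P_def by (rule sum_permutations_compose_right[OF \<tau>(1)])
      also have "\<dots> = (\<Sum>\<sigma>\<in>P. - (of_int (sign \<sigma>) * (Z \<sigma> a * R \<sigma>)))"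
        using \<tau> by (intro sum.cong refl)
          (auto simp: R swap P_def sign_compose[OF permutes_imp_permutation[OF finite] permutes_imp_permutation[OF finite]])
      finally show ?thesis by (simp add: sum_negf)
    qed
    have compl: "- S = insert a (- insert a S)"
      using 2 by auto
    have "?L (insert a S) = (\<Sum>\<sigma>\<in>P. of_int (sign \<sigma>) * ((Y \<sigma> a - Z \<sigma> a) * R \<sigma>))"
      using 2 by (simp add: R_def mult.assoc)
    also have "\<dots> = 2 * (\<Sum>\<sigma>\<in>P. of_int (sign \<sigma>) * (Y \<sigma> a * R \<sigma>))"
      using neg by (simp add: algebra_simps sum_subtractf)
    also have "(\<Sum>\<sigma>\<in>P. of_int (sign \<sigma>) * (Y \<sigma> a * R \<sigma>)) = ?L S"
      unfolding compl R_def by (simp add: ac_simps)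
    finally show ?case
      using 2 by simp
  qed
  from this[of UNIV] show ?thesis
    by (simp add: P_def Y_def Z_def)
qed

section \<open>Determinants of coordinate covectors on the real frame\<close>

lemma det_eq_prod_diagonal:
  fixes A :: "'a::comm_ring_1^'n^'n::finite"
  assumes "\<And>\<sigma>. \<sigma> permutes UNIV \<Longrightarrow> (\<And>i. A $ i $ \<sigma> i \<noteq> 0) \<Longrightarrow> \<sigma> = id"
  shows "det A = (\<Prod>i\<in>UNIV. A $ i $ i)"
proof -
  \<comment> \<open>The hypothesis replaces triangularity, for which the index type would have to be
    ordered: the identity is the only permutation left in the Leibniz expansion.\<close>
  have "det A = (\<Sum>\<sigma>\<in>{id}. of_int (sign \<sigma>) * (\<Prod>i\<in>UNIV. A $ i $ \<sigma> i))"
    unfolding det_def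
  proof (rule sum.mono_neutral_right)
    show "\<forall>\<sigma>\<in>{p. p permutes UNIV} - {id}. of_int (sign \<sigma>) * (\<Prod>i\<in>UNIV. A $ i $ \<sigma> i) = 0"
    proof
      fix \<sigma> assume "\<sigma> \<in> {p. p permutes (UNIV :: 'n set)} - {id}"
      then obtain i where "A $ i $ \<sigma> i = 0"
        using assms by auto
      then have "(\<Prod>i\<in>UNIV. A $ i $ \<sigma> i) = 0"
        by (intro prod_zero) auto
      then show "of_int (sign \<sigma>) * (\<Prod>i\<in>UNIV. A $ i $ \<sigma> i) = 0"
        by simp
    qed
  qed (auto simp: permutes_id finite_permutations)
  then show ?thesis by simp
qed

text \<open>Acts on one half of the index set: on the rows of holomorphic covectors for
  \<open>b = False\<close>, on those of antiholomorphic covectors for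
  \<open>b = True\<close>.\<close>

definition lift_perm :: "bool \<Rightarrow> ('n \<Rightarrow> 'n) \<Rightarrow> 'n \<times> bool \<Rightarrow> 'n \<times> bool"
  where "lift_perm b p = (\<lambda>(k, c). if c = b then (p k, c) else (k, c))"

text \<open>Induction over transpositions: each lifts to a single transposition, so signs are
  preserved.\<close>

lemma lift_perm:
  assumes "p permutes (UNIV :: 'n::finite set)"
  shows "lift_perm b p permutes UNIV \<and> sign (lift_perm b p) = sign p"
  using assms finite[of UNIV]
proof (induction p rule: permutes_induct)
  case id
  have "lift_perm b id = (id :: 'n \<times> bool \<Rightarrow> _)"
    by (auto simp: lift_perm_def fun_eq_iff)
  then show ?case by (simp only: permutes_id sign_id simp_thms)
next
  case (swap x y p)
  have e: "lift_perm b (Transposition.transpose x y \<circ> p)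
    = Transposition.transpose (x, b) (y, b) \<circ> lift_perm b p"
    by (auto simp: lift_perm_def fun_eq_iff Transposition.transpose_def)
  have t: "Transposition.transpose (x, b) (y, b) permutes UNIV"
    "Transposition.transpose x y permutes UNIV"
    by (auto simp: permutes_swap_id)
  show ?case
  proof
    show "lift_perm b (Transposition.transpose x y \<circ> p) permutes UNIV"
      unfolding e using swap t by (intro permutes_compose) auto
    have "sign (lift_perm b (Transposition.transpose x y \<circ> p)) = sign (Transposition.transpose (x, b) (y, b)) * sign p"
      unfolding e using swap t by (subst sign_compose) (auto intro: permutes_imp_permutation[OF finite])
    also have "\<dots> = sign (Transposition.transpose x y) * sign p"
      by (simp add: sign_swap_id)
    also have "\<dots> = sign (Transposition.transpose x y \<circ> p)"
      using swap t by (subst sign_compose) (auto intro: permutes_imp_permutation[OF finite])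
    finally show "sign (lift_perm b (Transposition.transpose x y \<circ> p)) = sign (Transposition.transpose x y \<circ> p)" .
  qed
qed

text \<open>The rows are the covectors \<open>dz\<close> with index \<open>x k\<close> and
  \<open>cnj dz\<close> with index \<open>y k\<close>, evaluated on the real frame; the determinant
  is the value of their wedge product on that frame.\<close>

definition frame_matrix :: "('n \<Rightarrow> 'n) \<Rightarrow> ('n \<Rightarrow> 'n) \<Rightarrow> complex^('n \<times> bool)^('n::finite \<times> bool)"
  where "frame_matrix x y = (\<chi> q p.
    if snd q then cnj (real_frame p $ y (fst q)) else real_frame p $ x (fst q))"

lemma real_frame_nth: "real_frame (l, b) $ k = (if k = l then if b then \<i> else 1 else 0)"
  by (auto simp: real_frame_def axis_def)

text \<open>Each \<open>k\<close> contributes the 2 by 2 determinant with rows (1, \<i>) and (1,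
  -\<i>), which is -2 \<i>. Subtracting the holomorphic row from the antiholomorphic one is written
  as the factorization into \<open>L\<close> and \<open>U\<close>.\<close>

lemma det_frame_matrix_id: "det (frame_matrix id id :: complex^('n \<times> bool)^('n::finite \<times> bool)) = (- 2 * \<i>) ^ CARD('n)"
proof -
  define L :: "complex^('n \<times> bool)^('n \<times> bool)"
    where "L = (\<chi> p q. if q = p \<or> q = (fst p, False) then 1 else 0)"
  define U :: "complex^('n \<times> bool)^('n \<times> bool)"
    where "U = (\<chi> q p. if snd q then cnj (real_frame p $ fst q) - real_frame p $ fst q else real_frame p $ fst q)"
  have U_nth: "U $ (k, b) $ (l, c) = (if k = l then if b then if c then - 2 * \<i> else 0
      else if c then \<i> else 1 else 0)" for k l b c
    by (simp add: U_def real_frame_nth)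
  have "frame_matrix id id = L ** U"
  proof -
    have "(L ** U) $ (k, b) $ p = frame_matrix id id $ (k, b) $ p" for k b p
    proof -
      have "(L ** U) $ (k, b) $ p = (\<Sum>q\<in>UNIV. (if q \<in> {(k, b), (k, False)} then U $ q $ p else 0))"
        unfolding matrix_matrix_mult_def by (auto simp: L_def intro!: sum.cong)
      also have "\<dots> = (\<Sum>q\<in>{(k, b), (k, False)}. U $ q $ p)"
        by (simp only: sum.inter_restrict[symmetric] finite Int_UNIV_left)
      also have "\<dots> = frame_matrix id id $ (k, b) $ p"
        by (cases b) (auto simp: U_def frame_matrix_def)
      finally show ?thesis .
    qed
    then show ?thesis by (auto simp: vec_eq_iff)
  qed
  moreover have "det L = (\<Prod>i\<in>UNIV. L $ i $ i)"
  proof (rule det_eq_prod_diagonal)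
    fix \<sigma> :: "'n \<times> bool \<Rightarrow> 'n \<times> bool"
    assume \<sigma>: "\<sigma> permutes UNIV" and nz: "\<And>i. L $ i $ \<sigma> i \<noteq> 0"
    have F: "\<sigma> (k, False) = (k, False)" for k
      using nz[of "(k, False)"] by (auto simp: L_def split: if_splits)
    have "\<sigma> (k, True) = (k, True)" for k
      using nz[of "(k, True)"] F[of k] injD[OF permutes_inj[OF \<sigma>], of "(k, True)" "(k, False)"]
      by (auto simp: L_def split: if_splits)
    with F show "\<sigma> = id"
      by (metis (full_types) eq_id_iff surj_pair)
  qed
  moreover have "det U = (\<Prod>i\<in>UNIV. U $ i $ i)"
  proof (rule det_eq_prod_diagonal)
    fix \<sigma> :: "'n \<times> bool \<Rightarrow> 'n \<times> bool"
    assume \<sigma>: "\<sigma> permutes UNIV" and nz: "\<And>i. U $ i $ \<sigma> i \<noteq> 0"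
    have T: "\<sigma> (k, True) = (k, True)" for k
      using nz[of "(k, True)"] by (cases "\<sigma> (k, True)") (auto simp: U_nth split: if_splits)
    have "\<sigma> (k, False) = (k, False)" for k
      using nz[of "(k, False)"] T[of k] injD[OF permutes_inj[OF \<sigma>], of "(k, True)" "(k, False)"]
      by (cases "\<sigma> (k, False)") (auto simp: U_nth split: if_splits)
    with T show "\<sigma> = id"
      by (metis (full_types) eq_id_iff surj_pair)
  qed
  ultimately have "det (frame_matrix id id :: complex^('n \<times> bool)^('n::finite \<times> bool))
      = (\<Prod>i\<in>UNIV. L $ i $ i) * (\<Prod>i\<in>UNIV. U $ i $ i)"
    by (simp add: det_mul)
  also have "(\<Prod>i\<in>UNIV. L $ i $ i) = 1"
    by (rule prod.neutral) (auto simp: L_def)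
  also have "(\<Prod>i\<in>UNIV. U $ i $ i) = (\<Prod>k\<in>UNIV. \<Prod>b\<in>UNIV. U $ (k, b) $ (k, b))"
    by (simp add: prod.cartesian_product)
  also have "\<dots> = (- 2 * \<i>) ^ CARD('n)"
    by (simp add: U_nth UNIV_bool)
  finally show ?thesis by (simp only: mult_1)
qed

lemma det_frame_matrix:
  assumes "x permutes (UNIV :: 'n::finite set)" "y permutes UNIV"
  shows "det (frame_matrix x y) = of_int (sign x) * of_int (sign y) * (- 2 * \<i>) ^ CARD('n)"
proof -
  have "frame_matrix x y = (\<chi> i. frame_matrix id y $ lift_perm False x i)"
    by (auto simp: frame_matrix_def lift_perm_def vec_eq_iff)
  then have "det (frame_matrix x y) = of_int (sign x) * det (frame_matrix id y)"
    using lift_perm[OF assms(1)] det_permute_rows by metis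
  moreover have "frame_matrix id y = (\<chi> i. frame_matrix id id $ lift_perm True y i)"
    by (auto simp: frame_matrix_def lift_perm_def vec_eq_iff)
  then have "det (frame_matrix id y) = of_int (sign y) * det (frame_matrix id id :: complex^('n \<times> bool)^('n \<times> bool))"
    using lift_perm[OF assms(2)] det_permute_rows by metis
  ultimately show ?thesis
    by (simp add: det_frame_matrix_id)
qed

lemma det_frame_matrix_not_inj:
  assumes "\<not> (inj x \<and> inj y)"
  shows "det (frame_matrix x y) = 0"
proof -
  obtain k l b where "k \<noteq> l" and "(if b then y else x) k = (if b then y else x) l"
    using assms unfolding inj_def by (metis (full_types))
  then have "row (k, b) (frame_matrix x y) = row (l, b) (frame_matrix x y)"
    by (cases b) (auto simp: row_def frame_matrix_def vec_eq_iff)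
  then show ?thesis
    using \<open>k \<noteq> l\<close> by (auto intro: det_identical_rows[of "(k, b)" "(l, b)"])
qed

lemma det_frame_matrix_expand:
  "det (frame_matrix x y) = (\<Sum>\<sigma> | \<sigma> permutes UNIV. of_int (sign \<sigma>) *
    (\<Prod>k\<in>UNIV. real_frame (\<sigma> (k, False)) $ x k * cnj (real_frame (\<sigma> (k, True)) $ y k)))"
proof -
  have "(\<Prod>i\<in>UNIV. frame_matrix x y $ i $ \<sigma> i)
    = (\<Prod>k\<in>UNIV. real_frame (\<sigma> (k, False)) $ x k * cnj (real_frame (\<sigma> (k, True)) $ y k))" for \<sigma>
  proof -
    have "(\<Prod>i\<in>UNIV. frame_matrix x y $ i $ \<sigma> i)
      = (\<Prod>k\<in>UNIV. \<Prod>b\<in>UNIV. frame_matrix x y $ (k, b) $ \<sigma> (k, b))"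
      by (simp add: prod.cartesian_product)
    then show ?thesis
      by (simp add: UNIV_bool frame_matrix_def mult.commute)
  qed
  then show ?thesis by (simp add: det_def)
qed

text \<open>Expanding the product over \<open>k\<close> gives a sum over index functions
  \<open>x\<close> and \<open>y\<close>, and the alternating sum of each monomial is
  \<open>det (frame_matrix x y)\<close>. This vanishes unless \<open>x\<close> and \<open>y\<close>
  are permutations, and each of the n! choices of \<open>x\<close> then yields one copy of
  \<open>det H\<close>.\<close>

lemma alternating_sum_det:
  fixes H :: "complex^'n^'n::finite"
  shows "(\<Sum>\<sigma> | \<sigma> permutes UNIV. of_int (sign \<sigma>) * (\<Prod>k\<in>UNIV. \<i> *
      (\<Sum>i\<in>UNIV. \<Sum>j\<in>UNIV. H $ i $ j * (real_frame (\<sigma> (k, False)) $ i * cnj (real_frame (\<sigma> (k, True)) $ j)))))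
    = 2 ^ CARD('n) * fact CARD('n) * det H"
proof -
  define F where "F \<sigma> k x y = real_frame (\<sigma> (k, False)) $ x * cnj (real_frame (\<sigma> (k, True)) $ y)"
    for \<sigma> :: "'n \<times> bool \<Rightarrow> 'n \<times> bool" and k x y :: 'n
  define G where "G x y = (\<Prod>k\<in>UNIV. H $ x k $ y k) * det (frame_matrix x y)" for x y
  have "(\<Prod>k\<in>UNIV. \<i> * (\<Sum>i\<in>UNIV. \<Sum>j\<in>UNIV. H $ i $ j * F \<sigma> k i j))
    = \<i> ^ CARD('n) * (\<Sum>x\<in>UNIV. \<Sum>y\<in>UNIV. (\<Prod>k\<in>UNIV. H $ x k $ y k) * (\<Prod>k\<in>UNIV. F \<sigma> k (x k) (y k)))" for \<sigma>
  proof -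
    have "(\<Prod>k\<in>UNIV. \<i> * (\<Sum>i\<in>UNIV. \<Sum>j\<in>UNIV. H $ i $ j * F \<sigma> k i j))
      = \<i> ^ CARD('n) * (\<Prod>k\<in>UNIV. \<Sum>p\<in>UNIV. H $ fst p $ snd p * F \<sigma> k (fst p) (snd p))"
      by (simp add: prod.distrib sum.cartesian_product case_prod_beta)
    also have "(\<Prod>k\<in>UNIV. \<Sum>p\<in>UNIV. H $ fst p $ snd p * F \<sigma> k (fst p) (snd p))
      = (\<Sum>g\<in>UNIV. \<Prod>k\<in>UNIV. H $ fst (g k) $ snd (g k) * F \<sigma> k (fst (g k)) (snd (g k)))"
      by (subst prod_sum_PiE) auto
    also have "\<dots> = (\<Sum>(x, y)\<in>UNIV. \<Prod>k\<in>UNIV. H $ x k $ y k * F \<sigma> k (x k) (y k))"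
      by (rule sum.reindex_bij_witness[of _ "\<lambda>(x, y) k. (x k, y k)" "\<lambda>g. (fst \<circ> g, snd \<circ> g)"]) auto
    also have "\<dots> = (\<Sum>x\<in>UNIV. \<Sum>y\<in>UNIV. (\<Prod>k\<in>UNIV. H $ x k $ y k) * (\<Prod>k\<in>UNIV. F \<sigma> k (x k) (y k)))"
      by (simp add: sum.cartesian_product prod.distrib)
    finally show ?thesis .
  qed
  then have "(\<Sum>\<sigma> | \<sigma> permutes UNIV. of_int (sign \<sigma>) * (\<Prod>k\<in>UNIV. \<i> *
      (\<Sum>i\<in>UNIV. \<Sum>j\<in>UNIV. H $ i $ j * F \<sigma> k i j)))
    = (\<Sum>\<sigma> | \<sigma> permutes UNIV. \<Sum>x\<in>UNIV. \<Sum>y\<in>UNIV. \<i> ^ CARD('n) *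
        ((\<Prod>k\<in>UNIV. H $ x k $ y k) * (of_int (sign \<sigma>) * (\<Prod>k\<in>UNIV. F \<sigma> k (x k) (y k)))))"
    by (simp add: sum_distrib_left ac_simps)
  also have "\<dots> = (\<Sum>x\<in>UNIV. \<Sum>y\<in>UNIV. \<Sum>\<sigma> | \<sigma> permutes UNIV. \<i> ^ CARD('n) *
        ((\<Prod>k\<in>UNIV. H $ x k $ y k) * (of_int (sign \<sigma>) * (\<Prod>k\<in>UNIV. F \<sigma> k (x k) (y k)))))"
    by (subst sum.swap, rule sum.cong[OF refl], rule sum.swap)
  \<comment> \<open>After the exchange of sums, the inner sum over \<sigma> is a Leibniz
    expansion.\<close>
  also have "\<dots> = \<i> ^ CARD('n) * (\<Sum>x\<in>UNIV. \<Sum>y\<in>UNIV. G x y)"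
    by (simp add: G_def det_frame_matrix_expand F_def sum_distrib_left)
  also have "(\<Sum>x\<in>UNIV. \<Sum>y\<in>UNIV. G x y) = (\<Sum>x | x permutes UNIV. \<Sum>y\<in>UNIV. G x y)"
  proof (rule sum.mono_neutral_right)
    show "\<forall>x\<in>UNIV - {x. x permutes UNIV}. (\<Sum>y\<in>UNIV. G x y) = 0"
      by (auto simp: G_def det_frame_matrix_not_inj permutes_def bij_def bij_iff[symmetric] finite_UNIV_inj_surj intro!: sum.neutral)
  qed auto
  also have "\<dots> = (\<Sum>x | x permutes UNIV. \<Sum>y | y permutes UNIV. G x y)"
  proof (rule sum.cong[OF refl], rule sum.mono_neutral_right)
    show "\<forall>y\<in>UNIV - {y. y permutes UNIV}. G x y = 0" for x
      by (auto simp: G_def det_frame_matrix_not_inj permutes_def bij_def bij_iff[symmetric] finite_UNIV_inj_surj intro!: sum.neutral)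
  qed auto
  \<comment> \<open>For fixed \<open>x\<close> the sum over \<open>y\<close> is the determinant of
    \<open>H\<close> with rows permuted by \<open>x\<close>; the resulting sign cancels the sign of
    \<open>x\<close> in \<open>det_frame_matrix\<close>.\<close>
  also have "\<dots> = (\<Sum>x | x permutes (UNIV :: 'n set). (- 2 * \<i>) ^ CARD('n) * det H)"
  proof (rule sum.cong[OF refl])
    fix x :: "'n \<Rightarrow> 'n" assume x: "x \<in> {x. x permutes UNIV}"
    have "(\<Sum>y | y permutes UNIV. G x y)
      = (- 2 * \<i>) ^ CARD('n) * (of_int (sign x) * (\<Sum>y | y permutes UNIV. of_int (sign y) * (\<Prod>k\<in>UNIV. H $ x k $ y k)))"
      using x by (simp add: G_def det_frame_matrix sum_distrib_left ac_simps)
    also have "(\<Sum>y | y permutes UNIV. of_int (sign y) * (\<Prod>k\<in>UNIV. H $ x k $ y k)) = det (\<chi> k. H $ x k)"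
      by (simp add: det_def)
    also have "\<dots> = of_int (sign x) * det H"
      using x by (simp add: det_permute_rows)
    finally show "(\<Sum>y | y permutes UNIV. G x y) = (- 2 * \<i>) ^ CARD('n) * det H"
      by (simp add: mult.assoc[symmetric] flip: of_int_mult)
  qed
  also have "\<i> ^ CARD('n) * \<dots> = (\<i> * (- 2 * \<i>)) ^ CARD('n) * fact CARD('n) * det H"
    by (subst power_mult_distrib) (simp add: card_permutations ac_simps)
  also have "\<i> * (- 2 * \<i>) = 2"
    by (simp add: complex_eq_iff)
  finally show ?thesis
    by (simp add: F_def)
qed

text \<open>On frame vectors the form is the antisymmetrization of \<open>X\<close>. The factor 2^n
  this produces cancels the denominator of \<open>top_wedge_power\<close>; the factor 2^n that
  remains comes from \<i> (-2 \<i>) = 2 in each slot.\<close>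

theorem top_wedge_power_fundamental_form:
  fixes H :: "complex^'n^'n::finite"
  assumes "hermitian H"
  shows "top_wedge_power (fundamental_form H) = 2 ^ CARD('n) * fact CARD('n) * Re (det H)"
proof -
  define X where "X p q = \<i> * (\<Sum>i\<in>UNIV. \<Sum>j\<in>UNIV. H $ i $ j * (real_frame p $ i * cnj (real_frame q $ j)))"
    for p q :: "'n \<times> bool"
  have "complex_of_real (fundamental_form H (real_frame p) (real_frame q)) = X p q - X q p" for p q
  proof -
    define s where "s p q = (\<Sum>i\<in>UNIV. \<Sum>j\<in>UNIV. H $ i $ j * (real_frame p $ i * cnj (real_frame q $ j)))"
      for p q :: "'n \<times> bool"
    have c: "s q p = cnj (s p q)" for p q
    proof -
      have "cnj (s p q) = (\<Sum>i\<in>UNIV. \<Sum>j\<in>UNIV. H $ j $ i * (real_frame q $ j * cnj (real_frame p $ i)))"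
        by (simp add: s_def hermitianD[OF assms] ac_simps)
      then show ?thesis
        unfolding s_def by (subst sum.swap) simp
    qed
    have "fundamental_form H (real_frame p) (real_frame q) = Re (\<i> * (s p q - s q p))"
      by (simp add: fundamental_form_def s_def right_diff_distrib sum_subtractf)
    moreover have "\<i> * (s p q - s q p) = of_real (Re (\<i> * (s p q - s q p)))"
      unfolding c[of p q] by (simp add: complex_eq_iff)
    ultimately show ?thesis
      by (simp add: X_def s_def right_diff_distrib)
  qed
  then have "complex_of_real (top_wedge_power (fundamental_form H))
    = (\<Sum>\<sigma> | \<sigma> permutes UNIV. of_int (sign \<sigma>) *
      (\<Prod>k\<in>UNIV. X (\<sigma> (k, False)) (\<sigma> (k, True)) - X (\<sigma> (k, True)) (\<sigma> (k, False)))) / 2 ^ CARD('n)"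
    by (simp add: top_wedge_power_def)
  also have "\<dots> = 2 ^ CARD('n) * fact CARD('n) * det H"
    unfolding alternating_sum_antisymmetrize by (simp add: X_def alternating_sum_det)
  also have "\<dots> = complex_of_real (2 ^ CARD('n) * fact CARD('n)) * det H"
    by simp
  finally have "Re (complex_of_real (top_wedge_power (fundamental_form H)))
    = Re (complex_of_real (2 ^ CARD('n) * fact CARD('n)) * det H)"
    by (rule arg_cong)
  moreover have "Re (complex_of_real c * z) = c * Re z" for c z
    by simp
  ultimately show ?thesis
    unfolding Re_complex_of_real by metis
qed

section \<open>Positive definite Hermitian matrices\<close>

definition hform :: "complex^'n^'n::finite \<Rightarrow> complex^'n \<Rightarrow> complex^'n \<Rightarrow> complex"
  where "hform H v w = (\<Sum>i\<in>UNIV. \<Sum>j\<in>UNIV. H $ i $ j * v $ i * cnj (w $ j))"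

text \<open>\<open>hform\<close> pairs the rows of \<open>H\<close> with its unconjugated argument,
  whereas matrix-vector multiplication contracts columns; conjugating vectors passes from one
  convention to the other.\<close>

definition cnj_vec :: "complex^'n::finite \<Rightarrow> complex^'n"
  where "cnj_vec v = (\<chi> i. cnj (v $ i))"

lemma hform_add_left: "hform H (u + v) w = hform H u w + hform H v w"
  and hform_add_right: "hform H u (v + w) = hform H u v + hform H u w"
  and hform_scale_left: "hform H (c *s v) w = c * hform H v w"
  and hform_scale_right: "hform H v (c *s w) = cnj c * hform H v w"
  and hform_zero: "hform H 0 v = 0" "hform H v 0 = 0"
  by (simp_all add: hform_def algebra_simps sum.distrib sum_distrib_left)

lemma hform_axis: "hform H (axis i 1) (axis j 1) = H $ i $ j"
proof -
  have "H $ k $ l * axis i 1 $ k * cnj (axis j 1 $ l) = (if l = j then if k = i then H $ k $ l else 0 else 0)" for k l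
    by (simp add: axis_def)
  then show ?thesis by (simp add: hform_def)
qed

lemma pos_def_matrix_hform:
  "pos_def_matrix H \<longleftrightarrow> (\<forall>v. v \<noteq> 0 \<longrightarrow> Im (hform H v v) = 0 \<and> Re (hform H v v) > 0)"
  by (simp add: pos_def_matrix_def hform_def)

lemma hform_cnj: "hermitian H \<Longrightarrow> cnj (hform H v w) = hform H w v"
proof -
  assume H: "hermitian H"
  have "cnj (hform H v w) = (\<Sum>i\<in>UNIV. \<Sum>j\<in>UNIV. H $ j $ i * w $ j * cnj (v $ i))"
    by (simp add: hform_def hermitianD[OF H] ac_simps)
  then show ?thesis
    unfolding hform_def by (subst sum.swap) simp
qed

text \<open>Polarization: reality of the form at \<open>v + w\<close> and at
  \<open>v + \<i> w\<close> determines the imaginary and the real part of \<open>hform H w v\<close>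
  from \<open>hform H v w\<close>.\<close>

lemma pos_def_matrix_hermitian:
  fixes H :: "complex^'n^'n::finite"
  assumes "pos_def_matrix H"
  shows "hermitian H"
proof -
  have real: "Im (hform H v v) = 0" for v
    using assms by (cases "v = 0") (auto simp: pos_def_matrix_hform hform_zero)
  have "hform H w v = cnj (hform H v w)" for v w
  proof -
    have "Im (hform H v w + hform H w v) = 0"
      using real[of "v + w"] real[of v] real[of w] by (simp add: hform_add_left hform_add_right)
    moreover have "Im (hform H v (\<i> *s w) + hform H (\<i> *s w) v) = 0"
      using real[of "v + \<i> *s w"] real[of v] real[of "\<i> *s w"] by (simp add: hform_add_left hform_add_right)
    ultimately show ?thesis
      by (simp add: hform_scale_left hform_scale_right complex_eq_iff)
  qed
  from this[of "axis i 1" "axis j 1" for i j] show ?thesis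
    unfolding hermitian_def hform_axis by blast
qed

lemma pos_def_matrix_nonneg: "pos_def_matrix H \<Longrightarrow> 0 \<le> Re (hform H v v)"
  by (cases "v = 0") (auto simp: pos_def_matrix_hform hform_zero less_imp_le)

lemma hermitian_norm_hform: "hermitian_norm H v = sqrt (Re (hform H v v))"
  by (simp add: hermitian_norm_def hform_def)

text \<open>The conjugate of a kernel vector would be isotropic.\<close>

lemma pos_def_matrix_det_nonzero:
  fixes H :: "complex^'n^'n::finite"
  assumes "pos_def_matrix H"
  shows "det H \<noteq> 0"
proof
  assume "det H = 0"
  then have "\<not> (\<forall>x. H *v x = 0 \<longrightarrow> x = 0)"
    using invertible_det_nz[of H] invertible_left_inverse[of H] matrix_left_invertible_ker[of H] by auto
  then obtain x where x: "H *v x = 0" "x \<noteq> 0" by blast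
  have "hform H (cnj_vec x) (cnj_vec x) = (\<Sum>i\<in>UNIV. cnj (x $ i) * (H *v x) $ i)"
    by (simp add: hform_def cnj_vec_def matrix_vector_mult_def sum_distrib_left ac_simps)
  then have "hform H (cnj_vec x) (cnj_vec x) = 0"
    using x by simp
  moreover have "cnj_vec x \<noteq> 0"
    using x by (auto simp: cnj_vec_def vec_eq_iff)
  ultimately show False
    using assms by (auto simp: pos_def_matrix_hform)
qed

lemma hermitian_det_real:
  assumes "hermitian H"
  shows "Im (det H) = 0"
proof -
  have "cnj (det H) = det (transpose H)"
    by (simp add: det_def transpose_def hermitianD[OF assms])
  then have "cnj (det H) = det H"
    by (simp only: det_transpose)
  then show ?thesis
    by (simp add: complex_eq_iff)
qed

lemma hform_mat_1: "hform (mat 1) v v = of_real ((norm v)\<^sup>2)"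
proof -
  have "hform (mat 1) v v = (\<Sum>i\<in>UNIV. \<Sum>j\<in>UNIV. if i = j then v $ i * cnj (v $ i) else 0)"
    unfolding hform_def by (intro sum.cong refl) (simp add: mat_def)
  also have "\<dots> = (\<Sum>i\<in>UNIV. v $ i * cnj (v $ i))"
    by simp
  also have "\<dots> = of_real (\<Sum>i\<in>UNIV. (norm (v $ i))\<^sup>2)"
    by (simp only: complex_norm_square of_real_sum)
  finally show ?thesis
    by (simp add: norm_vec_def L2_set_def sum_nonneg)
qed

text \<open>Along the segment from the identity to \<open>H\<close> all matrices are positive
  definite, so the determinant is real and never zero; it starts at 1 and cannot change
  sign.\<close>

lemma pos_def_matrix_det_pos:
  fixes H :: "complex^'n^'n::finite"
  assumes "pos_def_matrix H"
  shows "Re (det H) > 0"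
proof (rule ccontr)
  define A where "A t = (\<chi> i j. of_real t * H $ i $ j + of_real (1 - t) * mat 1 $ i $ j)" for t
  have hf: "hform (A t) v v = of_real t * hform H v v + of_real (1 - t) * hform (mat 1) v v" for t v
    by (simp add: A_def hform_def algebra_simps sum.distrib sum_distrib_left sum_subtractf)
  have pd: "pos_def_matrix (A t)" if "0 \<le> t" "t \<le> 1" for t
    unfolding pos_def_matrix_hform
  proof (intro allI impI)
    fix v :: "complex^'n" assume v: "v \<noteq> 0"
    have *: "Im (hform H v v) = 0" "Re (hform H v v) > 0"
      using assms v by (auto simp: pos_def_matrix_hform)
    have "t * Re (hform H v v) + (1 - t) * (norm v)\<^sup>2 > 0"
      using that * v by (cases "t = 0") (auto intro!: add_pos_nonneg)
    with * show "Im (hform (A t) v v) = 0 \<and> Re (hform (A t) v v) > 0"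
      by (simp add: hf hform_mat_1)
  qed
  assume "\<not> ?thesis"
  moreover have "A 1 = H" "A 0 = mat 1"
    by (simp_all add: A_def vec_eq_iff)
  moreover have "continuous_on {0..1} (\<lambda>t. Re (det (A t)))"
    unfolding det_def A_def by (auto intro!: continuous_intros)
  ultimately obtain t where "0 \<le> t" "t \<le> 1" "Re (det (A t)) = 0"
    using IVT2'[of "\<lambda>t. Re (det (A t))" 1 0 0] by (auto simp: det_I)
  then show False
    using pos_def_matrix_det_nonzero[OF pd[of t]] hermitian_det_real[OF pos_def_matrix_hermitian[OF pd[of t]]]
    by (simp add: complex_eq_iff)
qed

section \<open>The determinant of a rank-one perturbation of the identity\<close>

lemma det_identity_with_row:
  fixes v :: "complex^'n::finite" and u :: "'n \<Rightarrow> complex"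
  assumes "a \<notin> S"
  shows "det (\<chi> i. if i = a then v else if i \<in> S then axis i 1 + u i *s v else axis i 1 :: complex^'n^'n) = v $ a"
  using finite[of S] assms
proof (induction S rule: finite_induct)
  case empty
  have r: "row i (mat 1 :: complex^'n^'n) = axis i 1" for i
    by (auto simp: row_def mat_def axis_def vec_eq_iff)
  show ?case
    using cramer_lemma_transpose[of a v "mat 1"]
    unfolding r basis_expansion empty_iff if_False det_I mult_1_right .
next
  case (insert b S)
  define c where "c i = (if i = a then v else if i \<in> S then axis i 1 + u i *s v else axis i 1)" for i
  have ab: "a \<noteq> b" "b \<notin> S" "a \<notin> S" using insert by auto
  have "det (\<chi> i. if i = a then v else if i \<in> insert b S then axis i 1 + u i *s v else axis i 1 :: complex^'n^'n)
    = det (\<chi> i. if i = b then axis b 1 + u b *s v else c i)"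
    using ab by (intro arg_cong[where f = det]) (auto simp: c_def vec_eq_iff)
  \<comment> \<open>Linearity in row \<open>b\<close>. The part with \<open>v\<close> in row
    \<open>b\<close> has two equal rows, as row \<open>a\<close> is \<open>v\<close> too, so
    multiples of \<open>v\<close> disappear from the rows of \<open>S\<close> one by one.\<close>
  also have "\<dots> = det (\<chi> i. if i = b then axis b 1 else c i) + u b * det (\<chi> i. if i = b then v else c i)"
    by (simp add: det_row_add[of b "\<lambda>_. axis b 1" "\<lambda>_. u b *s v" c] det_row_mul[of b _ "\<lambda>_. v" c])
  also have "det (\<chi> i. if i = b then v else c i) = 0"
    using ab by (intro det_identical_rows[of a b]) (auto simp: row_def c_def)
  also have "(\<chi> i. if i = b then axis b 1 else c i) = (\<chi> i. c i)"
    using ab by (auto simp: c_def vec_eq_iff)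
  finally show ?case
    using insert by (simp add: c_def)
qed

text \<open>The rows are perturbed one at a time; perturbing row \<open>a\<close> adds
  \<open>u $ a\<close> times a determinant whose row \<open>a\<close> is \<open>v\<close>, that is,
  \<open>u $ a * v $ a\<close>.\<close>

lemma det_identity_plus_rank_one:
  fixes u v :: "complex^'n::finite"
  shows "det (\<chi> i j. (if i = j then 1 else 0) + u $ i * v $ j) = 1 + (\<Sum>i\<in>UNIV. u $ i * v $ i)"
proof -
  have "det (\<chi> i. if i \<in> S then axis i 1 + u $ i *s v else axis i 1 :: complex^'n^'n)
    = 1 + (\<Sum>i\<in>S. u $ i * v $ i)" for S
    using finite[of S]
  proof (induction S rule: finite_induct)
    case empty
    have "(\<chi> i. axis i 1) = (mat 1 :: complex^'n^'n)"
      by (auto simp: mat_def axis_def vec_eq_iff)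
    then show ?case by simp
  next
    case (insert a S)
    define c where "c i = (if i \<in> S then axis i 1 + u $ i *s v else axis i 1)" for i
    have "det (\<chi> i. if i \<in> insert a S then axis i 1 + u $ i *s v else axis i 1 :: complex^'n^'n)
      = det (\<chi> i. if i = a then axis a 1 + u $ a *s v else c i)"
      by (intro arg_cong[where f = det]) (auto simp: c_def vec_eq_iff)
    also have "\<dots> = det (\<chi> i. if i = a then axis a 1 else c i) + u $ a * det (\<chi> i. if i = a then v else c i)"
      by (simp add: det_row_add[of a "\<lambda>_. axis a 1" "\<lambda>_. u $ a *s v" c] det_row_mul[of a _ "\<lambda>_. v" c])
    also have "det (\<chi> i. if i = a then v else c i) = v $ a"
      unfolding c_def by (rule det_identity_with_row) fact
    also have "(\<chi> i. if i = a then axis a 1 else c i) = (\<chi> i. c i)"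
      using insert by (auto simp: c_def vec_eq_iff)
    finally show ?case
      using insert by (simp add: c_def)
  qed
  from this[of UNIV] have "det (\<chi> i. axis i 1 + u $ i *s v :: complex^'n^'n) = 1 + (\<Sum>i\<in>UNIV. u $ i * v $ i)"
    by (simp add: Cart_lambda_cong[of "\<lambda>i. if i \<in> UNIV then axis i 1 + u $ i *s v else axis i 1"])
  moreover have "(\<chi> i j. (if i = j then 1 else 0) + u $ i * v $ j) = (\<chi> i. axis i 1 + u $ i *s v)"
    by (auto simp: axis_def vec_eq_iff)
  ultimately show ?thesis
    by simp
qed

section \<open>The dual Hermitian form on covectors\<close>

definition inv_form :: "complex^'n^'n::finite \<Rightarrow> complex^'n \<Rightarrow> complex^'n \<Rightarrow> complex"
  where "inv_form H b c = (\<Sum>i\<in>UNIV. \<Sum>j\<in>UNIV. matrix_inv H $ j $ i * b $ i * cnj (c $ j))"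

lemma inv_form_matrix_inv: "inv_form H b c = (\<Sum>j\<in>UNIV. cnj (c $ j) * (matrix_inv H *v b) $ j)"
  unfolding inv_form_def
  by (subst sum.swap) (simp add: matrix_vector_mult_def sum_distrib_left ac_simps)

lemma inv_form_add_left: "inv_form H (a + b) c = inv_form H a c + inv_form H b c"
  and inv_form_add_right: "inv_form H a (b + c) = inv_form H a b + inv_form H a c"
  and inv_form_scale_left: "inv_form H (s *s b) c = s * inv_form H b c"
  and inv_form_scale_right: "inv_form H b (s *s c) = cnj s * inv_form H b c"
  by (simp_all add: inv_form_def algebra_simps sum.distrib sum_distrib_left)

context
  fixes H :: "complex^'n^'n::finite"
  assumes H: "pos_def_matrix H"
begin

lemma matrix_inv_mult_vec: "H *v (matrix_inv H *v b) = b"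
proof -
  have "H ** matrix_inv H = mat 1"
    using pos_def_matrix_det_nonzero[OF H] invertible_det_nz[of H]
    unfolding invertible_def matrix_inv_def by (metis (mono_tags, lifting) someI_ex)
  then show ?thesis
    by (simp add: matrix_vector_mul_assoc)
qed

text \<open>Covectors are identified with vectors through \<open>H\<close>; conjugation exchanges
  the two arguments. Symmetry and positivity of the dual form are inherited from
  \<open>hform\<close>.\<close>

lemma inv_form_hform: "inv_form H b c = hform H (cnj_vec (matrix_inv H *v c)) (cnj_vec (matrix_inv H *v b))"
proof -
  define w where "w = matrix_inv H *v c"
  have c: "c $ j = (\<Sum>k\<in>UNIV. H $ j $ k * w $ k)" for j
    using matrix_inv_mult_vec[of c] unfolding w_def[symmetric]
    by (auto simp: matrix_vector_mult_def vec_eq_iff)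
  have "inv_form H b c = (\<Sum>j\<in>UNIV. \<Sum>k\<in>UNIV. H $ k $ j * cnj (w $ k) * (matrix_inv H *v b) $ j)"
    unfolding inv_form_matrix_inv
    by (simp add: c hermitianD[OF pos_def_matrix_hermitian[OF H]] sum_distrib_right)
  then show ?thesis
    unfolding hform_def by (subst sum.swap) (simp add: w_def cnj_vec_def)
qed

lemma inv_form_cnj: "cnj (inv_form H b c) = inv_form H c b"
  unfolding inv_form_hform by (rule hform_cnj[OF pos_def_matrix_hermitian[OF H]])

lemma inv_form_nonneg: "0 \<le> Re (inv_form H b b)"
  unfolding inv_form_hform by (rule pos_def_matrix_nonneg[OF H])

lemma inv_form_real: "inv_form H b b = of_real (Re (inv_form H b b))"
  using inv_form_cnj[of b b] by (simp add: complex_eq_iff)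

text \<open>Cramer's rule: the components of adj(H) b are free of denominators.\<close>

lemma det_mult_matrix_inv:
  "det H * (matrix_inv H *v b) $ k = det (\<chi> i j. if j = k then b $ i else H $ i $ j)"
  using cramer_lemma[of k H "matrix_inv H *v b"] unfolding matrix_inv_mult_vec by simp

text \<open>\<open>H\<close> factors out on the left: with w = H^(-1) b, the remaining factor is the
  identity minus the rank-one product of w with the conjugate of b.\<close>

lemma det_rank_one_update:
  "det (\<chi> i j. H $ i $ j - b $ i * cnj (b $ j)) = det H * (1 - inv_form H b b)"
proof -
  define w where "w = matrix_inv H *v b"
  have b: "b $ j = (\<Sum>k\<in>UNIV. H $ j $ k * w $ k)" for j
    using matrix_inv_mult_vec[of b] unfolding w_def[symmetric]
    by (auto simp: matrix_vector_mult_def vec_eq_iff)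
  have "(\<chi> i j. H $ i $ j - b $ i * cnj (b $ j))
    = H ** (\<chi> i j. (if i = j then 1 else 0) + (- w) $ i * cnj_vec b $ j)"
  proof -
    have "(\<Sum>k\<in>UNIV. H $ i $ k * ((if k = j then 1 else 0) + - w $ k * cnj (b $ j)))
      = H $ i $ j - b $ i * cnj (b $ j)" for i j
    proof -
      have "(\<Sum>k\<in>UNIV. H $ i $ k * ((if k = j then 1 else 0) + - w $ k * cnj (b $ j)))
        = (\<Sum>k\<in>UNIV. if k = j then H $ i $ k else 0) - (\<Sum>k\<in>UNIV. H $ i $ k * w $ k) * cnj (b $ j)"
        unfolding sum_distrib_right sum_subtractf[symmetric]
        by (rule sum.cong[OF refl]) (simp add: algebra_simps)
      then show ?thesis by (simp add: b[of i])
    qed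
    then show ?thesis
      by (simp add: matrix_matrix_mult_def cnj_vec_def vec_eq_iff)
  qed
  then have "det (\<chi> i j. H $ i $ j - b $ i * cnj (b $ j)) = det H * (1 + (\<Sum>i\<in>UNIV. (- w) $ i * cnj_vec b $ i))"
    by (simp only: det_mul det_identity_plus_rank_one)
  then show ?thesis
    unfolding inv_form_matrix_inv w_def[symmetric] by (simp add: cnj_vec_def sum_negf ac_simps)
qed

end

lemma hform_rank_one_update:
  assumes "\<And>i j. H $ i $ j = A $ i $ j + b $ i * cnj (b $ j)"
  shows "hform H v v = hform A v v + of_real ((norm (\<Sum>i\<in>UNIV. b $ i * v $ i))\<^sup>2)"
proof -
  have "hform H v v = hform A v v + (\<Sum>i\<in>UNIV. \<Sum>j\<in>UNIV. (b $ i * v $ i) * cnj (b $ j * v $ j))"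
    by (simp add: hform_def assms sum.distrib[symmetric] algebra_simps)
  also have "(\<Sum>i\<in>UNIV. \<Sum>j\<in>UNIV. (b $ i * v $ i) * cnj (b $ j * v $ j))
    = (\<Sum>i\<in>UNIV. b $ i * v $ i) * cnj (\<Sum>i\<in>UNIV. b $ i * v $ i)"
    by (simp only: sum_product cnj_sum)
  finally show ?thesis
    by (simp only: complex_norm_square)
qed

text \<open>Let \<open>t\<close> be the dual norm squared of \<open>b\<close>. The vector
  \<open>v\<close> dual to \<open>b\<close> has H-norm squared \<open>t\<close> and pairs with
  \<open>b\<close> to \<open>t\<close>, so t = A(v, v) + t^2 \<ge> t^2.\<close>

lemma inv_form_rank_one_le_1:
  assumes H: "pos_def_matrix H" and A: "pos_def_matrix A"
    and HA: "\<And>i j. H $ i $ j = A $ i $ j + b $ i * cnj (b $ j)"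
  shows "Re (inv_form H b b) \<le> 1"
proof -
  define t where "t = Re (inv_form H b b)"
  define v where "v = cnj_vec (matrix_inv H *v b)"
  have t: "inv_form H b b = of_real t"
    unfolding t_def by (rule inv_form_real[OF H])
  have "(\<Sum>i\<in>UNIV. b $ i * v $ i) = cnj (inv_form H b b)"
    by (simp add: inv_form_matrix_inv v_def cnj_vec_def)
  then have "(\<Sum>i\<in>UNIV. b $ i * v $ i) = of_real t"
    by (simp add: t)
  then have "of_real t = hform A v v + of_real (t\<^sup>2)"
    using hform_rank_one_update[OF HA, of v] inv_form_hform[OF H, of b b]
    unfolding v_def[symmetric] by (simp add: t)
  then have "t = Re (hform A v v) + t\<^sup>2"
    by (metis Re_complex_of_real plus_complex.sel(1))
  then have "t * t \<le> t * 1"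
    using pos_def_matrix_nonneg[OF A, of v] by (simp add: power2_eq_square)
  moreover have "0 \<le> t"
    unfolding t_def by (rule inv_form_nonneg[OF H])
  ultimately have "t \<le> 1"
    by (metis mult_le_cancel_left_pos order_le_less zero_le_one)
  then show ?thesis by (simp add: t_def)
qed

section \<open>Wirtinger calculus and integration by parts\<close>

lemma d_z_eq: "(f has_derivative f') (at z) \<Longrightarrow> d_z j f z = (f' (axis j 1) - \<i> * f' (axis j \<i>)) / 2"
  and d_zbar_eq: "(f has_derivative f') (at z) \<Longrightarrow> d_zbar j f z = (f' (axis j 1) + \<i> * f' (axis j \<i>)) / 2"
  using frechet_derivative_at by (metis d_z_def, metis d_zbar_def)

lemma smooth_on_d_z: "open S \<Longrightarrow> smooth_on S f \<Longrightarrow> smooth_on S (d_z j f)"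
  and smooth_on_d_zbar: "open S \<Longrightarrow> smooth_on S f \<Longrightarrow> smooth_on S (d_zbar j f)"
proof -
  assume S: "open S" "smooth_on S f"
  have "smooth_on S (\<lambda>z. (1/2) * (frechet_derivative f (at z) (axis j 1) - \<i> * frechet_derivative f (at z) (axis j \<i>)))"
    "smooth_on S (\<lambda>z. (1/2) * (frechet_derivative f (at z) (axis j 1) + \<i> * frechet_derivative f (at z) (axis j \<i>)))"
    by (intro smooth_intros S)+
  then show "smooth_on S (d_z j f)" "smooth_on S (d_zbar j f)"
    by (simp_all add: d_z_def[abs_def] d_zbar_def[abs_def])
qed

lemma d_z_d_zbar_commute:
  fixes f :: "complex^'n::finite \<Rightarrow> complex"
  assumes S: "open S" "z \<in> S" and f: "smooth_on S f"
  shows "d_zbar k (d_z i f) z = d_z i (d_zbar k f) z"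
    and "d_zbar k (d_zbar j f) z = d_zbar j (d_zbar k f) z"
proof -
  define D where "D v x = frechet_derivative f (at x) v" for v x
  define E where "E v w = frechet_derivative (D v) (at z) w" for v w
  have D: "(D v has_derivative E v) (at z)" for v
    unfolding E_def D_def[abs_def] using smooth_on_has_derivative[OF smooth_on_derivative[OF f] S(2)] .
  have "((\<lambda>z. (D (axis j 1) z - \<i> * D (axis j \<i>) z) / 2) has_derivative
      (\<lambda>v. (E (axis j 1) v - \<i> * E (axis j \<i>) v) / 2)) (at z)" for j
    using D by (auto intro!: derivative_eq_intros)
  then have z: "(d_z j f has_derivative (\<lambda>v. (E (axis j 1) v - \<i> * E (axis j \<i>) v) / 2)) (at z)" for j
    by (simp add: d_z_def[abs_def] D_def[abs_def])
  have "((\<lambda>z. (D (axis j 1) z + \<i> * D (axis j \<i>) z) / 2) has_derivative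
      (\<lambda>v. (E (axis j 1) v + \<i> * E (axis j \<i>) v) / 2)) (at z)" for j
    using D by (auto intro!: derivative_eq_intros)
  then have zbar: "(d_zbar j f has_derivative (\<lambda>v. (E (axis j 1) v + \<i> * E (axis j \<i>) v) / 2)) (at z)" for j
    by (simp add: d_zbar_def[abs_def] D_def[abs_def])
  have c: "E v w = E w v" for v w
    unfolding E_def D_def[abs_def]
    using f frechet_derivative_commute[OF S, of f v w] unfolding smooth_on_def by blast
  show "d_zbar k (d_z i f) z = d_z i (d_zbar k f) z"
    unfolding d_zbar_eq[OF z] d_z_eq[OF zbar]
    using c[of "axis i 1" "axis k 1"] c[of "axis i 1" "axis k \<i>"]
      c[of "axis i \<i>" "axis k 1"] c[of "axis i \<i>" "axis k \<i>"]
    by (simp add: algebra_simps diff_divide_distrib add_divide_distrib)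
  show "d_zbar k (d_zbar j f) z = d_zbar j (d_zbar k f) z"
    unfolding d_zbar_eq[OF zbar]
    using c[of "axis j 1" "axis k 1"] c[of "axis j 1" "axis k \<i>"]
      c[of "axis j \<i>" "axis k 1"] c[of "axis j \<i>" "axis k \<i>"]
    by (simp add: algebra_simps diff_divide_distrib add_divide_distrib)
qed

definition grad_z :: "(complex^'n::finite \<Rightarrow> real) \<Rightarrow> complex^'n \<Rightarrow> complex^'n"
  where "grad_z f z = (\<chi> i. d_z i (\<lambda>w. complex_of_real (f w)) z)"

lemma has_derivative_of_real_compose:
  "(f has_derivative f') F \<Longrightarrow> ((\<lambda>w. complex_of_real (f w)) has_derivative (\<lambda>v. of_real (f' v))) F"
  by (rule bounded_linear.has_derivative[OF bounded_linear_of_real])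

lemma grad_z_eq:
  assumes "(f has_derivative f') (at z)"
  shows "grad_z f z $ i = (of_real (f' (axis i 1)) - \<i> * of_real (f' (axis i \<i>))) / 2"
  unfolding grad_z_def by (simp add: d_z_eq[OF has_derivative_of_real_compose[OF assms]])

lemma d_zbar_of_real:
  assumes "f differentiable (at z)"
  shows "d_zbar i (\<lambda>w. complex_of_real (f w)) z = cnj (grad_z f z $ i)"
proof -
  obtain f' where f': "(f has_derivative f') (at z)"
    using assms by (auto simp: differentiable_def)
  show ?thesis
    unfolding grad_z_eq[OF f'] d_zbar_eq[OF has_derivative_of_real_compose[OF f']] by simp
qed

text \<open>The differential of a real function is twice the real part of its (1,0) part. This 2
  becomes the Lipschitz constant of \<open>g\<close> in \<open>complete\<close>.\<close>

lemma derivative_grad_z: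
  fixes f :: "complex^'n::finite \<Rightarrow> real"
  assumes f': "(f has_derivative f') (at z)"
  shows "f' v = 2 * Re (\<Sum>i\<in>UNIV. grad_z f z $ i * v $ i)"
proof -
  have lin: "linear f'"
    using f' has_derivative_linear by blast
  have "v = (\<Sum>i\<in>UNIV. Re (v $ i) *\<^sub>R axis i 1 + Im (v $ i) *\<^sub>R axis i \<i>)"
  proof -
    have "(\<Sum>i\<in>UNIV. Re (v $ i) *\<^sub>R axis i 1 + Im (v $ i) *\<^sub>R axis i \<i>) $ k = v $ k" for k
    proof -
      have "(\<Sum>i\<in>UNIV. Re (v $ i) *\<^sub>R axis i 1 + Im (v $ i) *\<^sub>R axis i \<i>) $ k
        = (\<Sum>i\<in>UNIV. if i = k then of_real (Re (v $ k)) + \<i> * of_real (Im (v $ k)) else 0)"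
        unfolding sum_component
        by (rule sum.cong) (auto simp: axis_def complex_eq_iff)
      then show ?thesis by (simp add: complex_eq[symmetric])
    qed
    then show ?thesis by (simp add: vec_eq_iff)
  qed
  then have "f' v = f' (\<Sum>i\<in>UNIV. Re (v $ i) *\<^sub>R axis i 1 + Im (v $ i) *\<^sub>R axis i \<i>)"
    by simp
  also have "\<dots> = (\<Sum>i\<in>UNIV. Re (v $ i) * f' (axis i 1) + Im (v $ i) * f' (axis i \<i>))"
    by (simp add: linear_sum[OF lin] linear_add[OF lin] linear_scale[OF lin])
  also have "\<dots> = 2 * Re (\<Sum>i\<in>UNIV. grad_z f z $ i * v $ i)"
    by (simp add: grad_z_eq[OF f'] sum_distrib_left Re_divide_numeral Im_divide_numeral algebra_simps add_divide_distrib)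
  finally show ?thesis .
qed

lemma gradient_sq_inv_form:
  assumes "f differentiable (at z)"
  shows "gradient_sq H f z = Re (inv_form H (grad_z f z) (grad_z f z))"
  by (simp add: gradient_sq_def inv_form_def d_zbar_of_real[OF assms] grad_z_def[of f z, symmetric])
    (simp add: grad_z_def)

lemma grad_z_compose_real:
  assumes u: "u differentiable (at z)" and \<phi>: "(\<phi> has_real_derivative d) (at (u z))"
  shows "grad_z (\<lambda>w. \<phi> (u w)) z = of_real d *s grad_z u z"
proof -
  obtain u' where u': "(u has_derivative u') (at z)"
    using u by (auto simp: differentiable_def)
  have "((\<lambda>w. \<phi> (u w)) has_derivative (\<lambda>v. d * u' v)) (at z)"
    using has_derivative_compose[OF u' \<phi>[unfolded has_field_derivative_def]] .
  then show ?thesis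
    by (simp add: vec_eq_iff grad_z_eq[OF u'] grad_z_eq algebra_simps)
qed

section \<open>The Piola identity\<close>

lemma d_zbar_det:
  fixes A :: "'n::finite \<Rightarrow> 'n \<Rightarrow> complex^'m::finite \<Rightarrow> complex"
  assumes "\<And>j i. A j i differentiable (at z)"
  shows "d_zbar k (\<lambda>z. det (\<chi> j i. A j i z)) z
    = (\<Sum>l\<in>UNIV. det (\<chi> j i. if j = l then d_zbar k (A j i) z else A j i z))"
proof -
  define A' where "A' j i = frechet_derivative (A j i) (at z)" for j i
  have A': "(A j i has_derivative A' j i) (at z)" for j i
    using assms by (simp add: A'_def frechet_derivative_works[symmetric])
  have "((\<lambda>z. det (\<chi> j i. A j i z)) has_derivative
    (\<lambda>v. \<Sum>p | p permutes UNIV. of_int (sign p) *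
      (\<Sum>l\<in>UNIV. A' l (p l) v * (\<Prod>j\<in>UNIV - {l}. A j (p j) z)))) (at z)"
    unfolding det_def by (auto intro!: derivative_eq_intros A')
  then have "d_zbar k (\<lambda>z. det (\<chi> j i. A j i z)) z
    = ((\<Sum>p | p permutes UNIV. of_int (sign p) *
      (\<Sum>l\<in>UNIV. A' l (p l) (axis k 1) * (\<Prod>j\<in>UNIV - {l}. A j (p j) z)))
      + \<i> * (\<Sum>p | p permutes UNIV. of_int (sign p) *
      (\<Sum>l\<in>UNIV. A' l (p l) (axis k \<i>) * (\<Prod>j\<in>UNIV - {l}. A j (p j) z)))) / 2"
    by (rule d_zbar_eq)
  also have "\<dots> = (\<Sum>p | p permutes UNIV. of_int (sign p) *
      (\<Sum>l\<in>UNIV. d_zbar k (A l (p l)) z * (\<Prod>j\<in>UNIV - {l}. A j (p j) z)))"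
    by (simp add: d_zbar_eq[OF A'] sum_distrib_left sum_divide_distrib add_divide_distrib sum.distrib algebra_simps)
  also have "\<dots> = (\<Sum>l\<in>UNIV. \<Sum>p | p permutes UNIV. of_int (sign p) *
      (d_zbar k (A l (p l)) z * (\<Prod>j\<in>UNIV - {l}. A j (p j) z)))"
    unfolding sum_distrib_left by (rule sum.swap)
  also have "\<dots> = (\<Sum>l\<in>UNIV. det (\<chi> j i. if j = l then d_zbar k (A j i) z else A j i z))"
    unfolding det_def
  proof (intro sum.cong refl arg_cong2[where f = "(*)"])
    fix l p
    have "(\<Prod>j\<in>UNIV - {l}. A j (p j) z) = (\<Prod>j\<in>UNIV - {l}. if j = l then d_zbar k (A j (p j)) z else A j (p j) z)"
      by (rule prod.cong) auto
    then show "d_zbar k (A l (p l)) z * (\<Prod>j\<in>UNIV - {l}. A j (p j) z)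
      = (\<Prod>j\<in>UNIV. (\<chi> j i. if j = l then d_zbar k (A j i) z else A j i z) $ j $ p j)"
      by (simp add: prod.remove[of UNIV l])
  qed
  finally show ?thesis .
qed

text \<open>Component \<open>k\<close> of adj(H) \<partial>g. As a determinant it is polynomial in
  derivatives of \<open>g\<close>, hence smooth wherever \<open>g\<close> is.\<close>

definition cramer_field :: "(complex^'n::finite \<Rightarrow> real) \<Rightarrow> 'n \<Rightarrow> complex^'n \<Rightarrow> complex"
  where "cramer_field g k z = det (\<chi> i j. if j = k then grad_z g z $ i else complex_hessian g z $ i $ j)"

lemma smooth_on_grad_z:
  assumes S: "open S" and g: "smooth_on S g"
  shows "smooth_on S (\<lambda>z. grad_z g z $ i)"
  using smooth_on_d_z[OF S smooth_on_of_real[OF S g]] by (simp add: grad_z_def eta_contract_eq)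

lemma smooth_on_complex_hessian:
  assumes S: "open S" and g: "smooth_on S g"
  shows "smooth_on S (\<lambda>z. complex_hessian g z $ i $ j)"
  using smooth_on_d_z[OF S smooth_on_d_zbar[OF S smooth_on_of_real[OF S g]]]
  by (simp add: complex_hessian_def)

lemma smooth_on_det:
  fixes A :: "'a::real_normed_vector \<Rightarrow> complex^'n^'n::finite"
  assumes "open S" "\<And>i j. smooth_on S (\<lambda>z. A z $ i $ j)"
  shows "smooth_on S (\<lambda>z. det (A z))"
  unfolding det_def by (intro smooth_intros assms)

lemma smooth_on_cramer_field:
  assumes S: "open S" and g: "smooth_on S g"
  shows "smooth_on S (cramer_field g k)"
proof -
  have "smooth_on S (\<lambda>z. (\<chi> i j. if j = k then grad_z g z $ i else complex_hessian g z $ i $ j) $ i $ j)" for i j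
    using smooth_on_grad_z[OF assms] smooth_on_complex_hessian[OF assms] by (cases "j = k") auto
  from smooth_on_det[OF S this] show ?thesis
    by (simp add: cramer_field_def[abs_def])
qed

text \<open>The Piola identity in disguise: in the double sum over the replaced columns \<open>k\<close> and
  the differentiated columns \<open>l\<close>, the off-diagonal terms cancel in pairs, since third derivatives
  commute and swapping two columns changes the sign.\<close>

lemma divergence_cramer_field:
  fixes g :: "complex^'n::finite \<Rightarrow> real"
  assumes S: "open S" and z: "z \<in> S" and g: "smooth_on S g"
  shows "(\<Sum>k\<in>UNIV. d_zbar k (cramer_field g k) z) = of_nat CARD('n) * det (complex_hessian g z)"
proof -
  define G where "G = (\<lambda>w. complex_of_real (g w))"
  define b where "b = grad_z g z"
  define H where "H = complex_hessian g z"
  define w where "w k l = (\<chi> i. d_zbar k (d_z i (d_zbar l G)) z)" for k l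
  define E where "E k l = (if l = k then 0 else det (\<chi> j. if j = l then w k l else if j = k then b else column j H))" for k l
  have G: "smooth_on S G"
    unfolding G_def by (rule smooth_on_of_real[OF S g])
  have H: "H $ i $ j = d_z i (d_zbar j G) z" for i j
    by (simp add: H_def complex_hessian_def G_def)
  have "d_zbar k (cramer_field g k) z = det H + (\<Sum>l\<in>UNIV. E k l)" for k
  proof -
    define A where "A j i = (if j = k then d_z i G else d_z i (d_zbar j G))" for j i
    have A: "smooth_on S (A j i)" for j i
      unfolding A_def using smooth_on_d_z[OF S G] smooth_on_d_z[OF S smooth_on_d_zbar[OF S G]] by auto
    have dA: "A j i differentiable (at z)" for j i
      using smooth_on_has_derivative[OF A z] by (auto simp: differentiable_def)
    have "cramer_field g k y = det (\<chi> j i. A j i y)" for y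
    proof -
      have "cramer_field g k y = det (transpose (\<chi> i j. if j = k then grad_z g y $ i else complex_hessian g y $ i $ j))"
        by (simp add: cramer_field_def)
      then show ?thesis
        by (simp add: transpose_def A_def grad_z_def complex_hessian_def G_def if_distribR cong: if_cong)
    qed
    then have "d_zbar k (cramer_field g k) z = d_zbar k (\<lambda>y. det (\<chi> j i. A j i y)) z"
      by presburger
    also have "\<dots> = (\<Sum>l\<in>UNIV. det (\<chi> j i. if j = l then d_zbar k (A j i) z else A j i z))"
      by (rule d_zbar_det[OF dA])
    also have "\<dots> = det (\<chi> j i. if j = k then d_zbar k (A j i) z else A j i z)
       + (\<Sum>l\<in>UNIV - {k}. det (\<chi> j i. if j = l then d_zbar k (A j i) z else A j i z))"
      by (simp add: sum.remove[of UNIV k])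
    \<comment> \<open>Differentiating the inserted column \<partial>g in the k-th antiholomorphic
      direction restores column \<open>k\<close> of the Hessian, so every \<open>k\<close>
      contributes a full \<open>det H\<close>.\<close>
    also have "(\<chi> j i. if j = k then d_zbar k (A j i) z else A j i z) = transpose H"
      using d_z_d_zbar_commute(1)[OF S z G] by (simp add: transpose_def A_def H vec_eq_iff)
    also have "(\<Sum>l\<in>UNIV - {k}. det (\<chi> j i. if j = l then d_zbar k (A j i) z else A j i z))
      = (\<Sum>l\<in>UNIV - {k}. E k l)"
    proof (rule sum.cong[OF refl])
      fix l assume l: "l \<in> UNIV - {k}"
      have "(\<chi> j i. if j = l then d_zbar k (A j i) z else A j i z)
        = (\<chi> j. if j = l then w k l else if j = k then b else column j H)"
        using l by (simp add: A_def w_def b_def grad_z_def G_def[symmetric] column_def H vec_eq_iff)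
      then show "det (\<chi> j i. if j = l then d_zbar k (A j i) z else A j i z) = E k l"
        using l by (simp add: E_def)
    qed
    also have "\<dots> = (\<Sum>l\<in>UNIV. E k l)"
      by (rule sum.mono_neutral_left) (auto simp: E_def)
    finally show ?thesis by simp
  qed
  then have "(\<Sum>k\<in>UNIV. d_zbar k (cramer_field g k) z) = of_nat CARD('n) * det H + (\<Sum>k\<in>UNIV. \<Sum>l\<in>UNIV. E k l)"
    by (simp add: sum.distrib)
  moreover have "(\<Sum>k\<in>UNIV. \<Sum>l\<in>UNIV. E k l) = - (\<Sum>k\<in>UNIV. \<Sum>l\<in>UNIV. E k l)"
  proof -
    have E: "E k l = - E l k" for k l
    proof (cases "k = l")
      case False
      have wkl: "w k l = w l k"
      proof -
        have "d_zbar k (d_z i (d_zbar l G)) z = d_zbar l (d_z i (d_zbar k G)) z" for i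
        proof -
          have e: "d_zbar p (d_z i (d_zbar q G)) z = d_z i (d_zbar p (d_zbar q G)) z" for p q
            by (rule d_z_d_zbar_commute(1)[OF S z smooth_on_d_zbar[OF S G]])
          have "d_z i (d_zbar k (d_zbar l G)) z = d_z i (d_zbar l (d_zbar k G)) z"
          proof -
            have "frechet_derivative (d_zbar k (d_zbar l G)) (at z)
              = frechet_derivative (d_zbar l (d_zbar k G)) (at z)"
            proof (rule frechet_derivative_transform_within_open[OF _ S z])
              show "d_zbar k (d_zbar l G) differentiable at z"
                using smooth_on_has_derivative[OF smooth_on_d_zbar[OF S smooth_on_d_zbar[OF S G]] z]
                by (auto simp: differentiable_def)
            qed (rule d_z_d_zbar_commute(2)[OF S _ G])
            then show ?thesis by (simp add: d_z_def)
          qed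
          then show ?thesis by (simp add: e)
        qed
        then show ?thesis by (simp add: w_def)
      qed
      define M where "M = (\<chi> j. if j = l then w k l else if j = k then b else column j H)"
      have "(\<chi> j. if j = k then w l k else if j = l then b else column j H)
        = (\<chi> j. M $ Transposition.transpose k l j)"
        using False by (auto simp: M_def wkl Transposition.transpose_def vec_eq_iff)
      then have "det (\<chi> j. if j = k then w l k else if j = l then b else column j H)
        = of_int (sign (Transposition.transpose k l)) * det M"
        by (simp only: det_permute_rows[OF permutes_swap_id[of k UNIV l]] UNIV_I)
      then show ?thesis
        using False by (simp add: E_def M_def sign_swap_id)
    qed (simp add: E_def)
    have "(\<Sum>k\<in>UNIV. \<Sum>l\<in>UNIV. E k l) = (\<Sum>k\<in>UNIV. \<Sum>l\<in>UNIV. E l k)"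
      by (rule sum.swap)
    also have "\<dots> = (\<Sum>k\<in>UNIV. \<Sum>l\<in>UNIV. - E k l)"
      by (intro sum.cong refl) (rule E)
    finally show ?thesis by (simp add: sum_negf)
  qed
  then have "(\<Sum>k\<in>UNIV. \<Sum>l\<in>UNIV. E k l) = 0"
    by simp
  ultimately show ?thesis
    by (simp add: H_def)
qed

section \<open>Integrals of derivatives of compactly supported functions\<close>

lemma integrable_continuous_compact_support:
  fixes f :: "'a::euclidean_space \<Rightarrow> 'b::{banach, second_countable_topology}"
  assumes "continuous_on K f" "compact K" "\<And>x. x \<notin> K \<Longrightarrow> f x = 0"
  shows "integrable lborel f"
proof -
  have "integrable lborel (\<lambda>x. indicator K x *\<^sub>R f x)"
    using assms by (intro borel_integrable_compact)
  moreover have "(\<lambda>x. indicator K x *\<^sub>R f x) = f"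
    using assms(3) by (auto simp: indicator_def fun_eq_iff)
  ultimately show ?thesis by simp
qed

lemma derivative_zero_off_support:
  assumes "closed K" "\<And>x. x \<notin> K \<Longrightarrow> f x = 0" "x \<notin> K"
  shows "(f has_derivative (\<lambda>v. 0)) (at x)"
  by (rule has_derivative_transform_within_open[where f = "\<lambda>x. 0" and s = "- K"]) (use assms in auto)

text \<open>The difference quotients \<open>(f (x + v/n) - f x) n\<close> integrate to zero by translation invariance.\<close>

lemma integral_derivative_compact_support:
  fixes f :: "'a::euclidean_space \<Rightarrow> 'b::euclidean_space"
  assumes f: "Ck_on 1 UNIV f" and K: "compact K" and z: "\<And>x. x \<notin> K \<Longrightarrow> f x = 0"
  shows "integrable lborel (\<lambda>x. frechet_derivative f (at x) v)"
    and "integral\<^sup>L lborel (\<lambda>x. frechet_derivative f (at x) v) = 0"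
proof -
  define D where "D x = frechet_derivative f (at x) v" for x
  define q where "q n x = real (Suc n) *\<^sub>R (f (x + (1 / real (Suc n)) *\<^sub>R v) - f x)" for n x
  have f': "(f has_derivative frechet_derivative f (at x)) (at x)" for x
    using f by (simp add: frechet_derivative_works[symmetric])
  have cf: "continuous_on UNIV f"
    using Ck_on_SucD[of 0 UNIV f] f by simp
  have cD: "continuous_on UNIV D"
    using f by (simp add: D_def)
  have D0: "D x = 0" if "x \<notin> K" for x
    by (simp add: D_def frechet_derivative_at[OF derivative_zero_off_support[OF compact_imp_closed[OF K] z that], symmetric])
  show "integrable lborel (\<lambda>x. frechet_derivative f (at x) v)"
    using integrable_continuous_compact_support[OF continuous_on_subset[OF cD] K D0] by (simp add: D_def)
  have if': "integrable lborel f"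
    using integrable_continuous_compact_support[OF continuous_on_subset[OF cf] K z] by simp
  have translate: "integrable lborel (\<lambda>x. f (x + c))" "integral\<^sup>L lborel (\<lambda>x. f (x + c)) = integral\<^sup>L lborel f" for c
  proof -
    have m: "f \<in> borel_measurable borel"
      using cf by (rule borel_measurable_continuous_onI)
    have "integrable (distr lborel borel ((+) c)) f"
      using if' by (simp add: lborel_distr_plus)
    then show "integrable lborel (\<lambda>x. f (x + c))"
      by (simp add: integrable_distr_eq m add.commute)
    have "integral\<^sup>L lborel f = integral\<^sup>L (distr lborel borel ((+) c)) f"
      by (simp add: lborel_distr_plus)
    also have "\<dots> = integral\<^sup>L lborel (\<lambda>x. f (x + c))"
      by (subst integral_distr) (auto simp: m add.commute)
    finally show "integral\<^sup>L lborel (\<lambda>x. f (x + c)) = integral\<^sup>L lborel f" by simp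
  qed
  have q0: "integral\<^sup>L lborel (q n) = 0" for n
    unfolding q_def using translate if' by simp
  obtain M where M: "\<And>x. norm (D x) \<le> M"
  proof -
    have "bounded (D ` K)"
      using cD K by (meson compact_continuous_image compact_imp_bounded continuous_on_subset subset_UNIV)
    then obtain M where "\<And>x. x \<in> K \<Longrightarrow> norm (D x) \<le> M" "M > 0"
      unfolding bounded_pos by auto
    then show ?thesis
      using that[of M] D0 by (metis norm_zero less_imp_le)
  qed
  have M0: "0 \<le> M" using M norm_ge_zero order_trans by blast
  obtain R where R: "\<And>x. x \<in> K \<Longrightarrow> norm x \<le> R"
    using compact_imp_bounded[OF K] unfolding bounded_iff by blast
  \<comment> \<open>A dominating function independent of \<open>n\<close>: the mean value inequality
    bounds the quotient by \<open>M\<close>, and beyond radius \<open>R + norm v\<close> both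
    \<open>x\<close> and its translate, moved by at most \<open>norm v\<close>, miss
    \<open>K\<close>.\<close>
  have bound: "norm (q n x) \<le> indicator (cball 0 (R + norm v)) x *\<^sub>R M" for n x
  proof (cases "x \<in> cball 0 (R + norm v)")
    case True
    have "norm (f (x + (1 / real (Suc n)) *\<^sub>R v) - f x) \<le> M * (1 / real (Suc n))"
    proof -
      define p where "p t = f (x + t *\<^sub>R v)" for t
      have "(p has_derivative (\<lambda>s. s *\<^sub>R D (x + t *\<^sub>R v))) (at t)" for t
        using has_vector_derivative_line[OF f'] unfolding p_def D_def has_vector_derivative_def .
      moreover have "onorm (\<lambda>s. s *\<^sub>R D y) \<le> M" for y
        by (rule onorm_le) (simp add: mult.commute[of M] mult_left_mono M)
      ultimately have "norm (p (1 / real (Suc n)) - p 0) \<le> M * norm (1 / real (Suc n) - 0)"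
        by (intro differentiable_bound[where S = UNIV and f' = "\<lambda>t s. s *\<^sub>R D (x + t *\<^sub>R v)"]) auto
      then show ?thesis by (simp add: p_def)
    qed
    then have "norm (q n x) \<le> real (Suc n) * (M * (1 / real (Suc n)))"
      unfolding q_def norm_scaleR by (intro mult_mono) auto
    then show ?thesis using True by simp
  next
    case False
    have "x \<notin> K"
      using False R[of x] norm_ge_zero[of v] by auto
    moreover have "x + (1 / real (Suc n)) *\<^sub>R v \<notin> K"
    proof
      assume "x + (1 / real (Suc n)) *\<^sub>R v \<in> K"
      then have "norm (x + (1 / real (Suc n)) *\<^sub>R v) \<le> R" by (rule R)
      moreover have "norm x \<le> norm (x + (1 / real (Suc n)) *\<^sub>R v) + norm ((1 / real (Suc n)) *\<^sub>R v)"
        by (metis add_diff_cancel_right' norm_triangle_ineq4)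
      moreover have "norm ((1 / real (Suc n)) *\<^sub>R v) \<le> norm v"
        by (simp add: divide_le_eq mult_le_cancel_left1)
      ultimately show False using False by simp
    qed
    ultimately show ?thesis using False z by (simp add: q_def)
  qed
  have "(\<lambda>n. integral\<^sup>L lborel (q n)) \<longlonglongrightarrow> integral\<^sup>L lborel D"
  proof (rule integral_dominated_convergence[where w = "\<lambda>x. indicator (cball 0 (R + norm v)) x *\<^sub>R M"])
    show "D \<in> borel_measurable lborel"
      using cD by (simp add: borel_measurable_continuous_onI)
    show "q n \<in> borel_measurable lborel" for n
      unfolding q_def using translate(1) if' by (intro borel_measurable_scaleR borel_measurable_diff) auto
    show "integrable lborel (\<lambda>x::'a. indicator (cball 0 (R + norm v)) x *\<^sub>R M)"
      by (intro borel_integrable_compact) auto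
    show "AE x in lborel. (\<lambda>n. q n x) \<longlonglongrightarrow> D x"
    proof (rule AE_I2)
      fix x
      have "((\<lambda>h. f (x + h *\<^sub>R v)) has_derivative (\<lambda>s. s *\<^sub>R D x)) (at 0)"
        using has_vector_derivative_line[where x = x and s = 0 and v = v, OF f'] by (simp add: D_def has_vector_derivative_def)
      then have "((\<lambda>h. norm (f (x + h *\<^sub>R v) - f x - h *\<^sub>R D x) / norm h) \<longlongrightarrow> 0) (at 0)"
        by (simp add: has_derivative_at)
      moreover have "norm (f (x + h *\<^sub>R v) - f x - h *\<^sub>R D x) / norm h = norm ((f (x + h *\<^sub>R v) - f x) /\<^sub>R h - D x)"
        if "h \<noteq> 0" for h
      proof -
        have "(f (x + h *\<^sub>R v) - f x) /\<^sub>R h - D x = (f (x + h *\<^sub>R v) - f x - h *\<^sub>R D x) /\<^sub>R h"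
          using that by (simp add: scaleR_right_diff_distrib)
        then show ?thesis by (simp add: divide_inverse mult.commute)
      qed
      ultimately have "((\<lambda>h. norm ((f (x + h *\<^sub>R v) - f x) /\<^sub>R h - D x)) \<longlongrightarrow> 0) (at 0)"
        by (elim Lim_transform_eventually) (simp add: eventually_at_filter)
      then have "((\<lambda>h. (f (x + h *\<^sub>R v) - f x) /\<^sub>R h) \<longlongrightarrow> D x) (at 0)"
        by (rule LIM_zero_cancel[OF tendsto_norm_zero_cancel])
      moreover have "filterlim (\<lambda>n. 1 / real (Suc n)) (at 0) sequentially"
        using LIMSEQ_Suc[OF lim_1_over_n, where 'a1 = real] by (intro filterlim_atI) auto
      ultimately show "(\<lambda>n. q n x) \<longlonglongrightarrow> D x"
        using filterlim_compose by (fastforce simp: q_def)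
    qed
    show "AE x in lborel. norm (q n x) \<le> indicator (cball 0 (R + norm v)) x *\<^sub>R M" for n
      using bound by simp
  qed
  then have "integral\<^sup>L lborel D = 0"
    by (simp add: q0 LIMSEQ_const_iff)
  then show "integral\<^sup>L lborel (\<lambda>x. frechet_derivative f (at x) v) = 0"
    by (simp add: D_def[abs_def])
qed

text \<open>\<open>S\<close> and the complement of \<open>K\<close> are open and cover the space; on
  the second set the function is zero.\<close>

lemma smooth_on_UNIV_zero_extension:
  assumes "open S" "closed K" "K \<subseteq> S" "smooth_on S f" "\<And>x. x \<notin> K \<Longrightarrow> f x = 0"
  shows "smooth_on UNIV f"
proof -
  have "smooth_on (- K) f"
    using smooth_on_cong[of "- K" "\<lambda>x. 0" f] smooth_on_const assms by auto
  then have "smooth_on (S \<union> - K) f"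
    using assms by (intro smooth_on_Un) auto
  moreover have "S \<union> - K = UNIV" using assms by auto
  ultimately show ?thesis by simp
qed

lemma test_functionsE:
  assumes "f \<in> test_functions \<Omega>"
  obtains K where "compact K" "K \<subseteq> \<Omega>" "\<And>x. x \<notin> K \<Longrightarrow> f x = 0" "smooth_on UNIV f"
proof (rule that)
  show "f x = 0" if "x \<notin> closure {z. f z \<noteq> 0}" for x
    using that closure_subset[of "{z. f z \<noteq> 0}"] by auto
qed (use assms in \<open>auto simp: test_functions_def\<close>)

lemma test_functionsI:
  assumes "open \<Omega>" "compact K" "K \<subseteq> \<Omega>" "\<And>x. x \<notin> K \<Longrightarrow> f x = 0" "smooth_on \<Omega> f"
  shows "f \<in> test_functions \<Omega>"
proof -
  have "closure {z. f z \<noteq> 0} \<subseteq> K"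
    using assms by (intro closure_minimal) (auto dest: compact_imp_closed)
  moreover from this have "compact (closure {z. f z \<noteq> 0})"
    using compact_Int_closed[OF assms(2) closed_closure[of "{z. f z \<noteq> 0}"]] by (simp add: Int_absorb1)
  moreover have "smooth_on UNIV f"
    using smooth_on_UNIV_zero_extension[OF assms(1) compact_imp_closed[OF assms(2)] assms(3,5,4)] .
  ultimately show ?thesis
    using assms(3) by (auto simp: test_functions_def)
qed

text \<open>The field is \<open>f\<close> times \<open>cramer_field g\<close>. Differentiating the
  second factor gives n f det H by the Piola identity; differentiating \<open>f\<close> gives the
  pairing of \<partial>g with \<partial>f by Cramer's rule.\<close>

lemma integration_by_parts:
  fixes g f :: "complex^'n::finite \<Rightarrow> real"
  assumes S: "open \<Omega>" and g: "smooth_on \<Omega> g" and f: "f \<in> test_functions \<Omega>"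
    and H: "\<And>z. z \<in> \<Omega> \<Longrightarrow> pos_def_matrix (complex_hessian g z)"
  defines "F \<equiv> \<lambda>z. Re (det (complex_hessian g z)) *
      (real CARD('n) * f z + Re (inv_form (complex_hessian g z) (grad_z g z) (grad_z f z)))"
  shows "integrable lborel F" and "integral\<^sup>L lborel F = 0"
proof -
  obtain K where K: "compact K" "K \<subseteq> \<Omega>" "\<And>x. x \<notin> K \<Longrightarrow> f x = 0" and fs: "smooth_on UNIV f"
    using f by (rule test_functionsE) blast
  define X where "X k z = complex_of_real (f z) * cramer_field g k z" for k z
  have "smooth_on \<Omega> (X k)" for k
    unfolding X_def using smooth_on_subset[OF fs] S smooth_on_cramer_field[OF S g]
    by (intro smooth_intros) auto
  then have X: "smooth_on UNIV (X k)" for k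
    by (rule smooth_on_UNIV_zero_extension[OF S compact_imp_closed[OF K(1)] K(2)]) (auto simp: X_def K)
  have X0: "X k z = 0" if "z \<notin> K" for k z
    using that K(3) by (simp add: X_def)
  have F: "F z = Re (\<Sum>k\<in>UNIV. d_zbar k (X k) z)" for z
  proof (cases "z \<in> K")
    case True
    then have z: "z \<in> \<Omega>" using K by auto
    have fd: "f differentiable (at z)"
      using smooth_on_has_derivative[OF fs] by (auto simp: differentiable_def)
    have "d_zbar k (X k) z = cnj (grad_z f z $ k) * cramer_field g k z + f z * d_zbar k (cramer_field g k) z" for k
    proof -
      let ?c' = "frechet_derivative (cramer_field g k) (at z)"
      let ?f' = "frechet_derivative f (at z)"
      have c': "(cramer_field g k has_derivative ?c') (at z)"
        by (rule smooth_on_has_derivative[OF smooth_on_cramer_field[OF S g] z])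
      have f': "((\<lambda>w. complex_of_real (f w)) has_derivative (\<lambda>v. of_real (?f' v))) (at z)"
        by (rule has_derivative_of_real_compose[OF smooth_on_has_derivative[OF fs]]) simp
      have "(X k has_derivative (\<lambda>v. of_real (f z) * ?c' v + of_real (?f' v) * cramer_field g k z)) (at z)"
        unfolding X_def by (rule has_derivative_mult[OF f' c'])
      then show ?thesis
        unfolding d_zbar_of_real[OF fd, symmetric]
        by (simp add: d_zbar_eq[OF f'] d_zbar_eq[OF c'] d_zbar_eq algebra_simps add_divide_distrib)
    qed
    then have "(\<Sum>k\<in>UNIV. d_zbar k (X k) z)
      = (\<Sum>k\<in>UNIV. cnj (grad_z f z $ k) * cramer_field g k z) + of_real (f z) * (of_nat CARD('n) * det (complex_hessian g z))"
      by (simp add: sum.distrib divergence_cramer_field[OF S z g] sum_distrib_left[symmetric])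
    also have "(\<Sum>k\<in>UNIV. cnj (grad_z f z $ k) * cramer_field g k z)
      = det (complex_hessian g z) * inv_form (complex_hessian g z) (grad_z g z) (grad_z f z)"
      unfolding inv_form_matrix_inv sum_distrib_left
      by (rule sum.cong) (simp_all add: cramer_field_def det_mult_matrix_inv[OF H[OF z], symmetric])
    finally have "(\<Sum>k\<in>UNIV. d_zbar k (X k) z) = det (complex_hessian g z) *
        (of_nat CARD('n) * of_real (f z) + inv_form (complex_hessian g z) (grad_z g z) (grad_z f z))"
      by (simp add: algebra_simps)
    then show ?thesis
      using hermitian_det_real[OF pos_def_matrix_hermitian[OF H[OF z]]]
      by (simp add: F_def)
  next
    \<comment> \<open>Off \<open>K\<close> the point may lie outside \<Omega>, where the Hessian of
      \<open>g\<close> is uncontrolled; both sides vanish because \<open>f\<close> and its gradient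
      do.\<close>
    case False
    have X': "(X k has_derivative (\<lambda>v. 0)) (at z)" and f': "(f has_derivative (\<lambda>v. 0)) (at z)" for k
      using derivative_zero_off_support[OF compact_imp_closed[OF K(1)] _ False] X0 K(3) by blast+
    then have "d_zbar k (X k) z = 0" "grad_z f z = 0" for k
      by (simp_all add: d_zbar_eq[OF X'] grad_z_eq[OF f'] vec_eq_iff)
    then show ?thesis
      using K(3)[OF False] by (simp add: F_def inv_form_def)
  qed
  have C: "Ck_on 1 UNIV (X k)" for k
    using X smooth_on_def by blast
  have "integrable lborel (d_zbar k (X k))" "integral\<^sup>L lborel (d_zbar k (X k)) = 0" for k
    using integral_derivative_compact_support[OF C K(1) X0]
    unfolding d_zbar_def[abs_def] by auto
  then have "integrable lborel (\<lambda>z. \<Sum>k\<in>UNIV. d_zbar k (X k) z)"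
     "integral\<^sup>L lborel (\<lambda>z. \<Sum>k\<in>UNIV. d_zbar k (X k) z) = 0"
    by (auto simp: Bochner_Integration.integral_sum)
  then show "integrable lborel F" "integral\<^sup>L lborel F = 0"
    unfolding F by (simp_all add: integrable_Re integral_Re del: Re_sum)
qed

section \<open>The Riemannian distance\<close>

text \<open>A finite \<open>c\<close> is moved to the left by subtraction; for infinite
  \<open>c\<close> the bound is trivial. An empty index set is covered, its infimum being
  \<infinity>.\<close>

lemma le_INF_add_ennreal:
  fixes x c :: ennreal
  assumes "\<And>a. a \<in> A \<Longrightarrow> x \<le> f a + c"
  shows "x \<le> (INF a\<in>A. f a) + c"
proof (cases "c = top")
  case False
  have "x - c \<le> (INF a\<in>A. f a)"
    using assms False by (intro INF_greatest) (simp add: ennreal_minus_le_iff add.commute)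
  then show ?thesis
    using False by (simp add: ennreal_minus_le_iff add.commute)
qed simp

locale hermitian_domain =
  fixes \<Omega> :: "(complex^'n::finite) set" and H :: "complex^'n \<Rightarrow> complex^'n^'n"
  assumes open_domain: "open \<Omega>" and connected_domain: "connected \<Omega>"
    and continuous_entries: "\<And>i j. continuous_on \<Omega> (\<lambda>z. H z $ i $ j)"
    and pos_def: "\<And>z. z \<in> \<Omega> \<Longrightarrow> pos_def_matrix (H z)"
begin

abbreviation "hnorm z \<equiv> hermitian_norm (H z)"

abbreviation "paths p q \<equiv> {\<gamma>. valid_path \<gamma> \<and> path_image \<gamma> \<subseteq> \<Omega> \<and> pathstart \<gamma> = p \<and> pathfinish \<gamma> = q}"

definition speed :: "(real \<Rightarrow> complex^'n) \<Rightarrow> real \<Rightarrow> real"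
  where "speed \<gamma> t = hnorm (\<gamma> t) (vector_derivative \<gamma> (at t))"

lemma path_length_speed: "path_length H \<gamma> = (\<integral>\<^sup>+ t. ennreal (speed \<gamma> t) * indicator {0..1} t \<partial>lborel)"
  by (simp add: path_length_def speed_def)

lemma hnorm_nonneg: "z \<in> \<Omega> \<Longrightarrow> 0 \<le> hnorm z v"
  using pos_def_matrix_nonneg[OF pos_def] by (simp add: hermitian_norm_hform)

lemma hnorm_scaleR: "hnorm z (c *\<^sub>R v) = \<bar>c\<bar> * hnorm z v"
proof -
  have "c *\<^sub>R v = of_real c *s v"
    by (simp add: vec_eq_iff scaleR_conv_of_real[where 'a = complex])
  then have "hform (H z) (c *\<^sub>R v) (c *\<^sub>R v) = of_real (c\<^sup>2) * hform (H z) v v"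
    by (simp add: hform_scale_left hform_scale_right power2_eq_square)
  then have "Re (hform (H z) (c *\<^sub>R v) (c *\<^sub>R v)) = c\<^sup>2 * Re (hform (H z) v v)"
    by (simp del: of_real_power)
  then show ?thesis
    by (simp add: hermitian_norm_hform real_sqrt_mult)
qed

lemma continuous_hform:
  assumes "continuous_on T \<gamma>" "\<gamma> ` T \<subseteq> \<Omega>" "continuous_on T v"
  shows "continuous_on T (\<lambda>t. Re (hform (H (\<gamma> t)) (v t) (v t)))"
proof -
  have "continuous_on T (\<lambda>t. H (\<gamma> t) $ i $ j)" for i j
    using continuous_on_compose2[OF continuous_entries assms(1,2)] .
  moreover have "continuous_on T (\<lambda>t. v t $ i)" for i
    using assms(3) by (intro continuous_intros)
  ultimately show ?thesis
    unfolding hform_def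
    by (intro continuous_on_Re continuous_on_sum continuous_on_mult continuous_on_cnj)
qed

lemma continuous_hnorm:
  assumes "continuous_on T \<gamma>" "\<gamma> ` T \<subseteq> \<Omega>" "continuous_on T v"
  shows "continuous_on T (\<lambda>t. hnorm (\<gamma> t) (v t))"
  unfolding hermitian_norm_hform by (rule continuous_on_real_sqrt[OF continuous_hform[OF assms]])

text \<open>Extreme values of the norm over \<open>K\<close> times the unit sphere, extended to all
  vectors by homogeneity.\<close>

lemma hnorm_bounds_on_compact:
  assumes K: "compact K" "K \<subseteq> \<Omega>"
  obtains m M where "0 < m" "0 < M" "\<And>z v. z \<in> K \<Longrightarrow> m * norm v \<le> hnorm z v"
    "\<And>z v. z \<in> K \<Longrightarrow> hnorm z v \<le> M * norm v"
proof (cases "K = {}")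
  case True
  then show ?thesis using that[of 1 1] by simp
next
  case False
  define C where "C = K \<times> sphere (0 :: complex^'n) 1"
  have "(axis undefined 1 :: complex^'n) \<in> sphere 0 1"
    by (simp add: norm_axis_1)
  with False have C: "compact C" "C \<noteq> {}"
    using K by (auto simp: C_def compact_Times)
  have cont: "continuous_on C (\<lambda>x. hnorm (fst x) (snd x))"
    using K by (intro continuous_hnorm continuous_intros) (auto simp: C_def)
  obtain x where x: "x \<in> C" "\<And>y. y \<in> C \<Longrightarrow> hnorm (fst x) (snd x) \<le> hnorm (fst y) (snd y)"
    using continuous_attains_inf[OF C cont] by auto
  obtain y where y: "y \<in> C" "\<And>x. x \<in> C \<Longrightarrow> hnorm (fst x) (snd x) \<le> hnorm (fst y) (snd y)"
    using continuous_attains_sup[OF C cont] by auto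
  define m where "m = hnorm (fst x) (snd x)"
  define M where "M = hnorm (fst y) (snd y)"
  have "fst x \<in> \<Omega>" "snd x \<noteq> 0"
    using x(1) K by (auto simp: C_def)
  then have m: "0 < m"
    using pos_def by (auto simp: m_def hermitian_norm_hform pos_def_matrix_hform)
  have M: "0 < M"
    using m x(2)[OF y(1)] by (simp add: m_def M_def)
  have *: "m * norm v \<le> hnorm z v \<and> hnorm z v \<le> M * norm v" if "z \<in> K" for z v
  proof (cases "v = 0")
    case True
    then show ?thesis by (simp add: hermitian_norm_hform hform_zero)
  next
    case False
    define w where "w = (1 / norm v) *\<^sub>R v"
    have "(z, w) \<in> C"
      using that False by (simp add: C_def w_def)
    from x(2)[OF this] y(2)[OF this] have "m \<le> hnorm z w" "hnorm z w \<le> M"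
      by (simp_all add: m_def M_def)
    moreover have "hnorm z v = norm v * hnorm z w"
      using False by (simp add: w_def hnorm_scaleR)
    ultimately show ?thesis
      by (simp add: mult.commute[of _ "norm v"] mult_left_mono)
  qed
  then show ?thesis using that m M by blast
qed

section \<open>Lengths of piecewise C1 paths\<close>

lemma valid_pathE:
  assumes "valid_path \<gamma>"
  obtains S where "finite S" "\<And>t. t \<in> {0..1} - S \<Longrightarrow> \<gamma> differentiable (at t)"
    "continuous_on ({0..1} - S) (\<lambda>t. vector_derivative \<gamma> (at t))" "continuous_on {0..1} \<gamma>"
proof -
  obtain S where "finite S" "\<gamma> C1_differentiable_on ({0..1} - S)" "continuous_on {0..1} \<gamma>"
    using assms by (auto simp: valid_path_def piecewise_C1_differentiable_on_def)
  then show ?thesis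
    by (intro that[of S]) (auto simp: C1_differentiable_on_eq)
qed

text \<open>The speed is continuous off a finite set; whatever \<open>vector_derivative\<close>
  returns at the exceptional parameters does not affect measurability.\<close>

lemma measurable_speed:
  assumes "valid_path \<gamma>" "path_image \<gamma> \<subseteq> \<Omega>"
  shows "(\<lambda>t. ennreal (speed \<gamma> t) * indicator {0..1} t) \<in> borel_measurable borel"
proof -
  obtain S where S: "finite S" "\<And>t. t \<in> {0..1} - S \<Longrightarrow> \<gamma> differentiable (at t)"
    "continuous_on ({0..1} - S) (\<lambda>t. vector_derivative \<gamma> (at t))" "continuous_on {0..1} \<gamma>"
    by (rule valid_pathE[OF assms(1)]) (rule that)
  have "continuous_on ({0..1} - S) (speed \<gamma>)"
    unfolding speed_def using S assms(2)
    by (intro continuous_hnorm) (auto simp: path_image_def intro: continuous_on_subset)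
  then have "(\<lambda>t. indicator ({0..1} - S) t *\<^sub>R speed \<gamma> t) \<in> borel_measurable borel"
    using S(1) by (intro borel_measurable_continuous_on_indicator sets.Diff) (auto intro: borel_closed finite_imp_closed)
  then have "(\<lambda>t. ennreal (indicator ({0..1} - S) t *\<^sub>R speed \<gamma> t)) \<in> borel_measurable borel"
    by measurable
  then show ?thesis
    by (rule measurable_discrete_difference[where X = S])
      (use S(1) in \<open>auto simp: indicator_def countable_finite\<close>)
qed

text \<open>Finite sets are null, so chain-rule computations may ignore breakpoints.\<close>

lemma path_length_cong:
  assumes "finite S" "\<And>t. t \<notin> S \<Longrightarrow> t \<in> {0..1} \<Longrightarrow> ennreal (speed \<gamma> t) = f t"
  shows "path_length H \<gamma> = (\<integral>\<^sup>+ t. f t * indicator {0..1} t \<partial>lborel)"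
  unfolding path_length_speed
proof (rule nn_integral_cong_AE)
  show "AE t in lborel. ennreal (speed \<gamma> t) * indicator {0..1} t = f t * indicator {0..1} t"
    using AE_not_in[OF finite_imp_null_set_lborel[OF assms(1)]]
    by eventually_elim (auto simp: assms(2) indicator_def)
qed

lemma path_length_reversepath:
  assumes "valid_path \<gamma>" "path_image \<gamma> \<subseteq> \<Omega>"
  shows "path_length H (reversepath \<gamma>) = path_length H \<gamma>"
proof -
  obtain S where S: "finite S" "\<And>t. t \<in> {0..1} - S \<Longrightarrow> \<gamma> differentiable (at t)"
    "continuous_on ({0..1} - S) (\<lambda>t. vector_derivative \<gamma> (at t))" "continuous_on {0..1} \<gamma>"
    by (rule valid_pathE[OF assms(1)]) (rule that)
  have "speed (reversepath \<gamma>) t = speed \<gamma> (1 - t)" if "t \<notin> (\<lambda>t. 1 - t) ` S" "t \<in> {0..1}" for t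
  proof -
    have "1 - t \<in> {0..1} - S"
      using that by (auto simp: image_iff)
    then have "(\<gamma> has_vector_derivative vector_derivative \<gamma> (at (1 - t))) (at (1 - t))"
      using S(2) vector_derivative_works by blast
    then have "(\<gamma> \<circ> (\<lambda>t. 1 - t) has_vector_derivative (- 1) *\<^sub>R vector_derivative \<gamma> (at (1 - t))) (at t)"
      by (intro vector_diff_chain_at) (auto intro!: derivative_eq_intros)
    then have "vector_derivative (reversepath \<gamma>) (at t) = (- 1) *\<^sub>R vector_derivative \<gamma> (at (1 - t))"
      by (simp add: reversepath_def o_def vector_derivative_at)
    then show ?thesis
      unfolding speed_def by (simp only: hnorm_scaleR) (simp add: reversepath_def)
  qed
  then have "path_length H (reversepath \<gamma>)
    = (\<integral>\<^sup>+ t. ennreal (speed \<gamma> (1 - t)) * indicator {0..1} t \<partial>lborel)"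
    using S(1) by (intro path_length_cong[of "(\<lambda>t. 1 - t) ` S"]) auto
  also have "\<dots> = path_length H \<gamma>"
    unfolding path_length_speed
    by (subst nn_integral_real_affine[OF measurable_speed[OF assms], of "-1" 1])
      (auto intro!: nn_integral_cong simp: indicator_def)
  finally show ?thesis .
qed

lemma path_length_joinpaths:
  assumes "valid_path \<gamma>" "path_image \<gamma> \<subseteq> \<Omega>" "valid_path \<delta>" "path_image \<delta> \<subseteq> \<Omega>"
  shows "path_length H (\<gamma> +++ \<delta>) = path_length H \<gamma> + path_length H \<delta>"
proof -
  obtain S where S: "finite S" "\<And>t. t \<in> {0..1} - S \<Longrightarrow> \<gamma> differentiable (at t)"
    "continuous_on ({0..1} - S) (\<lambda>t. vector_derivative \<gamma> (at t))" "continuous_on {0..1} \<gamma>"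
    by (rule valid_pathE[OF assms(1)]) (rule that)
  obtain T where T: "finite T" "\<And>t. t \<in> {0..1} - T \<Longrightarrow> \<delta> differentiable (at t)"
    "continuous_on ({0..1} - T) (\<lambda>t. vector_derivative \<delta> (at t))" "continuous_on {0..1} \<delta>"
    by (rule valid_pathE[OF assms(3)]) (rule that)
  \<comment> \<open>Breakpoints of both pieces in the new parameter, and the junction. Away from the
    junction at most one of \<open>f (2 t)\<close> and \<open>h (2 t - 1)\<close> is
    nonzero.\<close>
  define N where "N = {1/2} \<union> (\<lambda>t. t / 2) ` S \<union> (\<lambda>t. (t + 1) / 2) ` T"
  define f where "f t = ennreal (speed \<gamma> t) * indicator {0..1} t" for t
  define h where "h t = ennreal (speed \<delta> t) * indicator {0..1} t" for t
  have [measurable]: "f \<in> borel_measurable borel" "h \<in> borel_measurable borel"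
    unfolding f_def h_def using measurable_speed assms by auto
  have "ennreal (speed (\<gamma> +++ \<delta>) t) = 2 * f (2 * t) + 2 * h (2 * t - 1)" if t: "t \<notin> N" "t \<in> {0..1}" for t
  proof (cases "t < 1/2")
    case True
    have "2 * t \<notin> S"
      using t(1) imageI[of "2 * t" S "\<lambda>t. t / 2"] by (auto simp: N_def)
    then have "2 * t \<in> {0..1} - S"
      using t True by auto
    then have "(\<gamma> has_vector_derivative vector_derivative \<gamma> (at (2 * t))) (at (2 * t))"
      using S(2) vector_derivative_works by blast
    then have "(\<gamma> \<circ> (\<lambda>t. 2 * t) has_vector_derivative 2 *\<^sub>R vector_derivative \<gamma> (at (2 * t))) (at t)"
      by (intro vector_diff_chain_at) (auto intro!: derivative_eq_intros)
    then have "((\<gamma> +++ \<delta>) has_vector_derivative 2 *\<^sub>R vector_derivative \<gamma> (at (2 * t))) (at t)"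
      by (rule has_vector_derivative_transform_within_open[where S = "{..<1/2}"])
        (use True in \<open>auto simp: joinpaths_def\<close>)
    then have "speed (\<gamma> +++ \<delta>) t = 2 * speed \<gamma> (2 * t)"
      using True by (simp add: speed_def vector_derivative_at hnorm_scaleR joinpaths_def)
    then show ?thesis
      using True t(2) by (simp add: f_def h_def indicator_def ennreal_mult'' ennreal_mult')
  next
    case False
    then have t2: "t > 1/2"
      using t by (cases "t = 1/2") (auto simp: N_def)
    have "2 * t - 1 \<notin> T"
      using t(1) imageI[of "2 * t - 1" T "\<lambda>t. (t + 1) / 2"] by (auto simp: N_def)
    then have "2 * t - 1 \<in> {0..1} - T"
      using t t2 by auto
    then have "(\<delta> has_vector_derivative vector_derivative \<delta> (at (2 * t - 1))) (at (2 * t - 1))"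
      using T(2) vector_derivative_works by blast
    then have "(\<delta> \<circ> (\<lambda>t. 2 * t - 1) has_vector_derivative 2 *\<^sub>R vector_derivative \<delta> (at (2 * t - 1))) (at t)"
      by (intro vector_diff_chain_at) (auto intro!: derivative_eq_intros)
    then have "((\<gamma> +++ \<delta>) has_vector_derivative 2 *\<^sub>R vector_derivative \<delta> (at (2 * t - 1))) (at t)"
      by (rule has_vector_derivative_transform_within_open[where S = "{1/2<..}"])
        (use t2 in \<open>auto simp: joinpaths_def\<close>)
    then have "speed (\<gamma> +++ \<delta>) t = 2 * speed \<delta> (2 * t - 1)"
      using t2 by (simp add: speed_def vector_derivative_at hnorm_scaleR joinpaths_def)
    then show ?thesis
      using t2 t(2) by (simp add: f_def h_def indicator_def ennreal_mult'' ennreal_mult')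
  qed
  then have "path_length H (\<gamma> +++ \<delta>)
    = (\<integral>\<^sup>+ t. (2 * f (2 * t) + 2 * h (2 * t - 1)) * indicator {0..1} t \<partial>lborel)"
    using S(1) T(1) by (intro path_length_cong[of N]) (auto simp: N_def)
  also have "\<dots> = (\<integral>\<^sup>+ t. 2 * f (2 * t) + 2 * h (2 * t - 1) \<partial>lborel)"
    by (rule nn_integral_cong) (auto simp: f_def h_def indicator_def)
  also have "\<dots> = 2 * (\<integral>\<^sup>+ t. f (2 * t) \<partial>lborel) + 2 * (\<integral>\<^sup>+ t. h (2 * t - 1) \<partial>lborel)"
    by (simp add: nn_integral_add nn_integral_cmult)
  also have "2 * (\<integral>\<^sup>+ t. f (2 * t) \<partial>lborel) = (\<integral>\<^sup>+ t. f t \<partial>lborel)"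
    by (subst nn_integral_real_affine[of f 2 0]) auto
  also have "2 * (\<integral>\<^sup>+ t. h (2 * t - 1) \<partial>lborel) = (\<integral>\<^sup>+ t. h t \<partial>lborel)"
    by (subst nn_integral_real_affine[of h 2 "-1"]) (auto simp: algebra_simps)
  finally show ?thesis
    by (simp add: path_length_speed f_def h_def)
qed

lemma path_length_bounded:
  assumes \<gamma>: "\<gamma> C1_differentiable_on {0..1}" "path_image \<gamma> \<subseteq> \<Omega>"
    and b: "\<And>t. t \<in> {0..1} \<Longrightarrow> speed \<gamma> t \<le> b"
  shows "path_length H \<gamma> \<le> ennreal b"
proof -
  have "path_length H \<gamma> \<le> (\<integral>\<^sup>+ t. ennreal b * indicator {0..1::real} t \<partial>lborel)"
    unfolding path_length_speed
    by (intro nn_integral_mono) (simp add: indicator_def ennreal_leI b)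
  then show ?thesis by (simp add: nn_integral_cmult)
qed

section \<open>The distance and functions Lipschitz for it\<close>

definition edist :: "complex^'n \<Rightarrow> complex^'n \<Rightarrow> ennreal"
  where "edist p q = (INF \<gamma>\<in>paths p q. path_length H \<gamma>)"

abbreviation "rdist \<equiv> riemannian_dist \<Omega> H"

lemma rdist_edist: "rdist p q = enn2real (edist p q)"
  by (simp add: riemannian_dist_def edist_def)

text \<open>In a connected open set any two points are joined by a polynomial path, whose speed is
  bounded.\<close>

lemma edist_finite:
  assumes "p \<in> \<Omega>" "q \<in> \<Omega>"
  shows "edist p q < \<infinity>"
proof -
  obtain \<gamma> where \<gamma>: "polynomial_function \<gamma>" "path_image \<gamma> \<subseteq> \<Omega>" "pathstart \<gamma> = p" "pathfinish \<gamma> = q"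
    using connected_open_polynomial_connected[OF open_domain connected_domain assms] by blast
  have C1: "\<gamma> C1_differentiable_on {0..1}"
    using \<gamma>(1) by (rule C1_differentiable_polynomial_function)
  then have "continuous_on {0..1} (\<lambda>t. vector_derivative \<gamma> (at t))" "continuous_on {0..1} \<gamma>"
    using C1_differentiable_imp_continuous_on by (auto simp: C1_differentiable_on_eq)
  then have "continuous_on {0..1} (speed \<gamma>)"
    unfolding speed_def using \<gamma>(2) by (intro continuous_hnorm) (auto simp: path_image_def)
  then obtain x where "\<And>t. t \<in> {0..1} \<Longrightarrow> speed \<gamma> t \<le> speed \<gamma> x"
    using continuous_attains_sup[of "{0..1::real}" "speed \<gamma>"] by fastforce
  then have "path_length H \<gamma> < \<infinity>"
    using path_length_bounded[OF C1 \<gamma>(2)] by (metis ennreal_less_top infinity_ennreal_def order_le_less_trans)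
  moreover have "edist p q \<le> path_length H \<gamma>"
    unfolding edist_def using \<gamma> by (intro INF_lower) (auto intro: valid_path_polynomial_function)
  ultimately show ?thesis by (rule order_le_less_trans[rotated])
qed

text \<open>\<open>enn2real\<close> sends \<infinity> to 0, so inequalities are proved for
  \<open>edist\<close> and transferred to \<open>rdist\<close> by finiteness.\<close>

lemma ennreal_rdist: "p \<in> \<Omega> \<Longrightarrow> q \<in> \<Omega> \<Longrightarrow> ennreal (rdist p q) = edist p q"
  using edist_finite by (simp add: rdist_edist)

text \<open>The fundamental theorem of calculus along the path, with the derivative of
  \<open>u\<close> compared to the speed. A path of infinite length satisfies the bound
  trivially.\<close>

lemma lipschitz_path:
  fixes u :: "complex^'n \<Rightarrow> real"
  assumes u: "\<And>z. z \<in> \<Omega> \<Longrightarrow> (u has_derivative u' z) (at z)"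
    and C: "\<And>z v. z \<in> \<Omega> \<Longrightarrow> \<bar>u' z v\<bar> \<le> C * hnorm z v" "C > 0"
    and \<gamma>: "\<gamma> \<in> paths p q"
  shows "ennreal \<bar>u q - u p\<bar> \<le> ennreal C * path_length H \<gamma>"
proof (cases "path_length H \<gamma> = \<infinity>")
  case True
  then show ?thesis using C(2) by (simp add: ennreal_mult_top)
next
  case False
  have "valid_path \<gamma>" using \<gamma> by simp
  then obtain S where S: "finite S" "\<And>t. t \<in> {0..1} - S \<Longrightarrow> \<gamma> differentiable (at t)"
    "continuous_on ({0..1} - S) (\<lambda>t. vector_derivative \<gamma> (at t))" "continuous_on {0..1} \<gamma>"
    by (rule valid_pathE) (rule that)
  have im: "\<gamma> t \<in> \<Omega>" if "t \<in> {0..1}" for t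
    using \<gamma> that by (auto simp: path_image_def)
  define r where "r t = indicator {0..1} t * speed \<gamma> t" for t
  have r0: "0 \<le> r t" for t
    using hnorm_nonneg[OF im] by (simp add: r_def speed_def indicator_def)
  have er: "ennreal (r t) = ennreal (speed \<gamma> t) * indicator {0..1} t" for t
    by (simp add: r_def indicator_def)
  have nn: "(\<integral>\<^sup>+ t. ennreal (r t) \<partial>lborel) = path_length H \<gamma>"
    by (simp add: er path_length_speed)
  have rm: "r \<in> borel_measurable lborel"
  proof -
    have "(\<lambda>t. enn2real (ennreal (r t))) \<in> borel_measurable borel"
      unfolding er using measurable_speed[of \<gamma>] \<gamma> by (intro borel_measurable_enn2real) auto
    then show ?thesis using r0 by simp
  qed
  have ri: "integrable lborel r"
    using r0 rm nn False by (intro integrableI_nonneg) (auto simp: top.not_eq_extremum)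
  have I: "ennreal (integral\<^sup>L lborel r) = path_length H \<gamma>"
    using nn_integral_eq_integral[OF ri] r0 nn by simp
  \<comment> \<open>Passage to the gauge integral, which recovers the increment of \<open>u\<close>
    from its derivative even when that derivative is unbounded near exceptional parameters.\<close>
  have "(r has_integral integral\<^sup>L lborel r) UNIV"
    by (rule has_integral_integral_lborel[OF ri])
  moreover have "r = (\<lambda>t. if t \<in> {0..1} then speed \<gamma> t else 0)"
    by (auto simp: r_def indicator_def)
  ultimately have Hr: "(speed \<gamma> has_integral integral\<^sup>L lborel r) {0..1}"
    using has_integral_restrict_UNIV[of "{0..1}" "speed \<gamma>"] by auto
  \<comment> \<open>The value 0 at exceptional parameters makes the comparison with the speed valid
    at every parameter.\<close>
  define w where "w t = (if t \<in> S then 0 else u' (\<gamma> t) (vector_derivative \<gamma> (at t)))" for t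
  have w: "(w has_integral (u (\<gamma> 1) - u (\<gamma> 0))) {0..1}"
  proof (rule fundamental_theorem_of_calculus_strong[OF S(1)])
    show "((\<lambda>t. u (\<gamma> t)) has_vector_derivative w t) (at t)" if t: "t \<in> {0..1} - S" for t
    proof -
      have "(\<gamma> has_derivative (\<lambda>x. x *\<^sub>R vector_derivative \<gamma> (at t))) (at t)"
        using S(2)[OF t] by (simp add: vector_derivative_works has_vector_derivative_def)
      moreover have u1: "(u has_derivative u' (\<gamma> t)) (at (\<gamma> t))"
        using t im u by auto
      ultimately have "((\<lambda>t. u (\<gamma> t)) has_derivative (\<lambda>x. u' (\<gamma> t) (x *\<^sub>R vector_derivative \<gamma> (at t)))) (at t)"
        by (rule has_derivative_compose)
      then show ?thesis
        using t has_derivative_linear[OF u1] by (simp add: has_vector_derivative_def w_def linear_scale)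
    qed
    have "continuous_on \<Omega> u"
      using u by (meson continuous_at_imp_continuous_on has_derivative_continuous)
    then show "continuous_on {0..1} (\<lambda>t. u (\<gamma> t))"
      using im by (intro continuous_on_compose2[OF _ S(4)]) auto
  qed simp
  have wr: "\<bar>w t\<bar> \<le> C * speed \<gamma> t" if "t \<in> {0..1}" for t
    using C im[OF that] hnorm_nonneg[OF im[OF that]] by (simp add: w_def speed_def)
  have HC: "((\<lambda>t. C * speed \<gamma> t) has_integral C * integral\<^sup>L lborel r) {0..1}"
    using has_integral_mult_right[OF Hr] by simp
  have "u (\<gamma> 1) - u (\<gamma> 0) \<le> C * integral\<^sup>L lborel r"
    by (rule has_integral_le[OF w HC]) (use wr in fastforce)
  moreover have "- (u (\<gamma> 1) - u (\<gamma> 0)) \<le> C * integral\<^sup>L lborel r"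
    by (rule has_integral_le[OF has_integral_neg[OF w] HC]) (use wr in fastforce)
  moreover have "\<gamma> 1 = q" "\<gamma> 0 = p"
    using \<gamma> by (auto simp: pathstart_def pathfinish_def)
  ultimately have "\<bar>u q - u p\<bar> \<le> C * integral\<^sup>L lborel r" by auto
  then have "ennreal \<bar>u q - u p\<bar> \<le> ennreal (C * integral\<^sup>L lborel r)"
    by (rule ennreal_leI)
  also have "\<dots> = ennreal C * path_length H \<gamma>"
    using C(2) by (simp add: ennreal_mult' I)
  finally show ?thesis .
qed

lemma lipschitz_rdist:
  fixes u :: "complex^'n \<Rightarrow> real"
  assumes u: "\<And>z. z \<in> \<Omega> \<Longrightarrow> (u has_derivative u' z) (at z)"
    and C: "\<And>z v. z \<in> \<Omega> \<Longrightarrow> \<bar>u' z v\<bar> \<le> C * hnorm z v" "C > 0"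
    and pq: "p \<in> \<Omega>" "q \<in> \<Omega>"
  shows "\<bar>u q - u p\<bar> \<le> C * rdist p q"
proof -
  have "ennreal (\<bar>u q - u p\<bar> / C) \<le> edist p q"
    unfolding edist_def
  proof (rule INF_greatest)
    fix \<gamma> assume "\<gamma> \<in> paths p q"
    then have le: "ennreal \<bar>u q - u p\<bar> \<le> ennreal C * path_length H \<gamma>"
      by (intro lipschitz_path[where u' = u'] u C)
    have "ennreal (\<bar>u q - u p\<bar> / C) = ennreal (1 / C) * ennreal \<bar>u q - u p\<bar>"
      using C(2) by (simp add: ennreal_mult'[symmetric])
    also have "\<dots> \<le> ennreal (1 / C) * (ennreal C * path_length H \<gamma>)"
      using le by (rule mult_left_mono) simp
    also have "\<dots> = path_length H \<gamma>"
      using C(2) by (simp add: mult.assoc[symmetric] ennreal_mult'[symmetric])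
    finally show "ennreal (\<bar>u q - u p\<bar> / C) \<le> path_length H \<gamma>" .
  qed
  then have "ennreal (\<bar>u q - u p\<bar> / C) \<le> ennreal (rdist p q)"
    by (simp add: ennreal_rdist[OF pq])
  then have "\<bar>u q - u p\<bar> / C \<le> rdist p q"
    by (subst (asm) ennreal_le_iff) (auto simp: rdist_edist)
  then show ?thesis
    using C(2) by (simp add: divide_le_eq mult.commute)
qed

lemma edist_commute: "edist p q = edist q p"
proof -
  have "edist p q \<le> edist q p" for p q
    unfolding edist_def
  proof (rule INF_greatest)
    fix \<gamma> assume \<gamma>: "\<gamma> \<in> paths q p"
    then have "(INF \<gamma>\<in>paths p q. path_length H \<gamma>) \<le> path_length H (reversepath \<gamma>)"
      by (intro INF_lower) auto
    then show "(INF \<gamma>\<in>paths p q. path_length H \<gamma>) \<le> path_length H \<gamma>"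
      using \<gamma> by (simp add: path_length_reversepath)
  qed
  then show ?thesis by (meson order_antisym)
qed

lemma edist_triangle: "edist p s \<le> edist p q + edist q s"
proof -
  have *: "edist p s \<le> path_length H \<gamma> + path_length H \<delta>" if "\<gamma> \<in> paths p q" "\<delta> \<in> paths q s" for \<gamma> \<delta>
  proof -
    have "edist p s \<le> path_length H (\<gamma> +++ \<delta>)"
      unfolding edist_def using that path_image_join_subset[of \<gamma> \<delta>]
      by (intro INF_lower) (auto intro!: valid_path_join)
    then show ?thesis
      using that by (simp add: path_length_joinpaths)
  qed
  then have "edist p s \<le> path_length H \<gamma> + edist q s" if "\<gamma> \<in> paths p q" for \<gamma>
  proof -
    have "edist p s \<le> edist q s + path_length H \<gamma>"
      unfolding edist_def[of q s]
    proof (rule le_INF_add_ennreal)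
      fix \<delta> assume "\<delta> \<in> paths q s"
      from *[OF that this] show "edist p s \<le> path_length H \<delta> + path_length H \<gamma>"
        by (simp only: add.commute)
    qed
    then show ?thesis by (simp add: add.commute)
  qed
  then show ?thesis
    unfolding edist_def[of p q] by (rule le_INF_add_ennreal)
qed

text \<open>The straight segment stays in the ball and has speed at most
  \<open>M * dist p q\<close>.\<close>

lemma rdist_le_norm_on_cball:
  assumes "cball p R \<subseteq> \<Omega>" "\<And>z v. z \<in> cball p R \<Longrightarrow> hnorm z v \<le> M * norm v" "q \<in> cball p R" "0 \<le> M"
  shows "rdist p q \<le> M * dist p q"
proof -
  have p: "p \<in> cball p R" using assms(3) by (metis centre_in_cball dist_le_zero_iff mem_cball order_trans zero_le_dist)
  have im: "path_image (linepath p q) \<subseteq> cball p R"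
    using p assms(3) by (simp add: closed_segment_subset)
  have C1: "linepath p q C1_differentiable_on {0..1}"
    unfolding C1_differentiable_on_def
    by (auto intro!: exI[of _ "\<lambda>_. q - p"] has_vector_derivative_linepath_within)
  have "path_length H (linepath p q) \<le> ennreal (M * dist p q)"
  proof (rule path_length_bounded[OF C1])
    fix t :: real assume "t \<in> {0..1}"
    then have "linepath p q t \<in> cball p R"
      using im unfolding path_image_def by blast
    then show "speed (linepath p q) t \<le> M * dist p q"
      using assms(2)[of "linepath p q t" "q - p"]
      by (simp add: speed_def vector_derivative_linepath_at dist_norm norm_minus_commute)
  qed (use im assms(1) in auto)
  moreover have "edist p q \<le> path_length H (linepath p q)"
    unfolding edist_def using im assms(1) by (intro INF_lower) auto
  ultimately have "edist p q \<le> ennreal (M * dist p q)" by simp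
  then show ?thesis
    using assms(4) by (simp add: rdist_edist enn2real_leI)
qed

text \<open>Separation of points: the \<open>C\<^sup>1\<close> bump \<open>(max 0 (R\<^sup>2 - |z - p|\<^sup>2))\<^sup>2\<close> is Lipschitz for the
  Riemannian distance.\<close>

lemma rdist_pos:
  assumes pq: "p \<in> \<Omega>" "q \<in> \<Omega>" "p \<noteq> q"
  shows "0 < rdist p q"
proof -
  obtain R0 where R0: "R0 > 0" "cball p R0 \<subseteq> \<Omega>"
    using open_domain pq(1) open_contains_cball_eq by blast
  define R where "R = min R0 (dist p q)"
  have R: "R > 0" "cball p R \<subseteq> \<Omega>" "R \<le> dist p q"
    using R0 pq(3) by (auto simp: R_def)
  obtain m where m: "0 < m" "\<And>z v. z \<in> cball p R \<Longrightarrow> m * norm v \<le> hnorm z v"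
    using hnorm_bounds_on_compact[OF compact_cball R(2)] by metis
  define s where "s z = R\<^sup>2 - (z - p) \<bullet> (z - p)" for z
  define \<phi> where "\<phi> t = (max 0 t)\<^sup>2" for t :: real
  have \<phi>': "(\<phi> has_real_derivative 2 * max 0 t) (at t)" for t
  proof (cases t "0 :: real" rule: linorder_cases)
    case less
    have "((\<lambda>t. 0) has_real_derivative 2 * max 0 t) (at t)" using less by simp
    then show ?thesis
      by (rule has_field_derivative_transform_within_open[where S = "{..<0}"]) (use less in \<open>auto simp: \<phi>_def\<close>)
  next
    case greater
    have "((\<lambda>t. t\<^sup>2) has_real_derivative 2 * max 0 t) (at t)"
      using greater by (auto intro!: derivative_eq_intros)
    then show ?thesis
      by (rule has_field_derivative_transform_within_open[where S = "{0<..}"]) (use greater in \<open>auto simp: \<phi>_def\<close>)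
  next
    case equal
    have "((\<lambda>h. (\<phi> (0 + h) - \<phi> 0) / h) \<longlongrightarrow> 0) (at 0)"
    proof (rule tendsto_rabs_zero_cancel, rule tendsto_sandwich[where f = "\<lambda>_. 0" and h = "\<lambda>h. \<bar>h\<bar>"])
      show "\<forall>\<^sub>F h in at 0. \<bar>(\<phi> (0 + h) - \<phi> 0) / h\<bar> \<le> \<bar>h\<bar>"
        by (rule always_eventually) (auto simp: \<phi>_def max_def power2_eq_square)
    qed (auto intro!: tendsto_eq_intros)
    then show ?thesis using equal by (simp add: DERIV_def)
  qed
  define u where "u z = \<phi> (s z)" for z
  define u' where "u' z v = 2 * max 0 (s z) * (- 2 * ((z - p) \<bullet> v))" for z v
  have u: "(u has_derivative u' z) (at z)" for z
  proof -
    have "(s has_derivative (\<lambda>v. - 2 * ((z - p) \<bullet> v))) (at z)"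
      unfolding s_def by (auto intro!: derivative_eq_intros simp: inner_commute)
    from has_derivative_compose[OF this \<phi>'[of "s z", unfolded has_field_derivative_def]]
    show ?thesis by (simp add: u_def[abs_def] u'_def[abs_def])
  qed
  \<comment> \<open>The derivative of the bump is at most 4 s(z) |z - p| |v|, hence at most 4 R^2 R
    |v|; dividing by \<open>m\<close> replaces |v| by the metric norm.\<close>
  define C where "C = 4 * R^3 / m"
  have C: "C > 0" using R m by (simp add: C_def)
  have bound: "\<bar>u' z v\<bar> \<le> C * hnorm z v" if "z \<in> \<Omega>" for z v
  proof (cases "s z > 0")
    case True
    have "(norm (z - p))\<^sup>2 \<le> R\<^sup>2"
      using True by (simp add: s_def dot_square_norm)
    then have nz: "norm (z - p) \<le> R"
      using R(1) by (rule power2_le_imp_le[OF _ less_imp_le])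
    then have z: "z \<in> cball p R"
      by (simp add: dist_norm norm_minus_commute)
    have sR: "s z \<le> R\<^sup>2" by (simp add: s_def)
    have "\<bar>u' z v\<bar> = 4 * s z * \<bar>(z - p) \<bullet> v\<bar>"
      using True by (simp add: u'_def abs_mult)
    also have "\<dots> \<le> 4 * R\<^sup>2 * (R * norm v)"
    proof (rule mult_mono)
      show "\<bar>(z - p) \<bullet> v\<bar> \<le> R * norm v"
        using Cauchy_Schwarz_ineq2[of "z - p" v] nz by (meson mult_right_mono norm_ge_zero order_trans)
    qed (use sR True R in auto)
    also have "\<dots> = C * (m * norm v)"
      using m(1) by (simp add: C_def power2_eq_square power3_eq_cube)
    also have "\<dots> \<le> C * hnorm z v"
      using m(2)[OF z] C by (intro mult_left_mono) auto
    finally show ?thesis .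
  next
    case False
    then show ?thesis
      using C hnorm_nonneg[OF that] by (simp add: u'_def)
  qed
  have "\<bar>u q - u p\<bar> \<le> C * rdist p q"
    by (rule lipschitz_rdist[OF u bound C pq(1,2)])
  moreover have "u q = 0"
  proof -
    have "R * R \<le> norm (q - p) * norm (q - p)"
      using R by (intro mult_mono) (auto simp: dist_norm norm_minus_commute)
    then show ?thesis
      by (simp add: u_def \<phi>_def s_def power2_eq_square dot_square_norm)
  qed
  moreover have "u p > 0"
    using R(1) by (simp add: u_def \<phi>_def s_def)
  ultimately have "0 < C * rdist p q" by simp
  then show ?thesis using C by (simp add: zero_less_mult_iff)
qed

lemma Metric_space_rdist: "Metric_space \<Omega> rdist"
proof
  show "0 \<le> rdist x y" for x y by (simp add: rdist_edist)
  show "rdist x y = rdist y x" for x y by (simp add: rdist_edist edist_commute[of x y])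
  show "rdist x y = 0 \<longleftrightarrow> x = y" if xy: "x \<in> \<Omega>" "y \<in> \<Omega>" for x y
  proof
    assume "rdist x y = 0"
    then show "x = y" using rdist_pos[OF xy] by auto
  next
    assume [simp]: "x = y"
    obtain R where R: "R > 0" "cball x R \<subseteq> \<Omega>"
      using open_domain xy(1) open_contains_cball_eq by blast
    obtain M where "0 < M" "\<And>z v. z \<in> cball x R \<Longrightarrow> hnorm z v \<le> M * norm v"
      using hnorm_bounds_on_compact[OF compact_cball R(2)] by metis
    then have "rdist x x \<le> M * dist x x"
      using R by (intro rdist_le_norm_on_cball[OF R(2)]) auto
    then have "rdist x x \<le> 0" by simp
    moreover have "0 \<le> rdist x x" by (simp add: rdist_edist)
    ultimately show "rdist x y = 0" by simp
  qed
  show "rdist x z \<le> rdist x y + rdist y z" if "x \<in> \<Omega>" "y \<in> \<Omega>" "z \<in> \<Omega>" for x y z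
  proof -
    have "ennreal (rdist x z) \<le> ennreal (rdist x y) + ennreal (rdist y z)"
      using edist_triangle[of x z y] by (simp add: ennreal_rdist that)
    then have "ennreal (rdist x z) \<le> ennreal (rdist x y + rdist y z)"
      by (subst ennreal_plus) (auto simp: rdist_edist)
    then show ?thesis
      by (subst (asm) ennreal_le_iff) (auto simp: rdist_edist)
  qed
qed

text \<open>A Cauchy sequence stays in a sublevel set of the Lipschitz function, hence in a compact
  set, and has a subsequence convergent in the Euclidean sense. Near the limit the distance is
  bounded by a multiple of the Euclidean one, and a Cauchy sequence with a convergent subsequence
  converges.\<close>

lemma completeI:
  fixes u :: "complex^'n \<Rightarrow> real"
  assumes u: "\<And>z. z \<in> \<Omega> \<Longrightarrow> (u has_derivative u' z) (at z)"
    and C: "\<And>z v. z \<in> \<Omega> \<Longrightarrow> \<bar>u' z v\<bar> \<le> C * hnorm z v" "C > 0"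
    and proper: "\<And>b. \<exists>K. compact K \<and> K \<subseteq> \<Omega> \<and> {z \<in> \<Omega>. u z \<le> b} \<subseteq> K"
  shows "complete_hermitian_metric \<Omega> H"
proof -
  interpret M: Metric_space \<Omega> rdist by (rule Metric_space_rdist)
  have "\<exists>x. limitin M.mtopology \<sigma> x sequentially" if \<sigma>: "M.MCauchy \<sigma>" for \<sigma>
  proof -
    have range: "\<And>n. \<sigma> n \<in> \<Omega>" using \<sigma> by (auto simp: M.MCauchy_def)
    obtain N where N: "\<And>n n'. N \<le> n \<Longrightarrow> N \<le> n' \<Longrightarrow> rdist (\<sigma> n) (\<sigma> n') < 1"
      using \<sigma> unfolding M.MCauchy_def by (metis zero_less_one)
    have "u (\<sigma> (N + n)) \<le> u (\<sigma> N) + C" for n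
    proof -
      have "\<bar>u (\<sigma> (N + n)) - u (\<sigma> N)\<bar> \<le> C * rdist (\<sigma> N) (\<sigma> (N + n))"
        by (rule lipschitz_rdist[OF u C range range])
      also have "\<dots> \<le> C * 1"
        using N[of N "N + n"] C(2) by (intro mult_left_mono) auto
      finally show ?thesis by simp
    qed
    then have sub: "\<sigma> (N + n) \<in> {z \<in> \<Omega>. u z \<le> u (\<sigma> N) + C}" for n
      using range by simp
    obtain K where K: "compact K" "K \<subseteq> \<Omega>" "{z \<in> \<Omega>. u z \<le> u (\<sigma> N) + C} \<subseteq> K"
      using proper by metis
    have "\<forall>n. \<sigma> (N + n) \<in> K"
      using sub K(3) by (meson subsetD)
    then obtain x r where x: "x \<in> K" "strict_mono r" "((\<lambda>n. \<sigma> (N + n)) \<circ> r) \<longlonglongrightarrow> x"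
      using K(1) unfolding compact_def by (metis (no_types, lifting))
    define r' where "r' n = N + r n" for n
    have r': "strict_mono r'"
      using x(2) by (simp add: r'_def strict_mono_def)
    have lim: "(\<lambda>n. dist x (\<sigma> (r' n))) \<longlonglongrightarrow> 0"
      using tendsto_dist_iff[THEN iffD1, OF x(3)] by (simp add: r'_def o_def dist_commute)
    obtain R where R: "R > 0" "cball x R \<subseteq> \<Omega>"
      using open_domain x(1) K(2) open_contains_cball_eq by blast
    obtain M where M: "0 < M" "\<And>z v. z \<in> cball x R \<Longrightarrow> hnorm z v \<le> M * norm v"
      using hnorm_bounds_on_compact[OF compact_cball R(2)] by metis
    have "limitin M.mtopology (\<sigma> \<circ> r') x sequentially"
      unfolding M.limitin_metric
    proof (intro conjI allI impI)
      show "x \<in> \<Omega>" using x K by auto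
      fix e :: real assume e: "e > 0"
      have "\<forall>\<^sub>F n in sequentially. dist x (\<sigma> (r' n)) < min R (e / M)"
        using lim R e M by (intro order_tendstoD) auto
      then show "\<forall>\<^sub>F n in sequentially. (\<sigma> \<circ> r') n \<in> \<Omega> \<and> rdist ((\<sigma> \<circ> r') n) x < e"
      proof eventually_elim
        case (elim n)
        then have "\<sigma> (r' n) \<in> cball x R" by simp
        then have "rdist x (\<sigma> (r' n)) \<le> M * dist x (\<sigma> (r' n))"
          using M by (intro rdist_le_norm_on_cball[OF R(2)]) auto
        also have "\<dots> < e"
          using elim M(1) by (simp add: less_divide_eq mult.commute)
        finally show ?case
          using range by (simp add: M.commute)
      qed
    qed
    then show ?thesis
      using M.MCauchy_convergent_subsequence[OF \<sigma> r'] by blast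
  qed
  then show ?thesis
    unfolding complete_hermitian_metric_def M.mcomplete_def using Metric_space_rdist by blast
qed

end

section \<open>A smooth cutoff function\<close>

text \<open>\<open>exp_cutoff n\<close> is the \<open>n\<close>-th derivative of the smooth function \<open>exp (- 1 / x)\<close>, extended by
  zero to \<open>x \<le> 0\<close>.\<close>

primrec exp_cutoff_poly :: "nat \<Rightarrow> real poly" where
  "exp_cutoff_poly 0 = 1"
| "exp_cutoff_poly (Suc n) = [:0, 0, 1:] * (exp_cutoff_poly n - pderiv (exp_cutoff_poly n))"

definition exp_cutoff :: "nat \<Rightarrow> real \<Rightarrow> real"
  where "exp_cutoff n x = (if x > 0 then poly (exp_cutoff_poly n) (1 / x) * exp (- (1 / x)) else 0)"

lemma tendsto_poly_exp_neg: "((\<lambda>t. poly p t * exp (- t)) \<longlongrightarrow> (0::real)) at_top"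
proof -
  have "((\<lambda>t. \<Sum>i\<le>degree p. coeff p i * (t ^ i / exp t)) \<longlongrightarrow> (\<Sum>i\<le>degree p. coeff p i * 0)) at_top"
    by (intro tendsto_intros tendsto_power_div_exp_0)
  then show ?thesis
    by (simp add: poly_altdef sum_distrib_right exp_minus divide_inverse mult.assoc)
qed

text \<open>With t = 1/x, the derivative of p(t) exp (- t) in x is t^2 (p(t) - p'(t)) exp (- t),
  which explains the recursion of \<open>exp_cutoff_poly\<close>. At 0 the right difference quotient
  is t p(t) exp (- t), which tends to 0 as t grows.\<close>

lemma exp_cutoff_deriv: "(exp_cutoff n has_real_derivative exp_cutoff (Suc n) x) (at x)"
proof (cases x "0 :: real" rule: linorder_cases)
  case less
  have "((\<lambda>_. 0) has_real_derivative exp_cutoff (Suc n) x) (at x)"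
    using less by (simp add: exp_cutoff_def)
  then show ?thesis
    by (rule has_field_derivative_transform_within_open[where S = "{..<0}"])
      (use less in \<open>auto simp: exp_cutoff_def\<close>)
next
  case greater
  let ?p = "exp_cutoff_poly n"
  have "((\<lambda>x. poly ?p (1 / x) * exp (- (1 / x))) has_real_derivative exp_cutoff (Suc n) x) (at x)"
    using greater
    by (auto intro!: derivative_eq_intros DERIV_chain'[OF _ poly_DERIV] simp: exp_cutoff_def field_simps power2_eq_square)
  then show ?thesis
    by (rule has_field_derivative_transform_within_open[where S = "{0<..}"])
      (use greater in \<open>auto simp: exp_cutoff_def\<close>)
next
  case equal
  let ?q = "[:0, 1:] * exp_cutoff_poly n"
  have "((\<lambda>h. poly ?q (inverse h) * exp (- inverse h)) \<longlongrightarrow> 0) (at_right 0)"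
    by (rule filterlim_compose[OF tendsto_poly_exp_neg filterlim_inverse_at_top_right])
  then have "((\<lambda>h. (exp_cutoff n (0 + h) - exp_cutoff n 0) / h) \<longlongrightarrow> 0) (at_right 0)"
    by (rule Lim_transform_eventually)
      (auto simp: eventually_at_filter exp_cutoff_def divide_inverse)
  moreover have "((\<lambda>h. (exp_cutoff n (0 + h) - exp_cutoff n 0) / h) \<longlongrightarrow> 0) (at_left 0)"
    by (rule Lim_transform_eventually[OF tendsto_const])
      (auto simp: eventually_at_filter exp_cutoff_def)
  ultimately have "((\<lambda>h. (exp_cutoff n (0 + h) - exp_cutoff n 0) / h) \<longlongrightarrow> 0) (at 0)"
    by (simp add: filterlim_at_split)
  then show ?thesis
    using equal by (simp add: DERIV_def exp_cutoff_def)
qed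

lemma exp_cutoff_bounds: "0 \<le> exp_cutoff 0 x" "exp_cutoff 0 x \<le> 1"
  by (auto simp: exp_cutoff_def)

lemma exp_cutoff_pos: "x > 0 \<Longrightarrow> 0 < exp_cutoff 0 x"
  by (simp add: exp_cutoff_def)

lemma exp_cutoff_1: "x > 0 \<Longrightarrow> exp_cutoff 1 x = (1 / x)\<^sup>2 * exp (- (1 / x))"
  by (simp add: exp_cutoff_def power2_eq_square)

lemma exp_cutoff_weighted_deriv_eq:
  assumes "y > 1"
  shows "y * exp_cutoff 1 (y - 1) = (1 / (y - 1) + (1 / (y - 1))\<^sup>2) * exp (- (1 / (y - 1)))"
proof -
  define u where "u = 1 / (y - 1)"
  have "(y - 1) * u = 1" using assms by (simp add: u_def)
  then have "y * u\<^sup>2 = u + u\<^sup>2"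
    by (simp add: power2_eq_square algebra_simps)
  moreover have "exp_cutoff 1 (y - 1) = u\<^sup>2 * exp (- u)"
    using assms unfolding u_def by (intro exp_cutoff_1) simp
  ultimately show ?thesis
    unfolding u_def[symmetric] by (metis mult.assoc)
qed

text \<open>For y = k exp (- x) the expression is minus the derivative in x of the cutoff factor
  \<open>exp_cutoff 0 (y - 1)\<close>, so this bound is uniform in \<open>k\<close>. With u = 1/(y -
  1) it reduces to u + u^2 \<le> 3 exp u, a consequence of the quadratic Taylor bound.\<close>

lemma exp_cutoff_weighted_deriv:
  "0 \<le> y * exp_cutoff 1 (y - 1)" "y * exp_cutoff 1 (y - 1) \<le> 3"
proof -
  have "0 \<le> y * exp_cutoff 1 (y - 1) \<and> y * exp_cutoff 1 (y - 1) \<le> 3"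
  proof (cases "y > 1")
    case True
    define u where "u = 1 / (y - 1)"
    have u: "u > 0" using True by (simp add: u_def)
    have "u + u\<^sup>2 \<le> 3 * exp u"
      using exp_lower_Taylor_quadratic[of u] u zero_le_power2[of u] by linarith
    then have "(u + u\<^sup>2) * exp (- u) \<le> 3"
      by (simp add: exp_minus field_simps)
    then show ?thesis
      unfolding exp_cutoff_weighted_deriv_eq[OF True] u_def[symmetric] using u by simp
  qed (simp add: exp_cutoff_def)
  then show "0 \<le> y * exp_cutoff 1 (y - 1)" "y * exp_cutoff 1 (y - 1) \<le> 3" by auto
qed

lemma exp_cutoff_tendsto: "(exp_cutoff 0 \<longlongrightarrow> 1) at_top"
proof -
  have "((\<lambda>x::real. exp (- (1 / x))) \<longlongrightarrow> exp (- 0)) at_top"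
    by (intro tendsto_intros tendsto_divide_0[OF tendsto_const] filterlim_at_top_imp_at_infinity filterlim_ident)
  then have "((\<lambda>x::real. exp (- (1 / x))) \<longlongrightarrow> 1) at_top"
    by simp
  then show ?thesis
    by (rule Lim_transform_eventually)
      (auto simp: exp_cutoff_def intro: eventually_mono[OF eventually_gt_at_top[of 0]])
qed

lemma exp_cutoff_weighted_deriv_tendsto: "((\<lambda>y. y * exp_cutoff 1 (y - 1)) \<longlongrightarrow> 0) at_top"
proof -
  have "filterlim (\<lambda>y::real. - 1 + y) at_top at_top"
    by (rule filterlim_tendsto_add_at_top[OF tendsto_const filterlim_ident])
  from tendsto_inverse_0_at_top[OF this] have "((\<lambda>y::real. 1 / (y - 1)) \<longlongrightarrow> 0) at_top"
    by (simp add: divide_inverse)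
  then have "((\<lambda>y::real. 1 / (y - 1) + (1 / (y - 1))\<^sup>2) \<longlongrightarrow> 0 + 0\<^sup>2) at_top"
    by (intro tendsto_add tendsto_power)
  then have l: "((\<lambda>y::real. 1 / (y - 1) + (1 / (y - 1))\<^sup>2) \<longlongrightarrow> 0) at_top"
    by simp
  show ?thesis
  proof (rule tendsto_sandwich[OF _ _ tendsto_const l])
    show "\<forall>\<^sub>F y in at_top. 0 \<le> y * exp_cutoff 1 (y - 1)"
      by (rule always_eventually) (use exp_cutoff_weighted_deriv in blast)
    show "\<forall>\<^sub>F y in at_top. y * exp_cutoff 1 (y - 1) \<le> 1 / (y - 1) + (1 / (y - 1))\<^sup>2"
      by (rule eventually_mono[OF eventually_gt_at_top[of 1]])
        (unfold exp_cutoff_weighted_deriv_eq, simp add: mult_left_le)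
  qed
qed

section \<open>Potentials of exhaustion functions\<close>

lemma grad_z_cong:
  assumes "open S" "z \<in> S" "\<And>w. w \<in> S \<Longrightarrow> f w = h w" "h differentiable (at z)"
  shows "grad_z f z = grad_z h z"
proof -
  obtain h' where h': "(h has_derivative h') (at z)"
    using assms(4) by (auto simp: differentiable_def)
  have "(f has_derivative h') (at z)"
    by (rule has_derivative_transform_within_open[OF h' assms(1,2)]) (simp add: assms(3))
  then show ?thesis
    by (simp add: vec_eq_iff grad_z_eq[OF h'] grad_z_eq)
qed

text \<open>By Cramer's rule the form is a quotient of determinants with continuous entries.\<close>

lemma continuous_on_inv_form:
  assumes H: "\<And>z. z \<in> S \<Longrightarrow> pos_def_matrix (H z)" "\<And>i j. continuous_on S (\<lambda>z. H z $ i $ j)"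
    and b: "\<And>i. continuous_on S (\<lambda>z. b z $ i)" and c: "\<And>i. continuous_on S (\<lambda>z. c z $ i)"
  shows "continuous_on S (\<lambda>z. inv_form (H z) (b z) (c z))"
proof -
  have det: "continuous_on S (\<lambda>z. det (A z))"
    if "\<And>i j. continuous_on S (\<lambda>z. A z $ i $ j)" for A :: "_ \<Rightarrow> complex^'n^'n"
    unfolding det_def using that
    by (intro continuous_on_sum continuous_on_mult continuous_on_const continuous_on_prod)
  have "continuous_on S (\<lambda>z. \<Sum>k\<in>UNIV. cnj (c z $ k) *
    (det (\<chi> i j. if j = k then b z $ i else H z $ i $ j) / det (H z)))"
  proof (intro continuous_on_sum continuous_on_mult continuous_on_cnj continuous_on_divide c det)
    show "continuous_on S (\<lambda>z. (\<chi> i j. if j = k then b z $ i else H z $ i $ j) $ i $ j)" for i j k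
      using H(2) b by (cases "j = k") auto
    show "\<forall>z\<in>S. det (H z) \<noteq> 0"
      using pos_def_matrix_det_nonzero H(1) by blast
  qed (rule H(2))
  then show ?thesis
    by (rule continuous_on_eq)
      (simp add: inv_form_matrix_inv det_mult_matrix_inv[OF H(1), symmetric] pos_def_matrix_det_nonzero[OF H(1)])
qed

lemma det_scale:
  fixes P :: "complex^'n^'n::finite"
  shows "det (\<chi> i j. c * P $ i $ j) = c ^ CARD('n) * det P"
proof -
  have "(\<chi> i j. c * P $ i $ j) = (\<chi> i. c *s P $ i)"
    by (simp add: vec_eq_iff)
  then show ?thesis
    using det_rows_mul[of "\<lambda>_. c" "\<lambda>i. P $ i"] by simp
qed

text \<open>A nonempty open set contains a ball and is not null. It turns a vanishing integral into
  a contradiction at a point.\<close>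

lemma AE_lborel_open_witness:
  assumes "AE x in lborel. P x" "open U" "U \<noteq> ({} :: 'a::euclidean_space set)"
  shows "\<exists>x\<in>U. P x"
proof (rule ccontr)
  assume *: "\<not> ?thesis"
  have "AE x in lborel. x \<notin> U"
    using assms(1) by eventually_elim (use * in blast)
  then have "U \<in> null_sets lborel"
    using assms(2) by (simp add: AE_iff_null_sets)
  moreover obtain x e where "e > 0" "ball x e \<subseteq> U"
    using assms(2,3) openE by blast
  ultimately have "ball x e \<in> null_sets lborel"
    using null_sets_subset[of U lborel "ball x e"] by auto
  then show False
    using \<open>e > 0\<close> content_ball_pos[of e x] by (auto simp: null_sets_def measure_def)
qed

text \<open>The successive derivatives of - ln (- t), in the form that
  \<open>smooth_on_compose_real\<close> consumes.\<close>

lemma ln_derivatives: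
  assumes "t < 0"
  shows "((\<lambda>t. case n of 0 \<Rightarrow> - ln (- t) | Suc m \<Rightarrow> (-1) ^ Suc m * fact m / t ^ Suc m) has_real_derivative
    (-1) ^ Suc n * fact n / t ^ Suc n) (at t)"
proof (cases n)
  case 0
  then show ?thesis
    using assms by (auto intro!: derivative_eq_intros simp: field_simps)
next
  case (Suc m)
  have "((\<lambda>t. (-1) ^ Suc m * fact m * inverse (t ^ Suc m)) has_real_derivative
    (-1) ^ Suc m * fact m * (- (inverse (t ^ Suc m) * (of_nat (Suc m) * t ^ m) * inverse (t ^ Suc m)))) (at t)"
    using assms by (auto intro!: derivative_eq_intros simp del: power_Suc)
  also have "(-1) ^ Suc m * fact m * (- (inverse (t ^ Suc m) * (of_nat (Suc m) * t ^ m) * inverse (t ^ Suc m)))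
    = (-1) ^ Suc n * fact n / t ^ Suc n"
    using assms by (simp add: Suc field_simps)
  finally show ?thesis
    by (simp add: Suc divide_inverse)
qed

locale psh_exhaustion =
  fixes \<Omega> :: "(complex^'n::finite) set" and \<rho> g :: "complex^'n \<Rightarrow> real"
  assumes open_domain: "open \<Omega>" and connected_domain: "connected \<Omega>" and nonempty_domain: "\<Omega> \<noteq> {}"
    and strictly_psh: "smooth_strictly_psh_on \<Omega> \<rho>"
    and exhaustion: "exhaustion_function_on \<Omega> \<rho>"
    and g_eq: "\<And>z. z \<in> \<Omega> \<Longrightarrow> g z = - ln (- \<rho> z)"
begin

abbreviation "H \<equiv> complex_hessian g"
abbreviation "b \<equiv> grad_z g"

definition scaled_hessian :: "complex^'n \<Rightarrow> complex^'n^'n"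
  where "scaled_hessian z = (\<chi> i j. of_real (exp (g z)) * complex_hessian \<rho> z $ i $ j)"

definition grad_g_sq :: "complex^'n \<Rightarrow> real"
  where "grad_g_sq z = Re (inv_form (H z) (b z) (b z))"

text \<open>The indicator discards the points outside \<Omega>, where the values of \<open>g\<close>
  are arbitrary.\<close>

definition vol :: "complex^'n \<Rightarrow> real"
  where "vol z = indicator \<Omega> z * Re (det (H z))"

abbreviation "energy f \<equiv> integral\<^sup>L lborel (\<lambda>z. vol z * gradient_sq (H z) f z)"
abbreviation "mass f \<equiv> integral\<^sup>L lborel (\<lambda>z. vol z * (f z)\<^sup>2)"
abbreviation "rayleigh_quotients \<equiv> {4 * energy f / mass f | f. f \<in> test_functions \<Omega> \<and> f \<noteq> (\<lambda>z. 0)}"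
abbreviation "\<mu> \<equiv> wedge_power_measure \<Omega> (\<lambda>z. fundamental_form (H z))"
abbreviation "MA_moment \<epsilon> \<equiv>
  \<integral>\<^sup>+ z\<in>\<Omega>. ennreal ((- \<rho> z) powr \<epsilon>) \<partial>(wedge_power_measure \<Omega> (ddc \<rho>))"

section \<open>The potential, its gradient and its Hessian\<close>

lemma rho_neg: "z \<in> \<Omega> \<Longrightarrow> \<rho> z < 0" and rho_ge: "z \<in> \<Omega> \<Longrightarrow> - 1 \<le> \<rho> z"
  using exhaustion by (auto simp: exhaustion_function_on_def)

lemma sublevel_compact:
  "c < 0 \<Longrightarrow> compact (closure {z \<in> \<Omega>. \<rho> z < c}) \<and> closure {z \<in> \<Omega>. \<rho> z < c} \<subseteq> \<Omega>"
  using exhaustion unfolding exhaustion_function_on_def by blast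

lemma rho_eq: "z \<in> \<Omega> \<Longrightarrow> \<rho> z = - exp (- g z)"
  using rho_neg by (simp add: g_eq)

lemma smooth_rho: "smooth_on \<Omega> \<rho>"
  using strictly_psh by (simp add: smooth_strictly_psh_on_def)

lemma smooth_g: "smooth_on \<Omega> g"
proof -
  define \<phi> where "\<phi> n t = (case n of 0 \<Rightarrow> - ln (- t) | Suc m \<Rightarrow> (-1) ^ Suc m * fact m / t ^ Suc m)"
    for n and t :: real
  have "smooth_on \<Omega> (\<lambda>z. \<phi> 0 (\<rho> z))"
  proof (rule smooth_on_compose_real[OF open_domain _ _ smooth_rho, where T = "{..<0}" and \<phi> = \<phi>])
    show "(\<phi> n has_real_derivative \<phi> (Suc n) t) (at t)" if "t \<in> {..<0}" for n t
      using ln_derivatives[of t n] that unfolding \<phi>_def by simp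
  qed (use rho_neg in auto)
  then show ?thesis
    by (rule smooth_on_cong[OF open_domain, rotated]) (simp add: \<phi>_def g_eq)
qed

lemma differentiable_g: "z \<in> \<Omega> \<Longrightarrow> g differentiable (at z)"
  using smooth_on_has_derivative[OF smooth_g] by (auto simp: differentiable_def)

lemma differentiable_rho: "z \<in> \<Omega> \<Longrightarrow> \<rho> differentiable (at z)"
  using smooth_on_has_derivative[OF smooth_rho] by (auto simp: differentiable_def)

lemma b_eq: 
  assumes z: "z \<in> \<Omega>"
  shows "b z = of_real (exp (g z)) *s grad_z \<rho> z"
proof -
  have "b z = grad_z (\<lambda>w. - ln (- \<rho> w)) z"
  proof (rule grad_z_cong[OF open_domain z g_eq])
    show "(\<lambda>w. - ln (- \<rho> w)) differentiable (at z)"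
      using has_derivative_transform_within_open[OF smooth_on_has_derivative[OF smooth_g z] open_domain z, of "\<lambda>w. - ln (- \<rho> w)"]
      by (auto simp: differentiable_def g_eq)
  qed
  also have "\<dots> = of_real (- 1 / \<rho> z) *s grad_z \<rho> z"
    by (rule grad_z_compose_real[OF differentiable_rho[OF z]])
      (use rho_neg[OF z] in \<open>auto intro!: derivative_eq_intros\<close>)
  also have "- 1 / \<rho> z = exp (g z)"
    by (simp add: rho_eq[OF z] exp_minus field_simps)
  finally show ?thesis .
qed

text \<open>Near \<open>z\<close> the antiholomorphic gradient of \<open>g\<close> is exp g times
  that of \<rho>. Differentiating the product, exp g contributes exp g times \<partial>g, and the
  exponential is absorbed by turning the gradient of \<rho> back into that of
  \<open>g\<close>.\<close>

lemma hessian_eq: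
  assumes z: "z \<in> \<Omega>"
  shows "H z $ i $ j = scaled_hessian z $ i $ j + b z $ i * cnj (b z $ j)"
proof -
  define R where "R w = complex_of_real (\<rho> w)" for w
  define G where "G w = complex_of_real (g w)" for w
  define E where "E w = exp (g w)" for w
  have eG: "d_zbar j G w = of_real (E w) * d_zbar j R w" if w: "w \<in> \<Omega>" for w
    unfolding G_def R_def d_zbar_of_real[OF differentiable_g[OF w]]
      d_zbar_of_real[OF differentiable_rho[OF w]] b_eq[OF w]
    by (simp add: E_def)
  have dE: "E differentiable (at z)"
  proof -
    obtain g' where "(g has_derivative g') (at z)"
      using differentiable_g[OF z] by (auto simp: differentiable_def)
    then have "(E has_derivative (\<lambda>v. exp (g z) * g' v)) (at z)"
      unfolding E_def by (auto intro!: derivative_eq_intros)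
    then show ?thesis by (auto simp: differentiable_def)
  qed
  obtain E' where E': "(E has_derivative E') (at z)"
    using dE by (auto simp: differentiable_def)
  have "smooth_on \<Omega> (d_zbar j R)"
    unfolding R_def[abs_def] by (intro smooth_on_d_zbar smooth_on_of_real open_domain smooth_rho)
  then obtain D' where D': "(d_zbar j R has_derivative D') (at z)"
    using smooth_on_has_derivative z by blast
  have "(d_zbar j G has_derivative (\<lambda>v. of_real (E z) * D' v + of_real (E' v) * d_zbar j R z)) (at z)"
    by (rule has_derivative_transform_within_open
        [OF has_derivative_mult[OF has_derivative_of_real_compose[OF E'] D'] open_domain z])
      (simp add: eG)
  then have "d_z i (d_zbar j G) z = of_real (E z) * d_z i (d_zbar j R) z + grad_z E z $ i * d_zbar j R z"
    by (simp add: d_z_eq d_z_eq[OF D'] grad_z_eq[OF E'] algebra_simps add_divide_distrib diff_divide_distrib)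
  moreover have "grad_z E z = of_real (E z) *s b z"
    unfolding E_def by (rule grad_z_compose_real[OF differentiable_g[OF z]]) (auto intro!: derivative_eq_intros)
  moreover have "cnj (b z $ j) = of_real (E z) * d_zbar j R z"
    using eG[OF z] unfolding G_def[abs_def] d_zbar_of_real[OF differentiable_g[OF z]] .
  ultimately show ?thesis
    by (simp add: complex_hessian_def scaled_hessian_def G_def[abs_def] R_def[abs_def] E_def)
qed

lemma pos_def_scaled_hessian: "z \<in> \<Omega> \<Longrightarrow> pos_def_matrix (scaled_hessian z)"
proof -
  assume z: "z \<in> \<Omega>"
  have P: "pos_def_matrix (complex_hessian \<rho> z)"
    using strictly_psh z by (simp add: smooth_strictly_psh_on_def)
  have "hform (scaled_hessian z) v v = of_real (exp (g z)) * hform (complex_hessian \<rho> z) v v" for v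
    by (simp add: scaled_hessian_def hform_def sum_distrib_left ac_simps)
  then show ?thesis
    using P by (simp add: pos_def_matrix_hform)
qed

lemma hform_H: "z \<in> \<Omega> \<Longrightarrow> hform (H z) v v = hform (scaled_hessian z) v v + of_real ((norm (\<Sum>i\<in>UNIV. b z $ i * v $ i))\<^sup>2)"
  by (rule hform_rank_one_update) (rule hessian_eq)

lemma pos_def_H: "z \<in> \<Omega> \<Longrightarrow> pos_def_matrix (H z)"
  unfolding pos_def_matrix_hform[of "H z"]
  using pos_def_scaled_hessian[unfolded pos_def_matrix_hform] by (auto simp: hform_H simp del: of_real_power intro!: add_pos_nonneg)

lemma grad_g_sq_bounds: "z \<in> \<Omega> \<Longrightarrow> 0 \<le> grad_g_sq z" "z \<in> \<Omega> \<Longrightarrow> grad_g_sq z \<le> 1"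
  unfolding grad_g_sq_def
  by (simp_all add: inv_form_nonneg pos_def_H inv_form_rank_one_le_1[OF pos_def_H pos_def_scaled_hessian hessian_eq])

lemma det_H_pos: "z \<in> \<Omega> \<Longrightarrow> 0 < Re (det (H z))"
  by (intro pos_def_matrix_det_pos pos_def_H)

lemma vol_nonneg: "0 \<le> vol z"
  using less_imp_le[OF det_H_pos[of z]] by (simp add: vol_def indicator_def)

text \<open>The matrix \<open>H - b b\<^sup>*\<close> is the Hessian of \<open>\<rho>\<close> divided by \<open>- \<rho>\<close>.\<close>

lemma det_hessian_rho:
  assumes z: "z \<in> \<Omega>"
  shows "Re (det (complex_hessian \<rho> z)) * exp (real CARD('n) * g z) = Re (det (H z)) * (1 - grad_g_sq z)"
proof -
  have "scaled_hessian z = (\<chi> i j. H z $ i $ j - b z $ i * cnj (b z $ j))"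
    using hessian_eq[OF z] by (simp add: vec_eq_iff)
  then have "det (scaled_hessian z) = det (H z) * (1 - inv_form (H z) (b z) (b z))"
    by (simp only: det_rank_one_update[OF pos_def_H[OF z]])
  also have "\<dots> = det (H z) * of_real (1 - grad_g_sq z)"
    using inv_form_real[OF pos_def_H[OF z], of "b z"] by (simp add: grad_g_sq_def)
  finally have "Re (det (scaled_hessian z)) = Re (det (H z)) * (1 - grad_g_sq z)"
    by simp
  moreover have "det (scaled_hessian z) = of_real (exp (g z)) ^ CARD('n) * det (complex_hessian \<rho> z)"
    unfolding scaled_hessian_def by (rule det_scale)
  moreover have "of_real (exp (g z)) ^ CARD('n) = complex_of_real (exp (real CARD('n) * g z))"
    by (metis exp_of_nat_mult of_real_power)
  ultimately show ?thesis by (simp add: mult.commute)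
qed

lemma continuous_on_g: "continuous_on \<Omega> g"
  by (rule smooth_on_imp_continuous_on[OF smooth_g])

lemma continuous_on_H: "continuous_on \<Omega> (\<lambda>z. H z $ i $ j)"
  by (rule smooth_on_imp_continuous_on[OF smooth_on_complex_hessian[OF open_domain smooth_g]])

lemma continuous_on_b: "continuous_on \<Omega> (\<lambda>z. b z $ i)"
  by (rule smooth_on_imp_continuous_on[OF smooth_on_grad_z[OF open_domain smooth_g]])

lemma continuous_on_det_H: "continuous_on \<Omega> (\<lambda>z. Re (det (H z)))"
  by (intro continuous_on_Re smooth_on_imp_continuous_on smooth_on_det smooth_on_complex_hessian
      open_domain smooth_g)

lemma continuous_on_grad_g_sq: "continuous_on \<Omega> grad_g_sq"
  unfolding grad_g_sq_def[abs_def]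
  by (intro continuous_on_Re continuous_on_inv_form continuous_on_H continuous_on_b pos_def_H)

theorem complete: "complete_hermitian_metric \<Omega> H"
proof -
  interpret hermitian_domain \<Omega> H
    by unfold_locales (simp_all add: open_domain connected_domain continuous_on_H pos_def_H)
  show ?thesis
  proof (rule completeI[where u = g and C = 2])
    fix z assume z: "z \<in> \<Omega>"
    show g': "(g has_derivative frechet_derivative g (at z)) (at z)"
      by (rule smooth_on_has_derivative[OF smooth_g z])
    fix v
    have "\<bar>frechet_derivative g (at z) v\<bar> \<le> 2 * norm (\<Sum>i\<in>UNIV. b z $ i * v $ i)"
      using abs_Re_le_cmod[of "\<Sum>i\<in>UNIV. b z $ i * v $ i"] by (simp only: derivative_grad_z[OF g'] abs_mult)
    \<comment> \<open>\<open>H\<close> exceeds the positive matrix \<open>scaled_hessian\<close> by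
      the square of this pairing.\<close>
    also have "norm (\<Sum>i\<in>UNIV. b z $ i * v $ i) \<le> hermitian_norm (H z) v"
      unfolding hermitian_norm_hform hform_H[OF z]
      using pos_def_matrix_nonneg[OF pos_def_scaled_hessian[OF z], of v]
      by (intro real_le_rsqrt) (simp del: of_real_power)
    finally show "\<bar>frechet_derivative g (at z) v\<bar> \<le> 2 * hermitian_norm (H z) v" by simp
  next
    fix B :: real
    \<comment> \<open>The condition g \<le> B means \<rho> \<le> - exp (- B); halving gives room for
      the strict inequality in the sublevel set.\<close>
    define c where "c = - (exp (- B) / 2)"
    have c: "c < 0" by (simp add: c_def)
    have "\<rho> z < c" if "z \<in> \<Omega>" "g z \<le> B" for z
    proof -
      have "exp (- B) \<le> exp (- g z)" using that by simp
      then show ?thesis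
        unfolding rho_eq[OF that(1)] c_def using exp_gt_zero[of "- B"] by linarith
    qed
    then have "{z \<in> \<Omega>. g z \<le> B} \<subseteq> closure {z \<in> \<Omega>. \<rho> z < c}"
      using closure_subset[of "{z \<in> \<Omega>. \<rho> z < c}"] by auto
    then show "\<exists>K. compact K \<and> K \<subseteq> \<Omega> \<and> {z \<in> \<Omega>. g z \<le> B} \<subseteq> K"
      using sublevel_compact[OF c] by blast
  qed simp
qed

section \<open>Cutoffs of exponentials of the potential\<close>

definition cut :: "real \<Rightarrow> real \<Rightarrow> complex^'n \<Rightarrow> real"
  where "cut s k z = (if z \<in> \<Omega> then exp (- s * g z) * exp_cutoff 0 (k * exp (- g z) - 1) else 0)"

text \<open>The derivative at \<open>g z\<close> of the one-variable profile of which
  \<open>cut s k\<close> is the composition with \<open>g\<close>.\<close>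

definition cut_deriv :: "real \<Rightarrow> real \<Rightarrow> complex^'n \<Rightarrow> real"
  where "cut_deriv s k z = - (exp (- s * g z) * (s * exp_cutoff 0 (k * exp (- g z) - 1)
    + k * exp (- g z) * exp_cutoff 1 (k * exp (- g z) - 1)))"

text \<open>The cutoff vanishes where - \<rho> \<le> 1/k. The level 1/(2 k) is lower, so the
  corresponding sublevel set of \<rho> has relatively compact closure containing the
  support.\<close>

lemma cut_test_function:
  assumes k: "k > 0"
  shows "cut s k \<in> test_functions \<Omega>"
proof (rule test_functionsI[OF open_domain])
  let ?K = "closure {z \<in> \<Omega>. \<rho> z < - (1 / (2 * k))}"
  show "compact ?K" "?K \<subseteq> \<Omega>"
    using sublevel_compact[of "- (1 / (2 * k))"] k by auto
  show "cut s k z = 0" if "z \<notin> ?K" for z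
  proof (cases "z \<in> \<Omega>")
    case True
    then have "- (1 / (2 * k)) \<le> \<rho> z"
      using that closure_subset[of "{z \<in> \<Omega>. \<rho> z < - (1 / (2 * k))}"] by force
    then have "exp (- g z) \<le> 1 / (2 * k)"
      using rho_eq[OF True] by simp
    then have "k * exp (- g z) \<le> k * (1 / (2 * k))"
      using k by (intro mult_left_mono) auto
    then have "k * exp (- g z) - 1 \<le> 0"
      using k by simp
    then show ?thesis
      by (simp add: cut_def exp_cutoff_def)
  qed (simp add: cut_def)
  define \<phi> where "\<phi> n x = (- s) ^ n * exp (- s * x)" for n x
  have "smooth_on \<Omega> (\<lambda>z. \<phi> 0 (g z))"
    by (rule smooth_on_compose_real[OF open_domain _ _ smooth_g, where T = UNIV])
      (auto simp: \<phi>_def intro!: derivative_eq_intros)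
  moreover have "smooth_on \<Omega> (\<lambda>z. exp_cutoff 0 (k * (- \<rho> z) - 1))"
    by (rule smooth_on_compose_real[where T = UNIV and \<phi> = exp_cutoff, OF open_domain exp_cutoff_deriv])
      (auto intro!: smooth_intros open_domain smooth_rho)
  ultimately have "smooth_on \<Omega> (\<lambda>z. \<phi> 0 (g z) * exp_cutoff 0 (k * (- \<rho> z) - 1))"
    by (rule smooth_on_mult[OF open_domain])
  then show "smooth_on \<Omega> (cut s k)"
    by (rule smooth_on_cong[OF open_domain, rotated]) (simp add: cut_def \<phi>_def rho_eq)
qed

lemma grad_z_cut:
  assumes z: "z \<in> \<Omega>"
  shows "grad_z (cut s k) z = of_real (cut_deriv s k z) *s b z"
proof -
  define \<phi> where "\<phi> x = exp (- s * x) * exp_cutoff 0 (k * exp (- x) - 1)" for x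
  have d: "(\<phi> has_real_derivative cut_deriv s k z) (at (g z))"
    unfolding \<phi>_def
    by (auto intro!: derivative_eq_intros DERIV_chain'[OF _ exp_cutoff_deriv]
        simp: cut_deriv_def algebra_simps simp del: One_nat_def)
       (simp add: algebra_simps)
  have "grad_z (cut s k) z = grad_z (\<lambda>w. \<phi> (g w)) z"
  proof (rule grad_z_cong[OF open_domain z])
    show "(\<lambda>w. \<phi> (g w)) differentiable (at z)"
      using has_derivative_compose[OF smooth_on_has_derivative[OF smooth_g z] d[unfolded has_field_derivative_def]]
      by (auto simp: differentiable_def)
  qed (simp add: cut_def \<phi>_def)
  also have "\<dots> = of_real (cut_deriv s k z) *s b z"
    by (rule grad_z_compose_real[OF differentiable_g[OF z] d])
  finally show ?thesis .
qed

section \<open>Weighted integrals of test functions and the lower bound\<close>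

lemma integrable_vol:
  assumes "continuous_on \<Omega> h" "compact K" "K \<subseteq> \<Omega>" "\<And>z. z \<notin> K \<Longrightarrow> h z = 0"
  shows "integrable lborel (\<lambda>z. vol z * h z)"
proof (rule integrable_continuous_compact_support[OF _ assms(2)])
  have "continuous_on K (\<lambda>z. Re (det (H z)) * h z)"
    using continuous_on_subset[OF continuous_on_det_H assms(3)] continuous_on_subset[OF assms(1,3)]
    by (rule continuous_on_mult)
  then show "continuous_on K (\<lambda>z. vol z * h z)"
    by (rule continuous_on_eq) (use assms(3) in \<open>auto simp: vol_def\<close>)
qed (simp add: assms(4))

lemma continuous_on_gradient_sq:
  assumes f: "smooth_on UNIV f"
  shows "continuous_on \<Omega> (\<lambda>z. gradient_sq (H z) f z)"
proof -
  have "continuous_on \<Omega> (\<lambda>z. grad_z f z $ i)" for i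
    using smooth_on_imp_continuous_on[OF smooth_on_grad_z[OF open_UNIV f]]
    by (rule continuous_on_subset) simp
  then have "continuous_on \<Omega> (\<lambda>z. Re (inv_form (H z) (grad_z f z) (grad_z f z)))"
    by (intro continuous_on_Re continuous_on_inv_form continuous_on_H pos_def_H)
  moreover have "f differentiable (at z)" for z
    using smooth_on_has_derivative[OF f] by (auto simp: differentiable_def)
  ultimately show ?thesis
    by (simp add: gradient_sq_inv_form)
qed

lemma test_function_integrable:
  assumes f: "f \<in> test_functions \<Omega>"
  shows "integrable lborel (\<lambda>z. vol z * f z)"
    and "integrable lborel (\<lambda>z. vol z * (f z)\<^sup>2)"
    and "integrable lborel (\<lambda>z. vol z * gradient_sq (H z) f z)"
proof -
  obtain K where K: "compact K" "K \<subseteq> \<Omega>" "\<And>x. x \<notin> K \<Longrightarrow> f x = 0" and fs: "smooth_on UNIV f"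
    using f by (rule test_functionsE) blast
  have cf: "continuous_on \<Omega> f"
    using smooth_on_imp_continuous_on[OF fs] by (rule continuous_on_subset) simp
  show "integrable lborel (\<lambda>z. vol z * f z)"
    by (rule integrable_vol[OF cf K])
  show "integrable lborel (\<lambda>z. vol z * (f z)\<^sup>2)"
    by (rule integrable_vol[OF continuous_on_power[OF cf] K(1,2)]) (simp add: K(3))
  have "gradient_sq (H z) f z = 0" if "z \<notin> K" for z
  proof -
    have f': "(f has_derivative (\<lambda>v. 0)) (at z)"
      by (rule derivative_zero_off_support[OF compact_imp_closed[OF K(1)] K(3) that])
    then have "f differentiable (at z)" by (auto simp: differentiable_def)
    moreover have "grad_z f z = 0"
      by (simp add: vec_eq_iff grad_z_eq[OF f'])
    ultimately show ?thesis
      by (simp add: gradient_sq_inv_form inv_form_def)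
  qed
  then show "integrable lborel (\<lambda>z. vol z * gradient_sq (H z) f z)"
    by (rule integrable_vol[OF continuous_on_gradient_sq[OF fs] K(1,2)])
qed

lemma integral_vol_by_parts:
  assumes f: "f \<in> test_functions \<Omega>"
  shows "integrable lborel (\<lambda>z. vol z * (real CARD('n) * f z + Re (inv_form (H z) (b z) (grad_z f z))))"
    and "integral\<^sup>L lborel (\<lambda>z. vol z * (real CARD('n) * f z + Re (inv_form (H z) (b z) (grad_z f z)))) = 0"
proof -
  obtain K where K: "compact K" "K \<subseteq> \<Omega>" "\<And>x. x \<notin> K \<Longrightarrow> f x = 0" and fs: "smooth_on UNIV f"
    using f by (rule test_functionsE) blast
  have eq: "vol z * (real CARD('n) * f z + Re (inv_form (H z) (b z) (grad_z f z)))
    = Re (det (H z)) * (real CARD('n) * f z + Re (inv_form (H z) (b z) (grad_z f z)))" for z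
  proof (cases "z \<in> \<Omega>")
    case False
    then have z: "z \<notin> K" using K by auto
    have f': "(f has_derivative (\<lambda>v. 0)) (at z)"
      by (rule derivative_zero_off_support[OF compact_imp_closed[OF K(1)] K(3) z])
    have "grad_z f z = 0"
      by (simp add: vec_eq_iff grad_z_eq[OF f'])
    then show ?thesis
      by (simp add: inv_form_def K(3)[OF z])
  qed (simp add: vol_def)
  show "integrable lborel (\<lambda>z. vol z * (real CARD('n) * f z + Re (inv_form (H z) (b z) (grad_z f z))))"
    unfolding eq by (rule integration_by_parts(1)[OF open_domain smooth_g f pos_def_H])
  show "integral\<^sup>L lborel (\<lambda>z. vol z * (real CARD('n) * f z + Re (inv_form (H z) (b z) (grad_z f z)))) = 0"
    unfolding eq by (rule integration_by_parts(2)[OF open_domain smooth_g f pos_def_H])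
qed

lemma test_function_square:
  assumes f: "f \<in> test_functions \<Omega>"
  shows "(\<lambda>z. (f z)\<^sup>2) \<in> test_functions \<Omega>"
proof -
  obtain K where K: "compact K" "K \<subseteq> \<Omega>" "\<And>x. x \<notin> K \<Longrightarrow> f x = 0" and fs: "smooth_on UNIV f"
    using f by (rule test_functionsE) blast
  show ?thesis
  proof (rule test_functionsI[OF open_domain K(1,2)])
    show "smooth_on \<Omega> (\<lambda>z. (f z)\<^sup>2)"
      using smooth_on_subset[OF fs, of \<Omega>] unfolding power2_eq_square
      by (intro smooth_on_mult open_domain) auto
  qed (simp add: K(3))
qed

text \<open>Integrate \<open>0 \<le> |\<partial>f + (n/2) f \<partial>g|\<^sup>2\<close>, using \<open>|\<partial>g| \<le> 1\<close> and integration by parts for \<open>f\<^sup>2\<close>.\<close>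

lemma spectral_lower_bound:
  assumes f: "f \<in> test_functions \<Omega>"
  shows "(real CARD('n))\<^sup>2 * mass f
    \<le> 4 * energy f"
proof -
  define n where "n = real CARD('n)"
  let ?F = "\<lambda>z. n * (f z)\<^sup>2 + Re (inv_form (H z) (b z) (grad_z (\<lambda>z. (f z)\<^sup>2) z))"
  obtain K where fs: "smooth_on UNIV f"
    using f by (rule test_functionsE) blast
  have fd: "f differentiable (at z)" for z
    using smooth_on_has_derivative[OF fs] by (auto simp: differentiable_def)
  \<comment> \<open>\<open>?F\<close> is the integrand for f^2 whose weighted integral vanishes; the
    multiple 2 n of it is the one that eliminates the cross term of the expanded square.\<close>
  have pointwise: "n\<^sup>2 * (vol z * (f z)\<^sup>2) - 2 * n * (vol z * ?F z) \<le> 4 * (vol z * gradient_sq (H z) f z)" for z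
  proof (cases "z \<in> \<Omega>")
    case True
    note PD = pos_def_H[OF True]
    define a where "a = n / 2 * f z"
    define c where "c = grad_z f z"
    define p where "p = Re (inv_form (H z) (b z) c)"
    have sq: "grad_z (\<lambda>z. (f z)\<^sup>2) z = of_real (2 * f z) *s c"
      unfolding c_def by (rule grad_z_compose_real[OF fd]) (auto intro!: derivative_eq_intros)
    have sym: "Re (inv_form (H z) c (b z)) = p"
      using inv_form_cnj[OF PD, of "b z" c] by (metis p_def cnj.sel(1))
    have "0 \<le> Re (inv_form (H z) (c + of_real a *s b z) (c + of_real a *s b z))"
      by (rule inv_form_nonneg[OF PD])
    also have "\<dots> = gradient_sq (H z) f z + 2 * a * p + a\<^sup>2 * grad_g_sq z"
      using sym
      by (simp add: inv_form_add_left inv_form_add_right inv_form_scale_left inv_form_scale_right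
          gradient_sq_inv_form[OF fd] c_def[symmetric] grad_g_sq_def p_def power2_eq_square algebra_simps)
    also have "\<dots> \<le> gradient_sq (H z) f z + 2 * a * p + a\<^sup>2 * 1"
      using grad_g_sq_bounds[OF True] by (intro add_left_mono mult_left_mono) auto
    finally have "0 \<le> 4 * (gradient_sq (H z) f z + 2 * a * p + a\<^sup>2 * 1)"
      by simp
    also have "\<dots> = 4 * gradient_sq (H z) f z + 4 * n * f z * p + n\<^sup>2 * (f z)\<^sup>2"
      by (simp add: a_def power2_eq_square algebra_simps)
    finally have "0 \<le> 4 * gradient_sq (H z) f z + 4 * n * f z * p + n\<^sup>2 * (f z)\<^sup>2" .
    moreover have "?F z = n * (f z)\<^sup>2 + 2 * f z * p"
      by (simp add: sq inv_form_scale_right p_def)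
    ultimately have "n\<^sup>2 * (f z)\<^sup>2 - 2 * n * ?F z \<le> 4 * gradient_sq (H z) f z"
      by (simp add: power2_eq_square algebra_simps)
    then have "vol z * (n\<^sup>2 * (f z)\<^sup>2 - 2 * n * ?F z) \<le> vol z * (4 * gradient_sq (H z) f z)"
      by (rule mult_left_mono[OF _ vol_nonneg])
    then show ?thesis by (simp add: algebra_simps)
  qed (simp add: vol_def)
  note i = test_function_integrable[OF f] integral_vol_by_parts[OF test_function_square[OF f], folded n_def]
  have "integral\<^sup>L lborel (\<lambda>z. n\<^sup>2 * (vol z * (f z)\<^sup>2) - 2 * n * (vol z * ?F z))
    \<le> integral\<^sup>L lborel (\<lambda>z. 4 * (vol z * gradient_sq (H z) f z))"
    by (rule integral_mono[OF _ _ pointwise])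
      (intro Bochner_Integration.integrable_diff integrable_mult_right i)+
  moreover have "integral\<^sup>L lborel (\<lambda>z. n\<^sup>2 * (vol z * (f z)\<^sup>2) - 2 * n * (vol z * ?F z))
    = n\<^sup>2 * mass f - 2 * n * integral\<^sup>L lborel (\<lambda>z. vol z * ?F z)"
    by (subst Bochner_Integration.integral_diff)
      (intro integrable_mult_right i | simp)+
  ultimately show ?thesis
    unfolding i(5) n_def[symmetric] by simp
qed

lemma mass_pos:
  assumes f: "f \<in> test_functions \<Omega>" and "f \<noteq> (\<lambda>z. 0)"
  shows "0 < mass f"
proof -
  obtain K where K: "compact K" "K \<subseteq> \<Omega>" "\<And>x. x \<notin> K \<Longrightarrow> f x = 0" and fs: "smooth_on UNIV f"
    using f by (rule test_functionsE) blast
  obtain z where z: "f z \<noteq> 0" using assms(2) by auto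
  have "open (f -` (- {0}))"
    using smooth_on_imp_continuous_on[OF fs] by (rule open_vimage[rotated]) auto
  then have U: "open (\<Omega> \<inter> f -` (- {0}))"
    using open_domain by blast
  have ne: "\<Omega> \<inter> f -` (- {0}) \<noteq> {}"
    using z K by auto
  have "mass f \<noteq> 0"
  proof
    assume "mass f = 0"
    then have "AE z in lborel. vol z * (f z)\<^sup>2 = 0"
      using integral_nonneg_eq_0_iff_AE[OF test_function_integrable(2)[OF f]] vol_nonneg by simp
    from AE_lborel_open_witness[OF this U ne] show False
      using det_H_pos by (force simp: vol_def)
  qed
  moreover have "0 \<le> mass f"
    by (rule Bochner_Integration.integral_nonneg) (simp add: vol_nonneg)
  ultimately show ?thesis by simp
qed

section \<open>Rayleigh quotients with respect to Lebesgue measure\<close>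

lemma measurable_vol: "vol \<in> borel_measurable borel"
  using borel_measurable_continuous_on_indicator[OF _ continuous_on_det_H] open_domain
  by (simp add: vol_def[abs_def])

lemma wedge_power_measure_vol:
  "\<mu>
    = density lborel (\<lambda>z. ennreal (2 ^ CARD('n) * fact CARD('n) * vol z))"
  unfolding wedge_power_measure_def
proof (intro arg_cong[where f = "density lborel"] ext)
  show "ennreal (top_wedge_power (fundamental_form (H z))) * indicator \<Omega> z
    = ennreal (2 ^ CARD('n) * fact CARD('n) * vol z)" for z
    by (cases "z \<in> \<Omega>")
      (simp_all add: top_wedge_power_fundamental_form[OF pos_def_matrix_hermitian[OF pos_def_H]] vol_def)
qed

lemma set_integral_wedge_power_measure:
  assumes "continuous_on \<Omega> h"
  shows "(\<integral>z\<in>\<Omega>. h z \<partial>\<mu>)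
    = 2 ^ CARD('n) * fact CARD('n) * integral\<^sup>L lborel (\<lambda>z. vol z * h z)"
proof -
  have "(\<lambda>z. indicator \<Omega> z *\<^sub>R h z) \<in> borel_measurable borel"
    using borel_measurable_continuous_on_indicator[OF _ assms] open_domain by simp
  then have "(\<integral>z\<in>\<Omega>. h z \<partial>\<mu>)
    = integral\<^sup>L lborel (\<lambda>z. (2 ^ CARD('n) * fact CARD('n) * vol z) *\<^sub>R (indicator \<Omega> z *\<^sub>R h z))"
    unfolding set_lebesgue_integral_def wedge_power_measure_vol
    using measurable_vol vol_nonneg by (intro integral_density) auto
  also have "\<dots> = integral\<^sup>L lborel (\<lambda>z. (2 ^ CARD('n) * fact CARD('n)) * (vol z * h z))"
    by (intro Bochner_Integration.integral_cong refl) (simp add: vol_def indicator_def)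
  finally show ?thesis by simp
qed

text \<open>The factor 2^n n! occurs in numerator and denominator and cancels.\<close>

lemma bottom_spectrum_eq:
  "bottom_spectrum \<Omega> H = Inf rayleigh_quotients"
proof -
  have "4 * (\<integral>z\<in>\<Omega>. gradient_sq (H z) f z \<partial>\<mu>)
      / (\<integral>z\<in>\<Omega>. \<bar>f z\<bar>\<^sup>2 \<partial>\<mu>)
    = 4 * energy f / mass f"
    if f: "f \<in> test_functions \<Omega>" for f
  proof -
    obtain K where fs: "smooth_on UNIV f"
      using f by (rule test_functionsE) blast
    have "continuous_on \<Omega> (\<lambda>z. \<bar>f z\<bar>\<^sup>2)"
      using continuous_on_subset[OF smooth_on_imp_continuous_on[OF fs]] by (intro continuous_intros) auto
    then show ?thesis
      by (simp add: set_integral_wedge_power_measure continuous_on_gradient_sq[OF fs])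
  qed
  then show ?thesis
    unfolding bottom_spectrum_def Let_def setcompr_eq_image
    by (intro arg_cong[where f = Inf] image_cong refl) simp
qed

lemma cut_nonzero: "z \<in> \<Omega> \<Longrightarrow> exp (g z) < k \<Longrightarrow> cut s k z \<noteq> 0"
proof -
  assume "z \<in> \<Omega>" "exp (g z) < k"
  then have "0 < k * exp (- g z) - 1"
    by (simp add: exp_minus divide_inverse[symmetric])
  then show ?thesis
    using \<open>z \<in> \<Omega>\<close> exp_cutoff_pos by (simp add: cut_def less_imp_neq[symmetric])
qed

text \<open>Ensures that the infimum of Rayleigh quotients is taken over a nonempty set.\<close>

lemma cut_exists: "\<exists>f. f \<in> test_functions \<Omega> \<and> f \<noteq> (\<lambda>z. 0)"
proof -
  obtain z where z: "z \<in> \<Omega>" using nonempty_domain by blast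
  have "cut 0 (exp (g z) + 1) z \<noteq> 0"
    by (rule cut_nonzero[OF z]) simp
  moreover have "cut 0 (exp (g z) + 1) \<in> test_functions \<Omega>"
    by (rule cut_test_function) (simp add: add_pos_pos)
  ultimately show ?thesis by metis
qed

lemma bottom_spectrum_ge: "(real CARD('n))\<^sup>2 \<le> bottom_spectrum \<Omega> H"
  unfolding bottom_spectrum_eq
proof (rule cInf_greatest)
  fix x assume "x \<in> rayleigh_quotients"
  then obtain f where f: "f \<in> test_functions \<Omega>" "f \<noteq> (\<lambda>z. 0)"
    and x: "x = 4 * energy f / mass f"
    by blast
  show "(real CARD('n))\<^sup>2 \<le> x"
    unfolding x using spectral_lower_bound[OF f(1)] mass_pos[OF f] by (simp add: pos_le_divide_eq)
qed (use cut_exists in blast)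

lemma bottom_spectrum_le:
  assumes f: "f \<in> test_functions \<Omega>" "f \<noteq> (\<lambda>z. 0)"
  shows "bottom_spectrum \<Omega> H \<le> 4 * energy f
      / mass f"
  unfolding bottom_spectrum_eq
proof (rule cInf_lower)
  show "bdd_below rayleigh_quotients"
  proof (rule bdd_belowI[of _ 0])
    fix x assume "x \<in> rayleigh_quotients"
    then obtain f where f: "f \<in> test_functions \<Omega>" "f \<noteq> (\<lambda>z. 0)"
      and x: "x = 4 * energy f / mass f"
      by blast
    have "0 \<le> (real CARD('n))\<^sup>2 * mass f"
      using mass_pos[OF f] by simp
    then have "0 \<le> 4 * energy f"
      using spectral_lower_bound[OF f(1)] by (rule order_trans)
    then show "0 \<le> x"
      unfolding x using mass_pos[OF f] by (rule divide_nonneg_pos)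
  qed
qed (use f in blast)


section \<open>Finiteness of the weighted mass and the upper bound\<close>

text \<open>The integration by parts for \<open>exp (- 2 s g) \<eta>\<close>, with \<open>\<eta>\<close> a cutoff decreasing in \<open>g\<close>,
  controls the mass of \<open>exp (- 2 s g)\<close> by its part weighted with
  \<open>1 - grad_g_sq\<close>, which the Monge-Ampere hypothesis bounds.\<close>

lemma cut_mass_bound:
  assumes s: "2 * s > real CARD('n)" and k: "k > 0"
    and J: "integrable lborel (\<lambda>z. vol z * ((1 - grad_g_sq z) * exp (- (2 * s) * g z)))"
  shows "(2 * s - real CARD('n)) * integral\<^sup>L lborel (\<lambda>z. vol z * cut (2 * s) k z)
    \<le> 2 * s * integral\<^sup>L lborel (\<lambda>z. vol z * ((1 - grad_g_sq z) * exp (- (2 * s) * g z)))"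
proof -
  define n where "n = real CARD('n)"
  let ?f = "cut (2 * s) k"
  let ?F = "\<lambda>z. n * ?f z + Re (inv_form (H z) (b z) (grad_z ?f z))"
  let ?J = "\<lambda>z. (1 - grad_g_sq z) * exp (- (2 * s) * g z)"
  have s0: "s > 0" using s of_nat_0_le_iff[of "CARD('n)"] by linarith
  note f = cut_test_function[OF k, of "2 * s"]
  note i = test_function_integrable(1)[OF f] integral_vol_by_parts[OF f, folded n_def]
  have pointwise: "(2 * s - n) * (vol z * ?f z) + vol z * ?F z \<le> 2 * s * (vol z * ?J z)" for z
  proof (cases "z \<in> \<Omega>")
    case True
    define e where "e = exp (- (2 * s) * g z)"
    define y where "y = k * exp (- g z)"
    define \<eta> where "\<eta> = exp_cutoff 0 (y - 1)"
    define \<psi> where "\<psi> = y * exp_cutoff 1 (y - 1)"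
    have f: "?f z = e * \<eta>"
      using True by (simp add: cut_def e_def \<eta>_def y_def)
    have "cut_deriv (2 * s) k z = - (e * (2 * s * \<eta> + \<psi>))"
      by (simp add: cut_deriv_def e_def \<eta>_def y_def \<psi>_def)
    moreover have "Re (inv_form (H z) (b z) (grad_z ?f z)) = cut_deriv (2 * s) k z * grad_g_sq z"
      by (simp add: grad_z_cut[OF True] inv_form_scale_right grad_g_sq_def)
    ultimately have q: "Re (inv_form (H z) (b z) (grad_z ?f z)) = - (e * (2 * s * \<eta> + \<psi>)) * grad_g_sq z"
      by simp
    \<comment> \<open>The derivative of the cutoff enters only through \<psi> \<ge> 0, with a minus
      sign: the term is dropped, and bounding \<eta> by 1 leaves an estimate independent of
      \<open>k\<close>.\<close>
    have "(2 * s - n) * ?f z + ?F z = 2 * s * (1 - grad_g_sq z) * e * \<eta> - e * \<psi> * grad_g_sq z"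
      unfolding q f by (simp add: algebra_simps)
    also have "\<dots> \<le> 2 * s * (1 - grad_g_sq z) * e * \<eta>"
      using grad_g_sq_bounds[OF True] exp_cutoff_weighted_deriv(1)[of y] by (simp add: e_def \<psi>_def)
    also have "\<dots> \<le> 2 * s * (1 - grad_g_sq z) * e * 1"
      using grad_g_sq_bounds[OF True] s0 by (intro mult_left_mono) (auto simp: \<eta>_def exp_cutoff_bounds e_def)
    also have "\<dots> = 2 * s * ?J z" by (simp add: e_def)
    finally have "vol z * ((2 * s - n) * ?f z + ?F z) \<le> vol z * (2 * s * ?J z)"
      by (rule mult_left_mono[OF _ vol_nonneg])
    then show ?thesis by (simp add: algebra_simps)
  qed (simp add: vol_def)
  have "integral\<^sup>L lborel (\<lambda>z. (2 * s - n) * (vol z * ?f z) + vol z * ?F z)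
    \<le> integral\<^sup>L lborel (\<lambda>z. 2 * s * (vol z * ?J z))"
    by (rule integral_mono[OF _ _ pointwise])
      (intro Bochner_Integration.integrable_add integrable_mult_right i J)+
  moreover have "integral\<^sup>L lborel (\<lambda>z. (2 * s - n) * (vol z * ?f z) + vol z * ?F z)
    = (2 * s - n) * integral\<^sup>L lborel (\<lambda>z. vol z * ?f z) + integral\<^sup>L lborel (\<lambda>z. vol z * ?F z)"
    by (subst Bochner_Integration.integral_add) (intro integrable_mult_right i | simp)+
  ultimately show ?thesis
    unfolding i(3) n_def[symmetric] by simp
qed

lemma exp_cutoff_scaled_tendsto:
  "(\<lambda>k. exp_cutoff 0 (real (Suc k) * exp (- x) - 1)) \<longlonglongrightarrow> 1"
  "(\<lambda>k. real (Suc k) * exp (- x) * exp_cutoff 1 (real (Suc k) * exp (- x) - 1)) \<longlonglongrightarrow> 0"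
proof -
  have "filterlim (\<lambda>k. exp (- x) * real (Suc k)) at_top sequentially"
    by (intro filterlim_tendsto_pos_mult_at_top[OF tendsto_const] filterlim_compose[OF filterlim_real_sequentially filterlim_Suc]) simp
  then have l: "filterlim (\<lambda>k. real (Suc k) * exp (- x)) at_top sequentially"
    by (simp only: mult.commute)
  have "filterlim (\<lambda>k. - 1 + real (Suc k) * exp (- x)) at_top sequentially"
    by (rule filterlim_tendsto_add_at_top[OF tendsto_const l])
  then have l1: "filterlim (\<lambda>k. real (Suc k) * exp (- x) - 1) at_top sequentially"
    by (simp only: diff_conv_add_uminus add.commute)
  show "(\<lambda>k. exp_cutoff 0 (real (Suc k) * exp (- x) - 1)) \<longlonglongrightarrow> 1"
    by (rule filterlim_compose[OF exp_cutoff_tendsto l1])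
  show "(\<lambda>k. real (Suc k) * exp (- x) * exp_cutoff 1 (real (Suc k) * exp (- x) - 1)) \<longlonglongrightarrow> 0"
    by (rule filterlim_compose[OF exp_cutoff_weighted_deriv_tendsto l])
qed

lemma cut_tendsto: "z \<in> \<Omega> \<Longrightarrow> (\<lambda>k. cut s (real (Suc k)) z) \<longlonglongrightarrow> exp (- s * g z)"
  using tendsto_mult_left[OF exp_cutoff_scaled_tendsto(1)[of "g z"], of "exp (- s * g z)"]
  by (simp add: cut_def)

lemma cut_bounds: "0 \<le> cut s k z" "z \<in> \<Omega> \<Longrightarrow> cut s k z \<le> exp (- s * g z)"
  by (simp_all add: cut_def exp_cutoff_bounds mult_left_le)

lemma measurable_vol_mult:
  assumes "continuous_on \<Omega> h"
  shows "(\<lambda>z. vol z * h z) \<in> borel_measurable lborel"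
proof -
  have "(\<lambda>z. vol z * (indicator \<Omega> z *\<^sub>R h z)) \<in> borel_measurable borel"
    using borel_measurable_continuous_on_indicator[OF _ assms] open_domain
    by (intro borel_measurable_times measurable_vol) simp
  moreover have "(\<lambda>z. vol z * (indicator \<Omega> z *\<^sub>R h z)) = (\<lambda>z. vol z * h z)"
    by (auto simp: fun_eq_iff vol_def indicator_def)
  ultimately show ?thesis by simp
qed

text \<open>Fatou's lemma for the cutoffs of exp (- 2 s g), whose integrals are bounded
  independently of \<open>k\<close>.\<close>

lemma mass_finite:
  assumes s: "2 * s > real CARD('n)"
    and J: "integrable lborel (\<lambda>z. vol z * ((1 - grad_g_sq z) * exp (- (2 * s) * g z)))"
  shows "integrable lborel (\<lambda>z. vol z * exp (- (2 * s) * g z))"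
proof -
  define B where "B = 2 * s * integral\<^sup>L lborel (\<lambda>z. vol z * ((1 - grad_g_sq z) * exp (- (2 * s) * g z))) / (2 * s - real CARD('n))"
  let ?f = "\<lambda>k. cut (2 * s) (real (Suc k))"
  have "(\<integral>\<^sup>+z. ennreal (vol z * ?f k z) \<partial>lborel) \<le> ennreal B" for k
  proof -
    have "integral\<^sup>L lborel (\<lambda>z. vol z * ?f k z) \<le> B"
      using cut_mass_bound[OF s _ J, of "real (Suc k)"] s by (simp add: B_def pos_le_divide_eq mult.commute)
    moreover have "(\<integral>\<^sup>+z. ennreal (vol z * ?f k z) \<partial>lborel) = ennreal (integral\<^sup>L lborel (\<lambda>z. vol z * ?f k z))"
      by (rule nn_integral_eq_integral[OF test_function_integrable(1)[OF cut_test_function]])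
        (simp_all add: vol_nonneg cut_bounds)
    ultimately show ?thesis by (simp add: ennreal_leI)
  qed
  then have le: "liminf (\<lambda>k. \<integral>\<^sup>+z. ennreal (vol z * ?f k z) \<partial>lborel) \<le> ennreal B"
    using Liminf_le_Limsup Limsup_bounded[of "\<lambda>k. \<integral>\<^sup>+z. ennreal (vol z * ?f k z) \<partial>lborel" "ennreal B" sequentially]
    by (meson always_eventually order_trans trivial_limit_sequentially)
  have lim: "liminf (\<lambda>k. ennreal (vol z * ?f k z)) = ennreal (vol z * exp (- (2 * s) * g z))" for z
  proof (rule lim_imp_Liminf)
    have "(\<lambda>k. vol z * ?f k z) \<longlonglongrightarrow> vol z * exp (- (2 * s) * g z)"
    proof (cases "z \<in> \<Omega>")
      case True
      show ?thesis by (rule tendsto_mult_left[OF cut_tendsto[OF True]])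
    qed (simp add: vol_def)
    then show "(\<lambda>k. ennreal (vol z * ?f k z)) \<longlonglongrightarrow> ennreal (vol z * exp (- (2 * s) * g z))"
      by (rule tendsto_ennrealI)
  qed simp
  have "(\<integral>\<^sup>+z. ennreal (vol z * exp (- (2 * s) * g z)) \<partial>lborel)
    \<le> liminf (\<lambda>k. \<integral>\<^sup>+z. ennreal (vol z * ?f k z) \<partial>lborel)"
    unfolding lim[symmetric]
    by (rule nn_integral_liminf)
      (intro measurable_compose[OF _ measurable_ennreal] borel_measurable_integrable test_function_integrable(1) cut_test_function, simp)
  from order_trans[OF this le] have "(\<integral>\<^sup>+z. ennreal (vol z * exp (- (2 * s) * g z)) \<partial>lborel) < \<infinity>"
    by (rule order_le_less_trans) simp
  moreover have "(\<lambda>z. vol z * exp (- (2 * s) * g z)) \<in> borel_measurable lborel"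
    by (intro measurable_vol_mult continuous_intros continuous_on_g)
  ultimately show ?thesis
    by (intro integrableI_nonneg) (auto simp: vol_nonneg)
qed

text \<open>The test functions are the cutoffs of exp (- s g), whose squares tend to the integrable
  function exp (- 2 s g). Their gradients are multiples of \<partial>g with factor tending to - s
  exp (- s g), and |\<partial>g|^2 \<le> 1.\<close>

lemma bottom_spectrum_le_4_sq:
  assumes s: "2 * s > real CARD('n)"
    and J: "integrable lborel (\<lambda>z. vol z * ((1 - grad_g_sq z) * exp (- (2 * s) * g z)))"
  shows "bottom_spectrum \<Omega> H \<le> 4 * s\<^sup>2"
proof -
  have s0: "s > 0" using s of_nat_0_le_iff[of "CARD('n)"] by linarith
  note M = mass_finite[OF s J]
  let ?f = "\<lambda>k. cut s (real (Suc k))"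
  define E where "E z = exp (- (2 * s) * g z)" for z
  have E: "exp (- s * g z) * exp (- s * g z) = E z" for z
    by (simp add: E_def exp_add[symmetric])
  have ME: "integrable lborel (\<lambda>z. vol z * E z)"
    using M by (simp add: E_def)
  note test = cut_test_function[of "real (Suc k)" s for k]
  have grad: "gradient_sq (H z) (?f k) z = (cut_deriv s (real (Suc k)) z)\<^sup>2 * grad_g_sq z" if z: "z \<in> \<Omega>" for z k
  proof -
    obtain K where fs: "smooth_on UNIV (?f k)"
      using test[of k] by (rule test_functionsE) auto
    have "?f k differentiable (at z)"
      using smooth_on_has_derivative[OF fs, of z] by (auto simp: differentiable_def)
    then show ?thesis
      by (simp add: gradient_sq_inv_form grad_z_cut[OF z] inv_form_scale_left inv_form_scale_right
          grad_g_sq_def power2_eq_square)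
  qed
  \<comment> \<open>The logarithmic derivative factor of the cutoff function, up to sign: it lies
    between 0 and s + 3 for all \<open>k\<close> and tends to s at each point.\<close>
  define c where "c k z = s * exp_cutoff 0 (real (Suc k) * exp (- g z) - 1)
    + real (Suc k) * exp (- g z) * exp_cutoff 1 (real (Suc k) * exp (- g z) - 1)" for k z
  have c_bounds: "0 \<le> c k z" "c k z \<le> s + 3" for k z
  proof -
    have "s * exp_cutoff 0 (real (Suc k) * exp (- g z) - 1) \<le> s * 1"
      using s0 exp_cutoff_bounds by (intro mult_left_mono) auto
    then show "c k z \<le> s + 3"
      unfolding c_def using exp_cutoff_weighted_deriv(2)[of "real (Suc k) * exp (- g z)"] by linarith
    show "0 \<le> c k z"
      unfolding c_def using s0 exp_cutoff_bounds(1) exp_cutoff_weighted_deriv(1)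
      by (intro add_nonneg_nonneg mult_nonneg_nonneg[of s]) auto
  qed
  have c_lim: "(\<lambda>k. c k z) \<longlonglongrightarrow> s" for z
    using tendsto_add[OF tendsto_mult_left[OF exp_cutoff_scaled_tendsto(1)[of "g z"], of s] exp_cutoff_scaled_tendsto(2)[of "g z"]]
    unfolding c_def by simp
  have grad': "vol z * gradient_sq (H z) (?f k) z = vol z * ((c k z)\<^sup>2 * E z * grad_g_sq z)" for z k
  proof (cases "z \<in> \<Omega>")
    case True
    have "(cut_deriv s (real (Suc k)) z)\<^sup>2 = (c k z)\<^sup>2 * E z"
      unfolding cut_deriv_def c_def E[symmetric] by (simp only: power2_eq_square minus_mult_minus ac_simps)
    then show ?thesis by (simp add: grad[OF True] del: of_nat_Suc)
  qed (simp add: vol_def)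
  have num: "(\<lambda>k. energy (?f k))
    \<longlonglongrightarrow> integral\<^sup>L lborel (\<lambda>z. vol z * (s\<^sup>2 * E z * grad_g_sq z))"
  proof (rule integral_dominated_convergence[where w = "\<lambda>z. (s + 3)\<^sup>2 * (vol z * E z)"])
    show "(\<lambda>z. vol z * (s\<^sup>2 * E z * grad_g_sq z)) \<in> borel_measurable lborel"
      unfolding E_def by (intro measurable_vol_mult continuous_intros continuous_on_g continuous_on_grad_g_sq)
    show "(\<lambda>z. vol z * gradient_sq (H z) (?f k) z) \<in> borel_measurable lborel" for k
      by (intro borel_measurable_integrable test_function_integrable(3) test) simp
    show "integrable lborel (\<lambda>z. (s + 3)\<^sup>2 * (vol z * E z))"
      by (intro integrable_mult_right ME)
    show "AE z in lborel. (\<lambda>k. vol z * gradient_sq (H z) (?f k) z) \<longlonglongrightarrow> vol z * (s\<^sup>2 * E z * grad_g_sq z)"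
      unfolding grad' by (intro AE_I2 tendsto_intros c_lim)
    show "AE z in lborel. norm (vol z * gradient_sq (H z) (?f k) z) \<le> (s + 3)\<^sup>2 * (vol z * E z)" for k
    proof (rule AE_I2)
      fix z
      show "norm (vol z * gradient_sq (H z) (?f k) z) \<le> (s + 3)\<^sup>2 * (vol z * E z)"
      proof (cases "z \<in> \<Omega>")
        case True
        have "(c k z)\<^sup>2 * grad_g_sq z \<le> (s + 3)\<^sup>2 * 1"
          using grad_g_sq_bounds[OF True] c_bounds by (intro mult_mono power_mono) auto
        then have "(vol z * E z) * ((c k z)\<^sup>2 * grad_g_sq z) \<le> (vol z * E z) * ((s + 3)\<^sup>2 * 1)"
          by (rule mult_left_mono) (simp add: vol_nonneg E_def)
        moreover have "norm (vol z * ((c k z)\<^sup>2 * E z * grad_g_sq z)) = (vol z * E z) * ((c k z)\<^sup>2 * grad_g_sq z)"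
          using vol_nonneg[of z] grad_g_sq_bounds[OF True] by (simp add: abs_mult E_def)
        ultimately show ?thesis
          unfolding grad' by (simp add: ac_simps)
      qed (simp add: vol_def)
    qed
  qed
  have den: "(\<lambda>k. mass (?f k)) \<longlonglongrightarrow> integral\<^sup>L lborel (\<lambda>z. vol z * E z)"
  proof (rule integral_dominated_convergence[where w = "\<lambda>z. vol z * E z"])
    show "(\<lambda>z. vol z * E z) \<in> borel_measurable lborel"
      using ME by simp
    show "(\<lambda>z. vol z * (?f k z)\<^sup>2) \<in> borel_measurable lborel" for k
      by (intro borel_measurable_integrable test_function_integrable(2) test) simp
    show "AE z in lborel. (\<lambda>k. vol z * (?f k z)\<^sup>2) \<longlonglongrightarrow> vol z * E z"
    proof (rule AE_I2)
      fix z
      show "(\<lambda>k. vol z * (?f k z)\<^sup>2) \<longlonglongrightarrow> vol z * E z"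
      proof (cases "z \<in> \<Omega>")
        case True
        show ?thesis
          unfolding E[symmetric] power2_eq_square
          by (intro tendsto_mult tendsto_const cut_tendsto True)
      qed (simp add: vol_def)
    qed
    show "AE z in lborel. norm (vol z * (?f k z)\<^sup>2) \<le> vol z * E z" for k
    proof (rule AE_I2)
      fix z
      show "norm (vol z * (?f k z)\<^sup>2) \<le> vol z * E z"
      proof (cases "z \<in> \<Omega>")
        case True
        have "(?f k z)\<^sup>2 \<le> E z"
          unfolding E[symmetric] power2_eq_square using cut_bounds[where s = s and k = "real (Suc k)" and z = z] True
          by (intro mult_mono) auto
        then show ?thesis
          using vol_nonneg[of z] by (simp add: abs_mult mult_left_mono)
      qed (simp add: vol_def)
    qed
  qed (rule ME)
  \<comment> \<open>Multiplied out because \<open>cut\<close> may vanish identically for small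
    \<open>k\<close>; the division by the mass is done in the limit, where the mass is
    positive.\<close>
  have "bottom_spectrum \<Omega> H * mass (?f k)
    \<le> 4 * energy (?f k)" for k
  proof (cases "?f k = (\<lambda>z. 0)")
    case False
    then show ?thesis
      using bottom_spectrum_le[OF test False] mass_pos[OF test False] by (simp add: pos_le_divide_eq)
  next
    case True
    have "0 \<le> vol z * gradient_sq (H z) (?f k) z" for z
      unfolding grad' using vol_nonneg[of z] grad_g_sq_bounds[of z]
      by (cases "z \<in> \<Omega>") (auto simp: E_def vol_def)
    then have "0 \<le> energy (?f k)"
      by (rule Bochner_Integration.integral_nonneg)
    then show ?thesis
      by (simp add: fun_cong[OF True] del: of_nat_Suc)
  qed
  then have le: "bottom_spectrum \<Omega> H * integral\<^sup>L lborel (\<lambda>z. vol z * E z)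
    \<le> 4 * integral\<^sup>L lborel (\<lambda>z. vol z * (s\<^sup>2 * E z * grad_g_sq z))"
    by (intro LIMSEQ_le[OF tendsto_mult_left[OF den] tendsto_mult_left[OF num]]) blast
  also have "integral\<^sup>L lborel (\<lambda>z. vol z * (s\<^sup>2 * E z * grad_g_sq z)) \<le> integral\<^sup>L lborel (\<lambda>z. s\<^sup>2 * (vol z * E z))"
  proof (rule integral_mono_AE')
    show "integrable lborel (\<lambda>z. s\<^sup>2 * (vol z * E z))"
      by (intro integrable_mult_right ME)
    have "vol z * (s\<^sup>2 * E z * grad_g_sq z) \<le> s\<^sup>2 * (vol z * E z)" for z
    proof (cases "z \<in> \<Omega>")
      case True
      have "(s\<^sup>2 * (vol z * E z)) * grad_g_sq z \<le> (s\<^sup>2 * (vol z * E z)) * 1"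
        using grad_g_sq_bounds[OF True] by (intro mult_left_mono) (auto simp: vol_nonneg E_def)
      then show ?thesis
        by (simp add: ac_simps)
    qed (simp add: vol_def)
    then show "AE z in lborel. vol z * (s\<^sup>2 * E z * grad_g_sq z) \<le> s\<^sup>2 * (vol z * E z)"
      "AE z in lborel. 0 \<le> s\<^sup>2 * (vol z * E z)"
      by (auto simp: vol_nonneg E_def)
  qed
  finally have *: "bottom_spectrum \<Omega> H * integral\<^sup>L lborel (\<lambda>z. vol z * E z) \<le> (4 * s\<^sup>2) * integral\<^sup>L lborel (\<lambda>z. vol z * E z)"
    by simp
  have "0 < integral\<^sup>L lborel (\<lambda>z. vol z * E z)"
  proof -
    have "integral\<^sup>L lborel (\<lambda>z. vol z * E z) \<noteq> 0"
    proof
      assume "integral\<^sup>L lborel (\<lambda>z. vol z * E z) = 0"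
      then have "AE z in lborel. vol z * E z = 0"
        using integral_nonneg_eq_0_iff_AE[OF ME] vol_nonneg by (simp add: E_def)
      from AE_lborel_open_witness[OF this open_domain nonempty_domain] show False
        using det_H_pos by (force simp: vol_def E_def)
    qed
    moreover have "0 \<le> integral\<^sup>L lborel (\<lambda>z. vol z * E z)"
      by (rule Bochner_Integration.integral_nonneg) (simp add: vol_nonneg E_def)
    ultimately show ?thesis by simp
  qed
  with * show ?thesis by simp
qed

text \<open>By \<open>det_hessian_rho\<close>, (1 - t) det H is exp (n g) times the Hessian
  determinant of \<rho>. Against exp (- (n + \<epsilon>) g) only exp (- \<epsilon> g) = (-
  \<rho>)^\<epsilon> survives, the weight of the hypothesis.\<close>

lemma integrable_of_Monge_Ampere_mass:
  assumes "MA_moment \<epsilon> < \<infinity>"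
  shows "integrable lborel (\<lambda>z. vol z * ((1 - grad_g_sq z) * exp (- (real CARD('n) + \<epsilon>) * g z)))"
proof -
  \<comment> \<open>The normalization of the wedge power. As it is at least 1, finiteness of the
    integral of \<open>C * ?h\<close> passes to \<open>?h\<close> by comparison.\<close>
  define C where "C = (2 ^ CARD('n) * fact CARD('n) :: real)"
  have C: "C \<ge> 1"
    using mult_mono[of 1 "2 ^ CARD('n)" 1 "fact CARD('n) :: real"] by (simp add: C_def fact_ge_1)
  let ?h = "\<lambda>z. vol z * ((1 - grad_g_sq z) * exp (- (real CARD('n) + \<epsilon>) * g z))"
  let ?P = "\<lambda>z. Re (det (complex_hessian \<rho> z))"
  have h0: "0 \<le> ?h z" for z
    using vol_nonneg[of z] grad_g_sq_bounds[of z] by (cases "z \<in> \<Omega>") (auto simp: vol_def)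
  have meas: "?h \<in> borel_measurable lborel"
    by (intro measurable_vol_mult continuous_intros continuous_on_g continuous_on_grad_g_sq)
  have PD: "pos_def_matrix (complex_hessian \<rho> z)" if "z \<in> \<Omega>" for z
    using strictly_psh that by (simp add: smooth_strictly_psh_on_def)
  have dens: "wedge_power_measure \<Omega> (ddc \<rho>) = density lborel (\<lambda>z. ennreal (indicator \<Omega> z *\<^sub>R (C * ?P z)))"
    unfolding wedge_power_measure_def
  proof (intro arg_cong[where f = "density lborel"] ext)
    show "ennreal (top_wedge_power (ddc \<rho> z)) * indicator \<Omega> z = ennreal (indicator \<Omega> z *\<^sub>R (C * ?P z))" for z
      by (cases "z \<in> \<Omega>")
        (simp_all add: ddc_def top_wedge_power_fundamental_form[OF pos_def_matrix_hermitian[OF PD]] C_def)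
  qed
  have cP: "continuous_on \<Omega> (\<lambda>z. C * ?P z)"
    by (intro continuous_on_mult continuous_on_const continuous_on_Re smooth_on_imp_continuous_on
        smooth_on_det smooth_on_complex_hessian open_domain smooth_rho)
  have m1: "(\<lambda>z. ennreal (indicator \<Omega> z *\<^sub>R (C * ?P z))) \<in> borel_measurable lborel"
    using borel_measurable_continuous_on_indicator[OF _ cP] open_domain by simp
  have ce: "continuous_on \<Omega> (\<lambda>z. exp (- \<epsilon> * g z))"
    by (intro continuous_intros continuous_on_g)
  have pw: "(- \<rho> z) powr \<epsilon> = exp (- \<epsilon> * g z)" if "z \<in> \<Omega>" for z
    using rho_eq[OF that] by (simp add: powr_def)
  have "(\<lambda>z. ennreal (indicator \<Omega> z *\<^sub>R exp (- \<epsilon> * g z))) \<in> borel_measurable lborel"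
    using borel_measurable_continuous_on_indicator[OF _ ce] open_domain by simp
  moreover have ind: "ennreal ((- \<rho> z) powr \<epsilon>) * indicator \<Omega> z = ennreal (indicator \<Omega> z *\<^sub>R exp (- \<epsilon> * g z))" for z
    by (cases "z \<in> \<Omega>") (simp_all add: pw)
  ultimately have "MA_moment \<epsilon>
    = (\<integral>\<^sup>+ z. ennreal (indicator \<Omega> z *\<^sub>R (C * ?P z)) * ennreal (indicator \<Omega> z *\<^sub>R exp (- \<epsilon> * g z)) \<partial>lborel)"
    unfolding dens ind by (subst nn_integral_density[OF m1]) auto
  also have "\<dots> = (\<integral>\<^sup>+ z. ennreal (C * ?h z) \<partial>lborel)"
  proof (rule nn_integral_cong)
    fix z
    show "ennreal (indicator \<Omega> z *\<^sub>R (C * ?P z)) * ennreal (indicator \<Omega> z *\<^sub>R exp (- \<epsilon> * g z)) = ennreal (C * ?h z)"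
    proof (cases "z \<in> \<Omega>")
      case True
      have "?h z = ?P z * exp (real CARD('n) * g z) * exp (- (real CARD('n) + \<epsilon>) * g z)"
        using det_hessian_rho[OF True] True by (simp add: vol_def)
      also have "\<dots> = ?P z * exp (- \<epsilon> * g z)"
        by (simp add: mult.assoc exp_add[symmetric] algebra_simps)
      finally show ?thesis
        using True by (simp add: ennreal_mult''[symmetric] mult.assoc)
    qed (simp add: vol_def)
  qed
  finally have "(\<integral>\<^sup>+ z. ennreal (C * ?h z) \<partial>lborel) < \<infinity>"
    using assms by simp
  moreover have "(\<integral>\<^sup>+ z. ennreal (?h z) \<partial>lborel) \<le> (\<integral>\<^sup>+ z. ennreal (C * ?h z) \<partial>lborel)"
  proof (intro nn_integral_mono ennreal_leI)
    show "?h z \<le> C * ?h z" for z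
      using mult_right_mono[OF C h0[of z]] by simp
  qed
  ultimately have "(\<integral>\<^sup>+ z. ennreal (?h z) \<partial>lborel) < \<infinity>"
    by (rule order_le_less_trans[rotated])
  then show ?thesis
    using h0 meas by (intro integrableI_nonneg) auto
qed

text \<open>If the bottom exceeded n^2, some r would lie strictly between n and its square root; the
  upper bound with s = r/2 and \<epsilon> = r - n would then make the bottom at most r^2.\<close>

lemma bottom_spectrum_eq_sq:
  assumes "\<And>\<epsilon>. \<epsilon> > 0 \<Longrightarrow> MA_moment \<epsilon> < \<infinity>"
  shows "bottom_spectrum \<Omega> H = (real CARD('n))\<^sup>2"
proof (rule antisym[OF _ bottom_spectrum_ge], rule ccontr)
  assume "\<not> bottom_spectrum \<Omega> H \<le> (real CARD('n))\<^sup>2"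
  then have "real CARD('n) < sqrt (bottom_spectrum \<Omega> H)"
    by (simp add: real_less_rsqrt)
  then obtain r where r: "real CARD('n) < r" "r < sqrt (bottom_spectrum \<Omega> H)"
    using dense by blast
  have "bottom_spectrum \<Omega> H \<le> 4 * (r / 2)\<^sup>2"
    using bottom_spectrum_le_4_sq[of "r / 2"] integrable_of_Monge_Ampere_mass[OF assms, of "r - real CARD('n)"] r
    by simp
  then have "bottom_spectrum \<Omega> H \<le> r\<^sup>2"
    by (simp add: power_divide)
  moreover have "r\<^sup>2 < bottom_spectrum \<Omega> H"
  proof -
    have "0 \<le> r" using r(1) of_nat_0_le_iff[of "CARD('n)"] by linarith
    then show ?thesis
      using r(2) by (metis not_le real_le_lsqrt)
  qed
  ultimately show False by simp
qed

end

theorem theorem1p2: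
  fixes \<Omega> :: "(complex^'n::finite) set"
    and \<rho> g :: "complex^'n \<Rightarrow> real"
  assumes "open \<Omega>" and "connected \<Omega>" and "\<Omega> \<noteq> {}" and "bounded \<Omega>"
    and "smooth_strictly_psh_on \<Omega> \<rho>"
    and "exhaustion_function_on \<Omega> \<rho>"
    and "\<And>z. z \<in> \<Omega> \<Longrightarrow> g z = - ln (- \<rho> z)"
  shows "((\<forall>\<epsilon>>0. (\<integral>\<^sup>+ z\<in>\<Omega>. ennreal ((- \<rho> z) powr \<epsilon>) \<partial>(wedge_power_measure \<Omega> (ddc \<rho>))) < \<infinity>)
           \<longrightarrow> complete_hermitian_metric \<Omega> (complex_hessian g)
             \<and> bottom_spectrum \<Omega> (complex_hessian g) = (real CARD('n))\<^sup>2)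
       \<and> (emeasure (wedge_power_measure \<Omega> (ddc \<rho>)) \<Omega> < \<infinity>
           \<longrightarrow> complete_hermitian_metric \<Omega> (complex_hessian g)
             \<and> bottom_spectrum \<Omega> (complex_hessian g) = (real CARD('n))\<^sup>2)"
proof -
  interpret psh_exhaustion \<Omega> \<rho> g
    using assms by unfold_locales auto
  \<comment> \<open>Since 0 < - \<rho> \<le> 1, every positive power of - \<rho> is at most 1, so
    each moment is bounded by the total mass.\<close>
  have mass: "(\<integral>\<^sup>+ z\<in>\<Omega>. ennreal ((- \<rho> z) powr \<epsilon>) \<partial>(wedge_power_measure \<Omega> (ddc \<rho>))) < \<infinity>"
    if fin: "emeasure (wedge_power_measure \<Omega> (ddc \<rho>)) \<Omega> < \<infinity>" and \<epsilon>: "\<epsilon> > 0" for \<epsilon>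
  proof -
    have "(\<integral>\<^sup>+ z\<in>\<Omega>. ennreal ((- \<rho> z) powr \<epsilon>) \<partial>(wedge_power_measure \<Omega> (ddc \<rho>)))
      \<le> (\<integral>\<^sup>+ z. indicator \<Omega> z \<partial>(wedge_power_measure \<Omega> (ddc \<rho>)))"
    proof (rule nn_integral_mono)
      fix z
      show "ennreal ((- \<rho> z) powr \<epsilon>) * indicator \<Omega> z \<le> indicator \<Omega> z"
      proof (cases "z \<in> \<Omega>")
        case True
        then have "(- \<rho> z) powr \<epsilon> \<le> 1 powr \<epsilon>"
          using rho_neg rho_ge \<epsilon> by (intro powr_mono2) force+
        then show ?thesis using True by (simp add: ennreal_le_1)
      qed simp
    qed
    also have "\<dots> = emeasure (wedge_power_measure \<Omega> (ddc \<rho>)) \<Omega>"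
      using assms(1) by (intro nn_integral_indicator) (simp add: wedge_power_measure_def)
    finally show ?thesis using fin by (rule order_le_less_trans)
  qed
  show ?thesis
    using complete bottom_spectrum_eq_sq mass by blast
qed

end
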